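(* Assume that $\Gamma$ contains at least two touching (adjacent) sides of the rectangle $\Omega$. Then the wave equation with observation $\frac{\partial u}{\partial n}\big|_\Gamma$ is exactly observable, meaning that there exist constants $c=c(\Gamma,\|C_0\|)>0$ and $T_0=T_0(\Gamma,\|C_0\|)>0$ such that the inequality $$c\Big(\lVert\nabla u_0\rVert_{L^2(\Omega)}^2+\lVert v_0\rVert_{L^2(\Omega)}^2\Big)\le\int_0^T\int_\Gamma\Big|\frac{\partial u}{\partial n}\Big|^2ds(x)\,dt$$ holds for all $(u_0,v_0)\in(H^2(\Omega)\cap H_0^1(\Omega))\times H_0^1(\Omega)$ and all $T\ge T_0$, where $u$ is the solution of the wave equation with initial data $(u_0,v_0)$.
   Context: Let $a,b>0$, $\Omega=(0,a\pi)\times(0,b\pi)$, with boundary $\partial\Omega$ and outward unit normal $n$. Let $\Gamma$ be a nonempty open subset of $\partial\Omega$. The wave equation is $$\ddot u-\Delta u=0\ \text{ in }\Omega\times(0,\infty),\qquad u=0\ \text{ on }\partial\Omega\times\mathbb{R}_+,\qquad u(\cdot,0)=u_0,\ \dot u(\cdot,0)=v_0.$$ The observation operator $C_0:H^2(\Omega)\cap H_0^1(\Omega)\to L^2(\Gamma)$, $C_0u=\frac{\partial u}{\partial n}\big|_\Gamma$, is bounded, where the domain $D(-\Delta)=H^2(\Omega)\cap H_0^1(\Omega)$ of the Dirichlet Laplacian carries the norm $\|\Delta u\|_{L^2(\Omega)}$; $\|C_0\|$ denotes its operator norm. *)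

theory Defs
  imports "HOL-Analysis.Analysis"
begin

text \<open>
  Elements of function spaces are represented by functions on the whole plane; only their values
  almost everywhere on the domain matter. Scalars are complex, which contains the real case.
\<close>

definition L2 :: "'a measure \<Rightarrow> ('a \<Rightarrow> complex) set" where
  "L2 M = {f. f \<in> borel_measurable M \<and> integrable M (\<lambda>x. (cmod (f x))\<^sup>2)}"

definition L2_norm :: "'a measure \<Rightarrow> ('a \<Rightarrow> complex) \<Rightarrow> real" where
  "L2_norm M f = sqrt (\<integral>x. (cmod (f x))\<^sup>2 \<partial>M)"

primrec C_k :: "nat \<Rightarrow> (real \<times> real \<Rightarrow> complex) \<Rightarrow> bool" where
  "C_k 0 f \<longleftrightarrow> continuous_on UNIV f"
| "C_k (Suc k) f \<longleftrightarrow> (\<forall>x. f differentiable (at x)) \<and>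
     (\<forall>e\<in>Basis. C_k k (\<lambda>x. frechet_derivative f (at x) e))"

definition smooth :: "(real \<times> real \<Rightarrow> complex) \<Rightarrow> bool" where
  "smooth f \<longleftrightarrow> (\<forall>k. C_k k f)"

definition test_functions :: "(real \<times> real) set \<Rightarrow> (real \<times> real \<Rightarrow> complex) set" where
  "test_functions \<Omega> = {\<phi>. smooth \<phi> \<and> (\<exists>K. compact K \<and> K \<subseteq> \<Omega> \<and> (\<forall>x. x \<notin> K \<longrightarrow> \<phi> x = 0))}"

definition has_weak_partial ::
  "(real \<times> real) set \<Rightarrow> real \<times> real \<Rightarrow> (real \<times> real \<Rightarrow> complex) \<Rightarrow> (real \<times> real \<Rightarrow> complex) \<Rightarrow> bool" where
  "has_weak_partial \<Omega> e u g \<longleftrightarrow> u \<in> L2 (lebesgue_on \<Omega>) \<and> g \<in> L2 (lebesgue_on \<Omega>) \<and>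
     (\<forall>\<phi>\<in>test_functions \<Omega>.
        (\<integral>x. u x * frechet_derivative \<phi> (at x) e \<partial>lebesgue_on \<Omega>)
          = - (\<integral>x. g x * \<phi> x \<partial>lebesgue_on \<Omega>))"

text \<open>Determined up to a null set, whenever it exists.\<close>
definition weak_partial ::
  "(real \<times> real) set \<Rightarrow> real \<times> real \<Rightarrow> (real \<times> real \<Rightarrow> complex) \<Rightarrow> real \<times> real \<Rightarrow> complex" where
  "weak_partial \<Omega> e u = (SOME g. has_weak_partial \<Omega> e u g)"

definition grad_norm :: "(real \<times> real) set \<Rightarrow> (real \<times> real \<Rightarrow> complex) \<Rightarrow> real" where
  "grad_norm \<Omega> u = sqrt (\<Sum>e\<in>Basis. (L2_norm (lebesgue_on \<Omega>) (weak_partial \<Omega> e u))\<^sup>2)"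

definition laplacian :: "(real \<times> real) set \<Rightarrow> (real \<times> real \<Rightarrow> complex) \<Rightarrow> real \<times> real \<Rightarrow> complex" where
  "laplacian \<Omega> u x = (\<Sum>e\<in>Basis. weak_partial \<Omega> e (weak_partial \<Omega> e u) x)"

definition H1 :: "(real \<times> real) set \<Rightarrow> (real \<times> real \<Rightarrow> complex) set" where
  "H1 \<Omega> = {u. u \<in> L2 (lebesgue_on \<Omega>) \<and> (\<forall>e\<in>Basis. \<exists>g. has_weak_partial \<Omega> e u g)}"

definition H1_norm :: "(real \<times> real) set \<Rightarrow> (real \<times> real \<Rightarrow> complex) \<Rightarrow> real" where
  "H1_norm \<Omega> u = sqrt ((L2_norm (lebesgue_on \<Omega>) u)\<^sup>2 + (grad_norm \<Omega> u)\<^sup>2)"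

definition H2 :: "(real \<times> real) set \<Rightarrow> (real \<times> real \<Rightarrow> complex) set" where
  "H2 \<Omega> = {u. u \<in> H1 \<Omega> \<and> (\<forall>e\<in>Basis. weak_partial \<Omega> e u \<in> H1 \<Omega>)}"

definition H10 :: "(real \<times> real) set \<Rightarrow> (real \<times> real \<Rightarrow> complex) set" where
  "H10 \<Omega> = {u. u \<in> H1 \<Omega> \<and> (\<exists>\<phi>. (\<forall>n::nat. \<phi> n \<in> test_functions \<Omega>) \<and>
      (\<lambda>n. H1_norm \<Omega> (\<lambda>x. \<phi> n x - u x)) \<longlonglongrightarrow> 0)}"

definition dom_laplacian :: "(real \<times> real) set \<Rightarrow> (real \<times> real \<Rightarrow> complex) set" where
  "dom_laplacian \<Omega> = H2 \<Omega> \<inter> H10 \<Omega>"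

definition dom_norm :: "(real \<times> real) set \<Rightarrow> (real \<times> real \<Rightarrow> complex) \<Rightarrow> real" where
  "dom_norm \<Omega> u = L2_norm (lebesgue_on \<Omega>) (laplacian \<Omega> u)"

definition rectangle :: "real \<Rightarrow> real \<Rightarrow> (real \<times> real) set" where
  "rectangle a b = {0<..<a * pi} \<times> {0<..<b * pi}"

text \<open>Counterclockwise parametrization of the boundary by arc length, starting at the origin.\<close>
definition boundary_param :: "real \<Rightarrow> real \<Rightarrow> real \<Rightarrow> real \<times> real" where
  "boundary_param a b s =
     (if s < a * pi then (s, 0)
      else if s < (a + b) * pi then (a * pi, s - a * pi)
      else if s < (2 * a + b) * pi then ((2 * a + b) * pi - s, b * pi)
      else (0, 2 * (a + b) * pi - s))"

text \<open>The length measure \<open>ds\<close> on the boundary.\<close>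
definition boundary_measure :: "real \<Rightarrow> real \<Rightarrow> (real \<times> real) measure" where
  "boundary_measure a b =
     distr (restrict_space lborel {0..<2 * (a + b) * pi}) borel (boundary_param a b)"

text \<open>The values at the four corners, a null set, are immaterial.\<close>
definition outward_normal :: "real \<Rightarrow> real \<Rightarrow> real \<times> real \<Rightarrow> real \<times> real" where
  "outward_normal a b p =
     (if fst p = 0 then (-1, 0) else if fst p = a * pi then (1, 0)
      else if snd p = 0 then (0, -1) else (0, 1))"

definition has_boundary_trace ::
  "real \<Rightarrow> real \<Rightarrow> (real \<times> real \<Rightarrow> complex) \<Rightarrow> (real \<times> real \<Rightarrow> complex) \<Rightarrow> bool" where
  "has_boundary_trace a b w g \<longleftrightarrow> w \<in> H1 (rectangle a b) \<and> g \<in> L2 (boundary_measure a b) \<and>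
     (\<exists>\<phi>. (\<forall>n::nat. smooth (\<phi> n)) \<and>
        (\<lambda>n. H1_norm (rectangle a b) (\<lambda>x. \<phi> n x - w x)) \<longlonglongrightarrow> 0 \<and>
        (\<lambda>n. L2_norm (boundary_measure a b) (\<lambda>x. \<phi> n x - g x)) \<longlonglongrightarrow> 0)"

definition boundary_trace :: "real \<Rightarrow> real \<Rightarrow> (real \<times> real \<Rightarrow> complex) \<Rightarrow> real \<times> real \<Rightarrow> complex" where
  "boundary_trace a b w = (SOME g. has_boundary_trace a b w g)"

definition normal_derivative ::
  "real \<Rightarrow> real \<Rightarrow> (real \<times> real \<Rightarrow> complex) \<Rightarrow> real \<times> real \<Rightarrow> complex" where
  "normal_derivative a b u p =
     (\<Sum>e\<in>Basis. (outward_normal a b p \<bullet> e) *\<^sub>R boundary_trace a b (weak_partial (rectangle a b) e u) p)"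

definition observation_sq ::
  "real \<Rightarrow> real \<Rightarrow> (real \<times> real) set \<Rightarrow> (real \<times> real \<Rightarrow> complex) \<Rightarrow> real" where
  "observation_sq a b \<Gamma> u =
     (LINT p:\<Gamma>|boundary_measure a b. (cmod (normal_derivative a b u p))\<^sup>2)"

text \<open>Operator norm of \<open>u \<mapsto> \<partial>u/\<partial>n\<close> from the domain of the Laplacian to \<open>L\<^sup>2(\<Gamma>)\<close>.\<close>
definition observation_norm :: "real \<Rightarrow> real \<Rightarrow> (real \<times> real) set \<Rightarrow> real" where
  "observation_norm a b \<Gamma> =
     Inf {K. 0 \<le> K \<and> (\<forall>u\<in>dom_laplacian (rectangle a b).
       sqrt (observation_sq a b \<Gamma> u) \<le> K * dom_norm (rectangle a b) u)}"

text \<open>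
  The sides are taken without their end points, so that the hypothesis on \<open>\<Gamma>\<close> is the least
  restrictive one: the common corner need not belong to \<open>\<Gamma>\<close>. Two sides touch if and only if one is
  horizontal and the other vertical.
\<close>
definition horizontal_sides :: "real \<Rightarrow> real \<Rightarrow> (real \<times> real) set set" where
  "horizontal_sides a b = {{0<..<a * pi} \<times> {0}, {0<..<a * pi} \<times> {b * pi}}"

definition vertical_sides :: "real \<Rightarrow> real \<Rightarrow> (real \<times> real) set set" where
  "vertical_sides a b = {{0} \<times> {0<..<b * pi}, {a * pi} \<times> {0<..<b * pi}}"

definition contains_touching_sides :: "real \<Rightarrow> real \<Rightarrow> (real \<times> real) set \<Rightarrow> bool" where
  "contains_touching_sides a b \<Gamma> \<longleftrightarrow>
     (\<exists>S\<in>horizontal_sides a b. \<exists>S'\<in>vertical_sides a b. S \<subseteq> \<Gamma> \<and> S' \<subseteq> \<Gamma>)"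

text \<open>Continuity and differentiability on \<open>[0,\<infinity>)\<close> of curves of functions, in a given norm.\<close>
definition continuous_in ::
  "(('a \<Rightarrow> complex) \<Rightarrow> real) \<Rightarrow> (real \<Rightarrow> 'a \<Rightarrow> complex) \<Rightarrow> bool" where
  "continuous_in N u \<longleftrightarrow>
     (\<forall>t\<ge>0. ((\<lambda>s. N (\<lambda>x. u s x - u t x)) \<longlongrightarrow> 0) (at t within {0..}))"

definition has_derivative_in ::
  "(('a \<Rightarrow> complex) \<Rightarrow> real) \<Rightarrow> (real \<Rightarrow> 'a \<Rightarrow> complex) \<Rightarrow> (real \<Rightarrow> 'a \<Rightarrow> complex) \<Rightarrow> bool" where
  "has_derivative_in N u v \<longleftrightarrow>
     (\<forall>t\<ge>0. ((\<lambda>s. N (\<lambda>x. (u s x - u t x) /\<^sub>R (s - t) - v t x)) \<longlongrightarrow> 0) (at t within {0..}))"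

text \<open>
  The classical solution given by semigroup theory for data in \<open>(H\<^sup>2 \<inter> H\<^sup>1\<^sub>0) \<times> H\<^sup>1\<^sub>0\<close>:
  \<open>u \<in> C([0,\<infinity>); H\<^sup>2 \<inter> H\<^sup>1\<^sub>0) \<inter> C\<^sup>1([0,\<infinity>); H\<^sup>1\<^sub>0) \<inter> C\<^sup>2([0,\<infinity>); L\<^sup>2)\<close>,
  with the equation holding in \<open>L\<^sup>2\<close> at every time; \<open>v\<close> and \<open>w\<close> are the first two time derivatives.
\<close>
definition wave_solution ::
  "(real \<times> real) set \<Rightarrow> (real \<times> real \<Rightarrow> complex) \<Rightarrow> (real \<times> real \<Rightarrow> complex)
     \<Rightarrow> (real \<Rightarrow> real \<times> real \<Rightarrow> complex) \<Rightarrow> bool" where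
  "wave_solution \<Omega> u0 v0 u \<longleftrightarrow> (\<exists>v w.
     (\<forall>t\<ge>0. u t \<in> dom_laplacian \<Omega> \<and> v t \<in> H10 \<Omega> \<and> w t \<in> L2 (lebesgue_on \<Omega>)) \<and>
     continuous_in (dom_norm \<Omega>) u \<and>
     has_derivative_in (H1_norm \<Omega>) u v \<and> continuous_in (H1_norm \<Omega>) v \<and>
     has_derivative_in (L2_norm (lebesgue_on \<Omega>)) v w \<and>
     continuous_in (L2_norm (lebesgue_on \<Omega>)) w \<and>
     (\<forall>t\<ge>0. AE x in lebesgue_on \<Omega>. w t x = laplacian \<Omega> (u t) x) \<and>
     (AE x in lebesgue_on \<Omega>. u 0 x = u0 x) \<and>
     (AE x in lebesgue_on \<Omega>. v 0 x = v0 x))"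

end

theory Submission
  imports Defs "HOL-Real_Asymp.Real_Asymp"
begin

text \<open>
  The proof combines the multiplier method with Fourier series. Let \<open>m = (x - x\<^sub>0, y - y\<^sub>0)\<close>, where
  \<open>(x\<^sub>0, y\<^sub>0)\<close> is the corner opposite to the corner that the two observed sides share. Then \<open>m \<bullet> n\<close>
  vanishes on the two sides that need not be observed, and on the other two it is one of the side lengths
  \<open>A = a \<pi>\<close> and \<open>B = b \<pi>\<close>. For a smooth solution \<open>U\<close> with velocity \<open>V\<close>, put
  \<open>\<Xi>(t) = \<integral> V (2 m \<bullet> \<nabla>U + U)\<close>. Rellich's identity, applied to \<open>\<integral> 2 \<Delta>U (m \<bullet> \<nabla>U)\<close>, gives
  \<open>\<Xi>'(t) = \<integral> (m \<bullet> n) \<bar>\<partial>U/\<partial>n\<bar>\<^sup>2 ds - E\<close>, where the integral is over the boundary and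
  \<open>E = \<parallel>\<nabla>U\<parallel>\<^sup>2 + \<parallel>V\<parallel>\<^sup>2\<close> is constant in time. Since
  \<open>\<bar>\<Xi>\<bar> \<le> 2 (A + B) E\<close>, integration over \<open>[0, T]\<close> yields
  \<open>(T - 4 (A + B)) E \<le> (A + B) \<integral>\<integral> \<bar>\<partial>U/\<partial>n\<bar>\<^sup>2\<close> with the integral over \<open>[0, T] \<times> \<Gamma>\<close>, so that
  \<open>T\<^sub>0 = 4 (A + B) + 1\<close> and \<open>c = 1 / (A + B)\<close> will do. These depend on \<open>\<Gamma>\<close> only, because \<open>A\<close> and \<open>B\<close> are
  the suprema of the coordinates on \<open>\<Gamma>\<close> (\<open>touching_sides_determine_rectangle\<close>).

  The argument is carried out for sine polynomials (\<open>Rellich_identity\<close>, \<open>finite_observability\<close>), where all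
  integrations by parts are classical. For a general solution \<open>u\<close>, the sine coefficients of \<open>u(t)\<close> satisfy
  \<open>c'' = - \<lambda> c\<close> (\<open>fc_laplacian\<close>, \<open>wave_coefficients\<close>), so that every partial sum of the sine series is again a
  solution. What remains is the passage to the limit, which needs three facts about the partial sums
  \<open>u\<^sub>N\<close> of a function \<open>u\<close> in the domain of the Laplacian.

  \<^item> The sine system is complete (\<open>sine_system_total\<close>), by the Stone--Weierstrass theorem.

  \<^item> All derivatives of \<open>u\<^sub>N\<close> up to order two converge in \<open>L\<^sup>2\<close> to the weak derivatives of \<open>u\<close>
    (\<open>fourier_gradient_tendsto\<close>, \<open>fourier_hessian_tendsto\<close>): their coefficients are dominated by those of
    \<open>\<Delta>u\<close>.

  \<^item> Hence the normal derivatives converge in \<open>L\<^sup>2\<close> of the boundary (\<open>normal_sum_tendsto\<close>), by a trace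
    inequality for smooth functions (\<open>trace_inequality\<close>). They are bounded by a multiple of \<open>\<parallel>\<Delta>u\<parallel>\<close>, which is
    what dominated convergence in time requires.
\<close>

section \<open>Square integrable functions\<close>

lemma L2_measurable [measurable_dest]: "f \<in> L2 M \<Longrightarrow> f \<in> borel_measurable M"
  by (simp add: L2_def)

lemma L2_integrable_sq: "f \<in> L2 M \<Longrightarrow> integrable M (\<lambda>x. (cmod (f x))\<^sup>2)"
  by (simp add: L2_def)

lemma L2_norm_nonneg [simp]: "0 \<le> L2_norm M f"
  by (simp add: L2_norm_def)

lemma L2_norm_sq: "(L2_norm M f)\<^sup>2 = (\<integral>x. (cmod (f x))\<^sup>2 \<partial>M)"
  by (simp add: L2_norm_def)

lemma L2_zero [simp]: "(\<lambda>x. 0) \<in> L2 M"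
  by (simp add: L2_def)

lemma L2_mult_const:
  assumes "f \<in> L2 M" shows "(\<lambda>x. c * f x) \<in> L2 M"
  using assms unfolding L2_def by (auto simp: norm_mult power_mult_distrib)

lemma L2_add:
  assumes f: "f \<in> L2 M" and g: "g \<in> L2 M" shows "(\<lambda>x. f x + g x) \<in> L2 M"
proof -
  have [measurable]: "f \<in> borel_measurable M" "g \<in> borel_measurable M"
    using f g by (auto simp: L2_def)
  have "integrable M (\<lambda>x. 2 * (cmod (f x))\<^sup>2 + 2 * (cmod (g x))\<^sup>2)"
    using f g by (auto simp: L2_def)
  then have "integrable M (\<lambda>x. (cmod (f x + g x))\<^sup>2)"
  proof (rule Bochner_Integration.integrable_bound)
    show "AE x in M. norm ((cmod (f x + g x))\<^sup>2) \<le> norm (2 * (cmod (f x))\<^sup>2 + 2 * (cmod (g x))\<^sup>2)"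
    proof (rule AE_I2)
      fix x
      have "(cmod (f x + g x))\<^sup>2 \<le> (cmod (f x) + cmod (g x))\<^sup>2"
        by (intro power_mono norm_triangle_ineq) auto
      also have "\<dots> \<le> 2 * (cmod (f x))\<^sup>2 + 2 * (cmod (g x))\<^sup>2"
        using sum_squares_bound[of "cmod (f x)" "cmod (g x)"] by (simp add: power2_sum)
      finally show "norm ((cmod (f x + g x))\<^sup>2) \<le> norm (2 * (cmod (f x))\<^sup>2 + 2 * (cmod (g x))\<^sup>2)"
        by simp
    qed
  qed simp
  then show ?thesis by (simp add: L2_def)
qed

lemma L2_diff: "f \<in> L2 M \<Longrightarrow> g \<in> L2 M \<Longrightarrow> (\<lambda>x. f x - g x) \<in> L2 M"
  using L2_add[of f M "\<lambda>x. (-1) * g x"] L2_mult_const[of g M "-1"] by simp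

lemma L2_sum: "(\<And>i. i \<in> I \<Longrightarrow> f i \<in> L2 M) \<Longrightarrow> (\<lambda>x. \<Sum>i\<in>I. f i x) \<in> L2 M"
  by (induction I rule: infinite_finite_induct) (auto intro: L2_add)

lemma L2_mult_integrable:
  assumes f: "f \<in> L2 M" and g: "g \<in> L2 M" shows "integrable M (\<lambda>x. f x * g x)"
proof -
  have [measurable]: "f \<in> borel_measurable M" "g \<in> borel_measurable M"
    using f g by (auto simp: L2_def)
  have "integrable M (\<lambda>x. (cmod (f x))\<^sup>2 + (cmod (g x))\<^sup>2)"
    using f g by (auto simp: L2_def)
  then show ?thesis
  proof (rule Bochner_Integration.integrable_bound)
    show "AE x in M. norm (f x * g x) \<le> norm ((cmod (f x))\<^sup>2 + (cmod (g x))\<^sup>2)"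
    proof (rule AE_I2)
      fix x
      show "norm (f x * g x) \<le> norm ((cmod (f x))\<^sup>2 + (cmod (g x))\<^sup>2)"
        using sum_squares_bound[of "cmod (f x)" "cmod (g x)"]
              zero_le_power2[of "cmod (f x)"] zero_le_power2[of "cmod (g x)"]
              mult_nonneg_nonneg[of "cmod (f x)" "cmod (g x)"]
        unfolding norm_mult real_norm_def by linarith
    qed
  qed simp
qed

text \<open>Cauchy--Schwarz, from \<open>2 f g \<le> r f\<^sup>2 + g\<^sup>2 / r\<close> with the optimal \<open>r\<close>.\<close>
lemma L2_Cauchy_Schwarz:
  assumes f: "f \<in> L2 M" and g: "g \<in> L2 M"
  shows "(\<integral>x. cmod (f x * g x) \<partial>M) \<le> L2_norm M f * L2_norm M g"
proof -
  have *: "2 * (\<integral>x. cmod (f x * g x) \<partial>M) \<le> r * (L2_norm M f)\<^sup>2 + (L2_norm M g)\<^sup>2 / r" if r: "r > 0" for r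
  proof -
    have "2 * (\<integral>x. cmod (f x * g x) \<partial>M) = (\<integral>x. 2 * cmod (f x * g x) \<partial>M)" by simp
    also have "\<dots> \<le> (\<integral>x. r * (cmod (f x))\<^sup>2 + (cmod (g x))\<^sup>2 / r \<partial>M)"
    proof (rule integral_mono)
      show "integrable M (\<lambda>x. 2 * cmod (f x * g x))"
        using L2_mult_integrable[OF f g] by auto
      show "integrable M (\<lambda>x. r * (cmod (f x))\<^sup>2 + (cmod (g x))\<^sup>2 / r)"
        using f g by (auto simp: L2_def)
      fix x
      have "2 * (sqrt r * cmod (f x)) * (cmod (g x) / sqrt r) \<le> (sqrt r * cmod (f x))\<^sup>2 + (cmod (g x) / sqrt r)\<^sup>2"
        by (rule sum_squares_bound)
      then show "2 * cmod (f x * g x) \<le> r * (cmod (f x))\<^sup>2 + (cmod (g x))\<^sup>2 / r"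
        using r by (simp add: power_mult_distrib power_divide norm_mult)
    qed
    also have "\<dots> = r * (L2_norm M f)\<^sup>2 + (L2_norm M g)\<^sup>2 / r"
      using f g by (simp add: L2_def L2_norm_sq)
    finally show ?thesis .
  qed
  let ?I = "\<integral>x. cmod (f x * g x) \<partial>M" and ?F = "L2_norm M f" and ?G = "L2_norm M g"
  show ?thesis
  proof (cases "?F = 0 \<or> ?G = 0")
    case False
    then have "?F > 0" "?G > 0" by (simp_all add: less_le)
    then show ?thesis using *[of "?G / ?F"] by (simp add: power2_eq_square)
  next
    case True
    have "?I \<le> e" if e: "e > 0" for e
    proof (cases "?F = 0")
      case True
      let ?r = "(?G\<^sup>2 + 1) / e"
      have r: "?r > 0" using e by (auto intro!: divide_pos_pos add_nonneg_pos)
      have "2 * ?I \<le> ?G\<^sup>2 / ?r" using *[OF r] True by simp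
      also have "\<dots> = (?G\<^sup>2 / (?G\<^sup>2 + 1)) * e" using e by simp
      also have "\<dots> \<le> 1 * e" using e by (intro mult_right_mono) (auto simp: divide_le_eq add_nonneg_pos)
      finally show ?thesis using e by simp
    next
      case F: False
      with True have G: "?G = 0" by simp
      let ?r = "e / (?F\<^sup>2 + 1)"
      have r: "?r > 0" using e by (auto intro!: divide_pos_pos add_nonneg_pos)
      have "2 * ?I \<le> ?r * ?F\<^sup>2" using *[OF r] G by simp
      also have "\<dots> = (?F\<^sup>2 / (?F\<^sup>2 + 1)) * e" by simp
      also have "\<dots> \<le> 1 * e" using e by (intro mult_right_mono) (auto simp: divide_le_eq add_nonneg_pos)
      finally show ?thesis using e by simp
    qed
    then have "?I \<le> 0" by (rule field_le_epsilon[of _ 0, simplified])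
    with True show ?thesis by auto
  qed
qed

lemma L2_inner_bound:
  assumes f: "f \<in> L2 M" and g: "g \<in> L2 M"
  shows "cmod (\<integral>x. f x * g x \<partial>M) \<le> L2_norm M f * L2_norm M g"
  using integral_norm_bound[of M "\<lambda>x. f x * g x"] L2_Cauchy_Schwarz[OF f g] by linarith

lemma L2_norm_triangle:
  assumes f: "f \<in> L2 M" and g: "g \<in> L2 M"
  shows "L2_norm M (\<lambda>x. f x + g x) \<le> L2_norm M f + L2_norm M g"
proof (rule power2_le_imp_le)
  have "(L2_norm M (\<lambda>x. f x + g x))\<^sup>2 \<le> (\<integral>x. (cmod (f x))\<^sup>2 + (cmod (g x))\<^sup>2 + 2 * cmod (f x * g x) \<partial>M)"
    unfolding L2_norm_sq
  proof (rule integral_mono)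
    show "integrable M (\<lambda>x. (cmod (f x + g x))\<^sup>2)" using L2_add[OF f g] by (simp add: L2_def)
    show "integrable M (\<lambda>x. (cmod (f x))\<^sup>2 + (cmod (g x))\<^sup>2 + 2 * cmod (f x * g x))"
      using f g L2_mult_integrable[OF f g] by (auto simp: L2_def)
    fix x
    have "(cmod (f x + g x))\<^sup>2 \<le> (cmod (f x) + cmod (g x))\<^sup>2"
      by (intro power_mono norm_triangle_ineq) auto
    then show "(cmod (f x + g x))\<^sup>2 \<le> (cmod (f x))\<^sup>2 + (cmod (g x))\<^sup>2 + 2 * cmod (f x * g x)"
      by (simp add: power2_sum norm_mult)
  qed
  also have "\<dots> = (L2_norm M f)\<^sup>2 + (L2_norm M g)\<^sup>2 + 2 * (\<integral>x. cmod (f x * g x) \<partial>M)"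
    using f g L2_mult_integrable[OF f g] by (simp add: L2_def L2_norm_sq)
  also have "\<dots> \<le> (L2_norm M f + L2_norm M g)\<^sup>2"
    using L2_Cauchy_Schwarz[OF f g] by (simp add: power2_sum)
  finally show "(L2_norm M (\<lambda>x. f x + g x))\<^sup>2 \<le> (L2_norm M f + L2_norm M g)\<^sup>2" .
qed simp

lemma L2_norm_minus_commute: "L2_norm M (\<lambda>x. f x - g x) = L2_norm M (\<lambda>x. g x - f x)"
  by (simp add: L2_norm_def norm_minus_commute)

lemma L2_norm_diff_triangle:
  assumes "f \<in> L2 M" "g \<in> L2 M" "h \<in> L2 M"
  shows "L2_norm M (\<lambda>x. f x - h x) \<le> L2_norm M (\<lambda>x. f x - g x) + L2_norm M (\<lambda>x. g x - h x)"
  using L2_norm_triangle[of "\<lambda>x. f x - g x" M "\<lambda>x. g x - h x"] assms by (simp add: L2_diff)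

lemma L2_norm_abs_diff:
  assumes f: "f \<in> L2 M" and g: "g \<in> L2 M"
  shows "\<bar>L2_norm M f - L2_norm M g\<bar> \<le> L2_norm M (\<lambda>x. f x - g x)"
  using L2_norm_diff_triangle[OF f g L2_zero] L2_norm_diff_triangle[OF g f L2_zero]
    L2_norm_minus_commute[of M f g] by simp

lemma L2_norm_tendsto:
  assumes f: "\<And>n. f n \<in> L2 M" and g: "g \<in> L2 M"
    and "((\<lambda>n. L2_norm M (\<lambda>x. f n x - g x)) \<longlongrightarrow> 0) F"
  shows "((\<lambda>n. L2_norm M (f n)) \<longlongrightarrow> L2_norm M g) F"
proof (rule Lim_null[THEN iffD2], rule Lim_null_comparison[OF _ assms(3)])
  show "\<forall>\<^sub>F n in F. norm (L2_norm M (f n) - L2_norm M g) \<le> L2_norm M (\<lambda>x. f n x - g x)"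
    using L2_norm_abs_diff[OF f g] by auto
qed

lemma L2_inner_tendsto:
  assumes f: "\<forall>\<^sub>F n in F. f n \<in> L2 M" and g: "g \<in> L2 M" and h: "h \<in> L2 M"
    and lim: "((\<lambda>n. L2_norm M (\<lambda>x. f n x - g x)) \<longlongrightarrow> 0) F"
  shows "((\<lambda>n. \<integral>x. f n x * h x \<partial>M) \<longlongrightarrow> (\<integral>x. g x * h x \<partial>M)) F"
proof (rule Lim_null[THEN iffD2], rule Lim_null_comparison)
  show "((\<lambda>n. L2_norm M (\<lambda>x. f n x - g x) * L2_norm M h) \<longlongrightarrow> 0) F"
    using tendsto_mult_right[OF lim, of "L2_norm M h"] by simp
  show "\<forall>\<^sub>F n in F. norm ((\<integral>x. f n x * h x \<partial>M) - (\<integral>x. g x * h x \<partial>M))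
      \<le> L2_norm M (\<lambda>x. f n x - g x) * L2_norm M h"
  using f
  proof eventually_elim
    case (elim n)
    have "(\<integral>x. f n x * h x \<partial>M) - (\<integral>x. g x * h x \<partial>M) = (\<integral>x. (f n x - g x) * h x \<partial>M)"
      using L2_mult_integrable[OF elim h] L2_mult_integrable[OF g h]
      by (simp add: left_diff_distrib)
    then show ?case using L2_inner_bound[OF L2_diff[OF elim g] h] by simp
  qed
qed

lemma L2_norm_cong_AE:
  assumes "f \<in> borel_measurable M" "g \<in> borel_measurable M" "AE x in M. f x = g x"
  shows "L2_norm M f = L2_norm M g"
  unfolding L2_norm_def
  by (rule arg_cong[where f=sqrt], rule integral_cong_AE) (use assms in auto)

lemma L2_cong_AE:
  assumes f: "f \<in> L2 M" and g: "g \<in> borel_measurable M" and "AE x in M. f x = g x"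
  shows "g \<in> L2 M"
proof -
  have "integrable M (\<lambda>x. (cmod (g x))\<^sup>2)"
    by (rule Bochner_Integration.integrable_cong_AE_imp[OF L2_integrable_sq[OF f]])
       (use assms in auto)
  then show ?thesis using g by (simp add: L2_def)
qed

lemma bounded_imp_L2:
  assumes "finite_measure M" and [measurable]: "f \<in> borel_measurable M"
    and "\<And>x. x \<in> space M \<Longrightarrow> cmod (f x) \<le> B"
  shows "f \<in> L2 M"
proof -
  interpret finite_measure M by fact
  have "integrable M (\<lambda>x. (cmod (f x))\<^sup>2)"
    by (rule integrable_const_bound[where B="B\<^sup>2"])
       (auto intro!: AE_I2 power_mono assms)
  then show ?thesis by (simp add: L2_def)
qed

lemma L2_imp_integrable:
  assumes "finite_measure M" "f \<in> L2 M" shows "integrable M f"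
proof -
  interpret finite_measure M by fact
  have "(\<lambda>x. 1) \<in> L2 M" by (rule bounded_imp_L2[where B=1]) (auto intro: assms)
  from L2_mult_integrable[OF assms(2) this] show ?thesis by simp
qed

lemma L2_mult_bounded:
  assumes f: "f \<in> L2 M" and [measurable]: "g \<in> borel_measurable M"
    and B: "\<And>x. x \<in> space M \<Longrightarrow> cmod (g x) \<le> B"
  shows "(\<lambda>x. g x * f x) \<in> L2 M"
proof -
  have [measurable]: "f \<in> borel_measurable M" using f by (simp add: L2_def)
  have "integrable M (\<lambda>x. B\<^sup>2 * (cmod (f x))\<^sup>2)" using f by (simp add: L2_def)
  then have "integrable M (\<lambda>x. (cmod (g x * f x))\<^sup>2)"
    by (rule Bochner_Integration.integrable_bound)
       (auto intro!: AE_I2 mult_right_mono power_mono B simp: norm_mult power_mult_distrib)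
  then show ?thesis by (simp add: L2_def)
qed

lemma L2_norm_mult_bounded:
  assumes f: "f \<in> L2 M" and m [measurable]: "g \<in> borel_measurable M"
    and B: "\<And>x. x \<in> space M \<Longrightarrow> cmod (g x) \<le> B" and "B \<ge> 0"
  shows "L2_norm M (\<lambda>x. g x * f x) \<le> B * L2_norm M f"
proof -
  have "(L2_norm M (\<lambda>x. g x * f x))\<^sup>2 \<le> (\<integral>x. B\<^sup>2 * (cmod (f x))\<^sup>2 \<partial>M)"
    unfolding L2_norm_sq
  proof (rule integral_mono)
    show "integrable M (\<lambda>x. (cmod (g x * f x))\<^sup>2)" using L2_mult_bounded[OF f m B] by (simp add: L2_def)
    show "integrable M (\<lambda>x. B\<^sup>2 * (cmod (f x))\<^sup>2)" using f by (simp add: L2_def)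
  qed (auto intro!: mult_right_mono power_mono B simp: norm_mult power_mult_distrib)
  also have "\<dots> = (B * L2_norm M f)\<^sup>2" by (simp add: L2_norm_sq power_mult_distrib)
  finally show ?thesis by (rule power2_le_imp_le) (simp add: \<open>B \<ge> 0\<close>)
qed

text \<open>Riesz--Fischer: a subsequence with summable increments converges almost everywhere, and
  Fatou's lemma turns the Cauchy property into norm convergence to the pointwise limit.\<close>
lemma L2_complete:
  assumes fin: "finite_measure M" and f: "\<And>n::nat. f n \<in> L2 M"
    and Cauchy: "\<And>e. e > 0 \<Longrightarrow> \<exists>N. \<forall>m\<ge>N. \<forall>n\<ge>N. L2_norm M (\<lambda>x. f m x - f n x) < e"
  shows "\<exists>g\<in>L2 M. (\<lambda>n. L2_norm M (\<lambda>x. f n x - g x)) \<longlonglongrightarrow> 0"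
proof -
  interpret finite_measure M by fact
  have [measurable]: "\<And>n. f n \<in> borel_measurable M" using f by (auto simp: L2_def)
  define N where "N k = (SOME N. \<forall>m\<ge>N. \<forall>n\<ge>N. L2_norm M (\<lambda>x. f m x - f n x) < (1/2)^k)" for k :: nat
  have N: "L2_norm M (\<lambda>x. f m x - f n x) < (1/2)^k" if "m \<ge> N k" "n \<ge> N k" for m n k
    using someI_ex[OF Cauchy[of "(1/2)^k"]] that unfolding N_def by auto
  \<comment> \<open>The partial sums make the chosen indices increasing.\<close>
  define r where "r k = (\<Sum>i\<le>k. N i)" for k
  have r_ge: "r k \<ge> N k" for k unfolding r_def by (rule member_le_sum) auto
  have r_mono: "r k \<le> r l" if "k \<le> l" for k l
    unfolding r_def using that by (intro sum_mono2) auto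
  have h: "L2_norm M (\<lambda>x. f (r (Suc k)) x - f (r k) x) \<le> (1/2)^k" for k
    using N[of k "r (Suc k)" "r k"] r_ge[of k] r_mono[of k "Suc k"] by (simp add: less_imp_le order_trans)
  define D where "D k x = cmod (f (r (Suc k)) x - f (r k) x)" for k x
  have [measurable]: "\<And>k. D k \<in> borel_measurable M" unfolding D_def by measurable
  let ?C = "L2_norm M (\<lambda>x. 1)"
  have one: "(\<lambda>x. 1) \<in> L2 M" by (rule bounded_imp_L2[OF fin, where B=1]) auto
  have D_int: "integrable M (D k)" for k
    using L2_imp_integrable[OF fin L2_diff[OF f f, of "r (Suc k)" "r k"]] unfolding D_def by auto
  have D_le: "(\<integral>x. D k x \<partial>M) \<le> (1/2)^k * ?C" for k
  proof -
    have "(\<integral>x. D k x \<partial>M) \<le> L2_norm M (\<lambda>x. f (r (Suc k)) x - f (r k) x) * ?C"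
      using L2_Cauchy_Schwarz[OF L2_diff[OF f f, of "r (Suc k)" "r k"] one] unfolding D_def by simp
    also have "\<dots> \<le> (1/2)^k * ?C" using h[of k] by (intro mult_right_mono) auto
    finally show ?thesis .
  qed
  have "(\<integral>\<^sup>+x. (\<Sum>k. ennreal (D k x)) \<partial>M) = (\<Sum>k. \<integral>\<^sup>+x. ennreal (D k x) \<partial>M)"
    by (rule nn_integral_suminf) measurable
  also have "\<dots> = (\<Sum>k. ennreal (\<integral>x. D k x \<partial>M))"
    using D_int by (subst nn_integral_eq_integral) (auto simp: D_def)
  also have "\<dots> \<le> (\<Sum>k. ennreal ((1/2)^k * ?C))"
    by (intro suminf_le summableI ennreal_leI D_le)
  also have "\<dots> = ennreal (\<Sum>k. (1/2)^k * ?C)"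
    by (intro suminf_ennreal2 summable_mult2 summable_geometric) auto
  also have "\<dots> < \<infinity>" by simp
  finally have "AE x in M. (\<Sum>k. ennreal (D k x)) \<noteq> \<infinity>"
    by (intro nn_integral_noteq_infinite) auto
  then have AE_summable: "AE x in M. summable (\<lambda>k. f (r (Suc k)) x - f (r k) x)"
  proof eventually_elim
    case (elim x)
    have "summable (\<lambda>k. D k x)"
      by (rule summable_suminf_not_top) (use elim in \<open>auto simp: D_def\<close>)
    then show ?case unfolding D_def by (rule summable_norm_cancel)
  qed
  define g where "g x = lim (\<lambda>k. f (r k) x)" for x
  have [measurable]: "g \<in> borel_measurable M" unfolding g_def by measurable
  have AE_lim: "AE x in M. (\<lambda>k. f (r k) x) \<longlonglongrightarrow> g x"
    using AE_summable
  proof eventually_elim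
    case (elim x)
    have "convergent (\<lambda>n. (\<Sum>k<n. f (r (Suc k)) x - f (r k) x) + f (r 0) x)"
      using elim by (intro convergent_add convergent_const) (simp add: summable_iff_convergent)
    also have "(\<lambda>n. (\<Sum>k<n. f (r (Suc k)) x - f (r k) x) + f (r 0) x) = (\<lambda>n. f (r n) x)"
      using sum_lessThan_telescope[of "\<lambda>k. f (r k) x"] by (simp add: fun_eq_iff)
    finally show ?case unfolding g_def by (simp add: convergent_LIMSEQ_iff)
  qed
  have bound: "(\<integral>\<^sup>+x. ennreal ((cmod (g x - f n x))\<^sup>2) \<partial>M) \<le> ennreal (((1/2)^k)\<^sup>2)" if n: "n \<ge> N k" for n k
  proof -
    have "(\<integral>\<^sup>+x. ennreal ((cmod (g x - f n x))\<^sup>2) \<partial>M)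
        = (\<integral>\<^sup>+x. liminf (\<lambda>l. ennreal ((cmod (f (r l) x - f n x))\<^sup>2)) \<partial>M)"
    proof (rule nn_integral_cong_AE)
      show "AE x in M. ennreal ((cmod (g x - f n x))\<^sup>2) = liminf (\<lambda>l. ennreal ((cmod (f (r l) x - f n x))\<^sup>2))"
        using AE_lim
      proof eventually_elim
        case (elim x)
        have "(\<lambda>l. ennreal ((cmod (f (r l) x - f n x))\<^sup>2)) \<longlonglongrightarrow> ennreal ((cmod (g x - f n x))\<^sup>2)"
          by (intro tendsto_ennrealI tendsto_intros elim)
        from lim_imp_Liminf[OF _ this] show ?case by simp
      qed
    qed
    also have "\<dots> \<le> liminf (\<lambda>l. \<integral>\<^sup>+x. ennreal ((cmod (f (r l) x - f n x))\<^sup>2) \<partial>M)"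
      by (rule nn_integral_liminf) measurable
    also have "\<dots> \<le> ennreal (((1/2)^k)\<^sup>2)"
    proof (rule Liminf_le)
      show "\<forall>\<^sub>F l in sequentially. (\<integral>\<^sup>+x. ennreal ((cmod (f (r l) x - f n x))\<^sup>2) \<partial>M) \<le> ennreal (((1/2)^k)\<^sup>2)"
        using eventually_ge_at_top[of k]
      proof eventually_elim
        case (elim l)
        have "(\<integral>\<^sup>+x. ennreal ((cmod (f (r l) x - f n x))\<^sup>2) \<partial>M) = ennreal ((L2_norm M (\<lambda>x. f (r l) x - f n x))\<^sup>2)"
          unfolding L2_norm_sq
          by (rule nn_integral_eq_integral) (use L2_diff[OF f f] in \<open>auto simp: L2_def\<close>)
        also have "\<dots> \<le> ennreal (((1/2)^k)\<^sup>2)"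
          using N[of k "r l" n] n r_ge[of k] r_mono[OF elim]
          by (intro ennreal_leI power_mono) auto
        finally show ?case .
      qed
    qed simp
    finally show ?thesis .
  qed
  have diff_L2: "(\<lambda>x. g x - f n x) \<in> L2 M" if n: "n \<ge> N 0" for n
  proof -
    have "integrable M (\<lambda>x. (cmod (g x - f n x))\<^sup>2)"
      unfolding integrable_iff_bounded using bound[OF n] by (auto intro: le_less_trans)
    then show ?thesis by (simp add: L2_def)
  qed
  then have g: "g \<in> L2 M"
    using L2_add[OF diff_L2[of "N 0"] f[of "N 0"]] by simp
  have le: "L2_norm M (\<lambda>x. g x - f n x) \<le> (1/2)^k" if n: "n \<ge> N k" for n k
  proof (rule power2_le_imp_le)
    have "ennreal ((L2_norm M (\<lambda>x. g x - f n x))\<^sup>2) = (\<integral>\<^sup>+x. ennreal ((cmod (g x - f n x))\<^sup>2) \<partial>M)"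
      unfolding L2_norm_sq
      by (rule nn_integral_eq_integral[symmetric]) (use L2_diff[OF g f] in \<open>auto simp: L2_def\<close>)
    also have "\<dots> \<le> ennreal (((1/2)^k)\<^sup>2)" by (rule bound[OF n])
    finally show "(L2_norm M (\<lambda>x. g x - f n x))\<^sup>2 \<le> ((1/2)^k)\<^sup>2"
      by (subst (asm) ennreal_le_iff) auto
  qed simp
  have "(\<lambda>n. L2_norm M (\<lambda>x. f n x - g x)) \<longlonglongrightarrow> 0"
  proof (rule LIMSEQ_I)
    fix e :: real assume "e > 0"
    then obtain k where k: "(1/2)^k < e" using real_arch_pow_inv[of e "1/2"] by auto
    show "\<exists>no. \<forall>n\<ge>no. norm (L2_norm M (\<lambda>x. f n x - g x) - 0) < e"
    proof (intro exI[of _ "N k"] allI impI)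
      fix n assume "n \<ge> N k"
      then show "norm (L2_norm M (\<lambda>x. f n x - g x) - 0) < e"
        using le[of k n] k L2_norm_minus_commute[of M "f n" g] by simp
    qed
  qed
  with g show ?thesis by blast
qed

section \<open>Orthogonal systems\<close>

text \<open>The inner product is the real one on \<open>\<complex>\<close>; with real modes it only sees the coefficients, so
  quadratic quantities of a trigonometric sum are finite quadratic forms in its coefficients.\<close>
lemma inner_sums_integral:
  fixes \<alpha> \<beta> :: "'i \<Rightarrow> 'a \<Rightarrow> real" and c d :: "'i \<Rightarrow> complex"
  assumes int: "\<And>p q. p \<in> I \<Longrightarrow> q \<in> I \<Longrightarrow> integrable M (\<lambda>x. \<alpha> p x * \<beta> q x)"
  shows "integrable M (\<lambda>x. (\<Sum>p\<in>I. d p * of_real (\<alpha> p x)) \<bullet> (\<Sum>q\<in>I. c q * of_real (\<beta> q x)))"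
    and "(\<integral>x. (\<Sum>p\<in>I. d p * of_real (\<alpha> p x)) \<bullet> (\<Sum>q\<in>I. c q * of_real (\<beta> q x)) \<partial>M)
      = (\<Sum>p\<in>I. \<Sum>q\<in>I. (d p \<bullet> c q) * (\<integral>x. \<alpha> p x * \<beta> q x \<partial>M))"
proof -
  have *: "(\<Sum>p\<in>I. d p * of_real (\<alpha> p x)) \<bullet> (\<Sum>q\<in>I. c q * of_real (\<beta> q x))
      = (\<Sum>p\<in>I. \<Sum>q\<in>I. (d p \<bullet> c q) * (\<alpha> p x * \<beta> q x))" for x
  proof -
    have "(u * complex_of_real s) \<bullet> (v * complex_of_real t) = (u \<bullet> v) * (s * t)" for u v s t
      by (simp add: inner_complex_def algebra_simps)
    then show ?thesis by (simp add: inner_sum_left inner_sum_right) (rule sum.swap)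
  qed
  show "integrable M (\<lambda>x. (\<Sum>p\<in>I. d p * of_real (\<alpha> p x)) \<bullet> (\<Sum>q\<in>I. c q * of_real (\<beta> q x)))"
    unfolding * using int by auto
  show "(\<integral>x. (\<Sum>p\<in>I. d p * of_real (\<alpha> p x)) \<bullet> (\<Sum>q\<in>I. c q * of_real (\<beta> q x)) \<partial>M)
      = (\<Sum>p\<in>I. \<Sum>q\<in>I. (d p \<bullet> c q) * (\<integral>x. \<alpha> p x * \<beta> q x \<partial>M))"
    unfolding * using int by (simp add: Bochner_Integration.integral_sum integrable_sum)
qed

text \<open>The modes are real, so no conjugates appear in the coefficients, and they all have the same norm.\<close>
locale orthogonal_system =
  fixes M :: "'a measure" and e :: "'i \<Rightarrow> 'a \<Rightarrow> real" and J :: "'i set" and \<kappa> :: real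
  assumes fin: "finite_measure M" and e_L2: "\<And>p. (\<lambda>x. complex_of_real (e p x)) \<in> L2 M"
    and pos: "\<kappa> > 0"
    and orth: "\<And>p q. p \<in> J \<Longrightarrow> q \<in> J \<Longrightarrow> (\<integral>x. e p x * e q x \<partial>M) = (if p = q then \<kappa> else 0)"
begin

definition coef :: "('a \<Rightarrow> complex) \<Rightarrow> 'i \<Rightarrow> complex" where
  "coef f p = (\<integral>x. f x * of_real (e p x) \<partial>M) / of_real \<kappa>"

definition comb :: "('i \<Rightarrow> complex) \<Rightarrow> 'i set \<Rightarrow> 'a \<Rightarrow> complex" where
  "comb c I x = (\<Sum>p\<in>I. c p * of_real (e p x))"

lemma comb_L2: "comb c I \<in> L2 M"
  unfolding comb_def by (intro L2_sum L2_mult_const e_L2)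

lemma e_int: "integrable M (\<lambda>x. e p x * e q x)"
  using L2_mult_integrable[OF e_L2[of p] e_L2[of q]]
  by (simp flip: of_real_mult add: complex_of_real_integrable_eq)

lemma norm_comb:
  assumes "finite I" "I \<subseteq> J"
  shows "(L2_norm M (comb c I))\<^sup>2 = \<kappa> * (\<Sum>p\<in>I. (cmod (c p))\<^sup>2)"
proof -
  have "(L2_norm M (comb c I))\<^sup>2 = (\<integral>x. (\<Sum>p\<in>I. c p * of_real (e p x)) \<bullet> (\<Sum>q\<in>I. c q * of_real (e q x)) \<partial>M)"
    by (simp add: L2_norm_sq comb_def power2_norm_eq_inner)
  also have "\<dots> = (\<Sum>p\<in>I. \<Sum>q\<in>I. (c p \<bullet> c q) * (\<integral>x. e p x * e q x \<partial>M))"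
    by (rule inner_sums_integral(2)) (rule e_int)
  also have "\<dots> = (\<Sum>p\<in>I. \<Sum>q\<in>I. if p = q then (c p \<bullet> c q) * \<kappa> else 0)"
    using assms by (intro sum.cong refl) (auto simp: orth subset_iff)
  also have "\<dots> = \<kappa> * (\<Sum>p\<in>I. (cmod (c p))\<^sup>2)"
    using assms by (simp add: sum_distrib_left power2_norm_eq_inner mult.commute)
  finally show ?thesis .
qed

lemma integral_comb:
  assumes "finite I" "I \<subseteq> J" "p \<in> J"
  shows "(\<integral>x. comb c I x * of_real (e p x) \<partial>M) = (if p \<in> I then of_real \<kappa> * c p else 0)"
proof -
  have int: "integrable M (\<lambda>x. c q * of_real (e q x) * complex_of_real (e p x))" for q
    using L2_mult_integrable[OF L2_mult_const[OF e_L2[of q], of "c q"] e_L2[of p]] .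
  have "(\<integral>x. comb c I x * of_real (e p x) \<partial>M) = (\<Sum>q\<in>I. \<integral>x. c q * of_real (e q x) * of_real (e p x) \<partial>M)"
    unfolding comb_def sum_distrib_right
    by (rule Bochner_Integration.integral_sum) (rule int)
  also have "\<dots> = (\<Sum>q\<in>I. c q * of_real (\<integral>x. e q x * e p x \<partial>M))"
    by (simp only: mult.assoc integral_mult_right_zero of_real_mult[symmetric] integral_complex_of_real)
  also have "\<dots> = (\<Sum>q\<in>I. if q = p then c q * of_real \<kappa> else 0)"
    using assms by (intro sum.cong refl) (auto simp: orth subset_iff)
  finally show ?thesis using assms by simp
qed

text \<open>The function is paired with the combination whose coefficients are the conjugates of its own.\<close>
lemma Bessel:
  assumes f: "f \<in> L2 M" and I: "finite I" "I \<subseteq> J"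
  shows "\<kappa> * (\<Sum>p\<in>I. (cmod (coef f p))\<^sup>2) \<le> (L2_norm M f)\<^sup>2"
proof -
  let ?S = "\<kappa> * (\<Sum>p\<in>I. (cmod (coef f p))\<^sup>2)"
  have "(\<integral>x. f x * comb (\<lambda>p. cnj (coef f p)) I x \<partial>M)
      = (\<Sum>p\<in>I. \<integral>x. cnj (coef f p) * (f x * of_real (e p x)) \<partial>M)"
  proof -
    have "(\<lambda>x. f x * comb (\<lambda>p. cnj (coef f p)) I x) = (\<lambda>x. \<Sum>p\<in>I. cnj (coef f p) * (f x * of_real (e p x)))"
      by (simp add: comb_def sum_distrib_left mult_ac)
    then show ?thesis
      using L2_mult_integrable[OF f e_L2] by (simp add: Bochner_Integration.integral_sum)
  qed
  also have "\<dots> = (\<Sum>p\<in>I. cnj (coef f p) * (of_real \<kappa> * coef f p))"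
    using pos by (simp add: coef_def)
  also have "\<dots> = of_real ?S"
    by (simp add: sum_distrib_left complex_norm_square mult_ac del: of_real_power)
  finally have "cmod (of_real ?S) \<le> L2_norm M f * L2_norm M (comb (\<lambda>p. cnj (coef f p)) I)"
    using L2_inner_bound[OF f comb_L2] by metis
  moreover have "?S \<ge> 0" using pos by (auto intro!: mult_nonneg_nonneg sum_nonneg)
  ultimately have *: "?S \<le> L2_norm M f * L2_norm M (comb (\<lambda>p. cnj (coef f p)) I)"
    unfolding norm_of_real by linarith
  have "L2_norm M (comb (\<lambda>p. cnj (coef f p)) I) = sqrt ?S"
    using norm_comb[OF I, of "\<lambda>p. cnj (coef f p)"] by (simp add: real_sqrt_unique)
  with * \<open>?S \<ge> 0\<close> have le: "sqrt ?S * sqrt ?S \<le> L2_norm M f * sqrt ?S"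
    by (simp only: real_sqrt_mult_self abs_of_nonneg)
  have "sqrt ?S \<le> L2_norm M f"
  proof (cases "sqrt ?S > 0")
    case False
    then have "sqrt ?S \<le> 0" by simp
    then show ?thesis using L2_norm_nonneg[of M f] by linarith
  next
    case True
    show ?thesis by (rule mult_right_le_imp_le[OF le True])
  qed
  then have "(sqrt ?S)\<^sup>2 \<le> (L2_norm M f)\<^sup>2" using \<open>?S \<ge> 0\<close> by (intro power_mono) auto
  then show ?thesis using \<open>?S \<ge> 0\<close> by simp
qed

text \<open>The squared distance of two partial sums is \<open>\<kappa>\<close> times a difference of partial sums of a convergent
  series.\<close>
lemma comb_convergent:
  assumes I: "\<And>n::nat. finite (I n)" "\<And>n. I n \<subseteq> J" "incseq I"
    and bound: "\<And>n. (\<Sum>p\<in>I n. (cmod (c p))\<^sup>2) \<le> C"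
  shows "\<exists>g\<in>L2 M. (\<lambda>n. L2_norm M (\<lambda>x. comb c (I n) x - g x)) \<longlonglongrightarrow> 0"
proof -
  define s where "s n = (\<Sum>p\<in>I n. (cmod (c p))\<^sup>2)" for n
  have s_mono: "incseq s"
    unfolding s_def incseq_def using I by (auto intro!: sum_mono2 simp: incseq_def subset_iff)
  have "convergent s"
    using s_mono bound unfolding s_def[symmetric] by (metis incseq_convergent convergent_def)
  then have "Cauchy s" by (rule convergent_Cauchy)
  have diff: "(L2_norm M (\<lambda>x. comb c (I n) x - comb c (I m) x))\<^sup>2 = \<kappa> * (s n - s m)"
    if "m \<le> n" for m n
  proof -
    have sub: "I m \<subseteq> I n" using I(3) that by (simp add: incseq_def)
    then have "(\<lambda>x. comb c (I n) x - comb c (I m) x) = comb c (I n - I m)"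
      using I(1) by (auto simp: comb_def sum_diff fun_eq_iff)
    moreover have "finite (I n - I m)" "I n - I m \<subseteq> J" using I by auto
    ultimately show ?thesis using I(1) sub by (simp only: norm_comb) (simp add: s_def sum_diff)
  qed
  have "\<exists>N. \<forall>m\<ge>N. \<forall>n\<ge>N. L2_norm M (\<lambda>x. comb c (I m) x - comb c (I n) x) < \<epsilon>"
    if "\<epsilon> > 0" for \<epsilon>
  proof -
    have "\<epsilon>\<^sup>2 / \<kappa> > 0" using that pos by simp
    then obtain N where N: "\<And>m n. m \<ge> N \<Longrightarrow> n \<ge> N \<Longrightarrow> dist (s m) (s n) < \<epsilon>\<^sup>2 / \<kappa>"
      using \<open>Cauchy s\<close> unfolding Cauchy_def by meson
    have *: "L2_norm M (\<lambda>x. comb c (I n) x - comb c (I m) x) < \<epsilon>"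
      if "m \<ge> N" "n \<ge> N" "m \<le> n" for m n
    proof (rule power2_less_imp_less)
      have "s n - s m < \<epsilon>\<^sup>2 / \<kappa>" using N[of n m] that by (simp add: dist_real_def)
      then show "(L2_norm M (\<lambda>x. comb c (I n) x - comb c (I m) x))\<^sup>2 < \<epsilon>\<^sup>2"
        using pos diff[OF \<open>m \<le> n\<close>] by (simp add: field_simps)
    qed (use \<open>\<epsilon> > 0\<close> in simp)
    show ?thesis
    proof (intro exI[of _ N] allI impI)
      fix m n assume "m \<ge> N" "n \<ge> N"
      then show "L2_norm M (\<lambda>x. comb c (I m) x - comb c (I n) x) < \<epsilon>"
        using *[of m n] *[of n m] L2_norm_minus_commute[of M "comb c (I m)" "comb c (I n)"]
        by (cases "m \<le> n") auto
    qed
  qed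
  from L2_complete[of M "\<lambda>n. comb c (I n)", OF fin comb_L2 this] show ?thesis .
qed

text \<open>If nothing but zero is orthogonal to the system, the limit of the partial sums, having the same
  coefficients as the function, must be that function.\<close>
lemma expansion_tendsto:
  assumes f: "f \<in> L2 M"
    and total: "\<And>g. g \<in> L2 M \<Longrightarrow> (\<And>p. p \<in> J \<Longrightarrow> (\<integral>x. g x * of_real (e p x) \<partial>M) = 0) \<Longrightarrow> AE x in M. g x = 0"
    and I: "\<And>n::nat. finite (I n)" "\<And>n. I n \<subseteq> J" "incseq I" "J \<subseteq> (\<Union>n. I n)"
  shows "(\<lambda>n. L2_norm M (\<lambda>x. comb (coef f) (I n) x - f x)) \<longlonglongrightarrow> 0"
proof -
  have "(\<Sum>p\<in>I n. (cmod (coef f p))\<^sup>2) \<le> (L2_norm M f)\<^sup>2 / \<kappa>" for n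
    using Bessel[OF f I(1,2)[of n]] pos by (simp add: field_simps)
  from comb_convergent[OF I(1-3) this]
  obtain g where g: "g \<in> L2 M" and lim: "(\<lambda>n. L2_norm M (\<lambda>x. comb (coef f) (I n) x - g x)) \<longlonglongrightarrow> 0"
    by auto
  have "(\<integral>x. (g x - f x) * of_real (e p x) \<partial>M) = 0" if p: "p \<in> J" for p
  proof -
    obtain n0 where n0: "p \<in> I n0" using I(4) p by auto
    have "(\<lambda>n. \<integral>x. comb (coef f) (I n) x * of_real (e p x) \<partial>M) \<longlonglongrightarrow> (\<integral>x. g x * of_real (e p x) \<partial>M)"
      by (rule L2_inner_tendsto[OF _ g e_L2 lim]) (simp add: comb_L2)
    moreover have "\<forall>\<^sub>F n in sequentially. (\<integral>x. comb (coef f) (I n) x * of_real (e p x) \<partial>M) = of_real \<kappa> * coef f p"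
      using eventually_ge_at_top[of n0]
    proof eventually_elim
      case (elim n)
      then have "p \<in> I n" using I(3) n0 by (auto simp: incseq_def)
      then show ?case using integral_comb[OF I(1,2) p, of "coef f" n] by simp
    qed
    ultimately have "(\<integral>x. g x * of_real (e p x) \<partial>M) = of_real \<kappa> * coef f p"
      by (intro LIMSEQ_unique[OF _ tendsto_eventually])
    then show ?thesis
      using L2_mult_integrable[OF g e_L2[of p]] L2_mult_integrable[OF f e_L2[of p]] pos
      by (simp add: left_diff_distrib coef_def)
  qed
  from total[OF L2_diff[OF g f] this] have "AE x in M. g x - f x = 0" .
  then have ae: "AE x in M. comb (coef f) (I n) x - g x = comb (coef f) (I n) x - f x" for n
    by eventually_elim simp
  have "L2_norm M (\<lambda>x. comb (coef f) (I n) x - g x) = L2_norm M (\<lambda>x. comb (coef f) (I n) x - f x)" for n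
    by (rule L2_norm_cong_AE[OF _ _ ae]) (use comb_L2 f g in \<open>auto intro!: borel_measurable_diff L2_measurable\<close>)
  with lim show ?thesis by simp
qed

end

section \<open>Smooth functions\<close>

text \<open>One-dimensional counterpart of \<open>C_k\<close>: if \<open>f\<close> and \<open>g\<close> are of this kind, then \<open>f(x) g(y)\<close> is in
  \<open>C_k\<close>. All smooth functions that are built below are finite sums of such products.\<close>
primrec Ck1 :: "nat \<Rightarrow> (real \<Rightarrow> real) \<Rightarrow> bool" where
  "Ck1 0 f \<longleftrightarrow> continuous_on UNIV f"
| "Ck1 (Suc k) f \<longleftrightarrow> (\<exists>f'. (\<forall>x. (f has_real_derivative f' x) (at x)) \<and> Ck1 k f')"

lemma Ck1_SucI: "(\<And>x. (f has_real_derivative f' x) (at x)) \<Longrightarrow> Ck1 k f' \<Longrightarrow> Ck1 (Suc k) f"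
  by auto

lemma Ck1_continuous: "Ck1 k f \<Longrightarrow> continuous_on UNIV f"
  by (cases k) (auto intro: DERIV_continuous_on has_field_derivative_at_within)

lemma Ck1_mono: "Ck1 (Suc k) f \<Longrightarrow> Ck1 k f"
proof (induction k arbitrary: f)
  case 0 then show ?case using Ck1_continuous[OF 0] by simp
next
  case (Suc k)
  then obtain f' where "\<And>x. (f has_real_derivative f' x) (at x)" "Ck1 (Suc k) f'" by auto
  then show ?case using Suc.IH[of f'] by auto
qed

lemma Ck1_const [simp]: "Ck1 k (\<lambda>x. c)"
  by (induction k arbitrary: c) (auto intro!: exI[of _ "\<lambda>x. 0"])

lemma Ck1_add: "Ck1 k f \<Longrightarrow> Ck1 k g \<Longrightarrow> Ck1 k (\<lambda>x. f x + g x)"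
proof (induction k arbitrary: f g)
  case 0 then show ?case by (auto intro: continuous_intros)
next
  case (Suc k)
  then obtain f' g' where "\<And>x. (f has_real_derivative f' x) (at x)" "Ck1 k f'"
    "\<And>x. (g has_real_derivative g' x) (at x)" "Ck1 k g'" by auto
  then show ?case using Suc.IH[of f' g']
    by (intro Ck1_SucI[where f'="\<lambda>x. f' x + g' x"]) (auto intro!: derivative_eq_intros)
qed

lemma Ck1_mult: "Ck1 k f \<Longrightarrow> Ck1 k g \<Longrightarrow> Ck1 k (\<lambda>x. f x * g x)"
proof (induction k arbitrary: f g)
  case 0 then show ?case by (auto intro: continuous_intros)
next
  case (Suc k)
  obtain f' g' where "\<And>x. (f has_real_derivative f' x) (at x)" "Ck1 k f'"
    "\<And>x. (g has_real_derivative g' x) (at x)" "Ck1 k g'" using Suc.prems by auto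
  then show ?case using Suc.IH[of f' g] Suc.IH[of f g'] Ck1_mono[OF Suc.prems(1)] Ck1_mono[OF Suc.prems(2)]
    by (intro Ck1_SucI[where f'="\<lambda>x. f' x * g x + f x * g' x"] Ck1_add) (auto intro!: derivative_eq_intros)
qed

lemma Ck1_affine: "Ck1 k f \<Longrightarrow> Ck1 k (\<lambda>x. f (r * x + s))"
proof (induction k arbitrary: f)
  case 0
  then show ?case by (auto intro!: continuous_on_compose2[of UNIV f] continuous_intros)
next
  case (Suc k)
  then obtain f' where f': "\<And>x. (f has_real_derivative f' x) (at x)" "Ck1 k f'" by auto
  have "((\<lambda>x. f (r * x + s)) has_real_derivative r * f' (r * x + s)) (at x)" for x
    by (rule DERIV_chain2[OF f'(1), THEN DERIV_cong]) (auto intro!: derivative_eq_intros)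
  moreover have "Ck1 k (\<lambda>x. r * f' (r * x + s))"
    by (rule Ck1_mult[OF Ck1_const Suc.IH[OF f'(2)]])
  ultimately show ?case by (rule Ck1_SucI)
qed

lemma Ck1_sin_cos: "Ck1 k sin \<and> Ck1 k cos"
proof (induction k)
  case 0 show ?case by (auto intro: continuous_intros)
next
  case (Suc k)
  have "Ck1 k (\<lambda>x. (-1) * sin x)" using Suc by (intro Ck1_mult) auto
  then show ?case using Suc
    by (intro conjI Ck1_SucI[where f'=cos] Ck1_SucI[where f'="\<lambda>x. (-1) * sin x"])
       (auto intro!: derivative_eq_intros)
qed

text \<open>The family \<open>x\<^sup>-\<^sup>n exp (-1/x)\<close>, extended by zero, is closed under differentiation up to
  linear combinations, which makes all its members smooth.\<close>
definition flat :: "nat \<Rightarrow> real \<Rightarrow> real" where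
  "flat n x = (if x > 0 then (1 / x) ^ n * exp (- (1 / x)) else 0)"

lemma flat_nonneg: "0 \<le> flat n x" by (simp add: flat_def)

lemma flat_eq_0: "x \<le> 0 \<Longrightarrow> flat n x = 0" by (simp add: flat_def)

lemma flat_0_le_1: "flat 0 x \<le> 1" by (simp add: flat_def)

lemma flat_tendsto_0: "(flat n \<longlongrightarrow> 0) (at 0)"
proof -
  have "((\<lambda>y::real. y ^ n / exp y) \<longlongrightarrow> 0) at_top" by (rule tendsto_power_div_exp_0)
  then have "((\<lambda>x::real. inverse x ^ n / exp (inverse x)) \<longlongrightarrow> 0) (at_right 0)"
    by (rule filterlim_compose) (rule filterlim_inverse_at_top_right)
  moreover have "\<forall>\<^sub>F x in at_right 0. inverse x ^ n / exp (inverse x) = flat n x"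
    unfolding eventually_at_right[OF zero_less_one] flat_def
    by (intro exI[of _ 1]) (auto simp: exp_minus divide_simps)
  ultimately have "(flat n \<longlongrightarrow> 0) (at_right 0)" by (rule Lim_transform_eventually)
  moreover have "(flat n \<longlongrightarrow> 0) (at_left 0)"
    by (rule tendsto_eventually)
       (auto simp: eventually_at_left[of "-1::real"] flat_def intro!: exI[of _ "-1::real"])
  ultimately show ?thesis by (simp add: filterlim_split_at)
qed

lemma flat_deriv: "(flat n has_real_derivative (flat (n + 2) x + (- real n) * flat (n + 1) x)) (at x)"
proof -
  consider "x > 0" | "x < 0" | "x = 0" by linarith
  then show ?thesis
  proof cases
    case 1
    have d1: "((\<lambda>x. 1 / x) has_real_derivative - ((1 / x)\<^sup>2)) (at x)"
      using 1 by (auto intro!: derivative_eq_intros simp: power2_eq_square)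
    have d2: "((\<lambda>x. exp (- (1 / x))) has_real_derivative exp (- (1 / x)) * (1 / x)\<^sup>2) (at x)"
      by (rule DERIV_cong[OF DERIV_fun_exp[OF DERIV_minus[OF d1]]]) simp
    have "((\<lambda>x. (1 / x) ^ n * exp (- (1 / x))) has_real_derivative flat (n + 2) x + (- real n) * flat (n + 1) x) (at x)"
      by (rule DERIV_cong[OF DERIV_mult[OF DERIV_power[OF d1] d2]])
         (use 1 in \<open>cases n; simp add: flat_def algebra_simps power2_eq_square del: power_divide times_divide_eq_left times_divide_eq_right\<close>)
    then show ?thesis
      by (rule has_field_derivative_transform_within_open[where S="{0<..}"]) (use 1 in \<open>auto simp: flat_def\<close>)
  next
    case 2
    have "((\<lambda>x. 0) has_real_derivative flat (n + 2) x + (- real n) * flat (n + 1) x) (at x)"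
      using 2 by (auto simp: flat_def)
    then show ?thesis
      by (rule has_field_derivative_transform_within_open[where S="{..<0}"]) (use 2 in \<open>auto simp: flat_def\<close>)
  next
    case 3
    have "flat n h / h = flat (Suc n) h" for h by (simp add: flat_def)
    then show ?thesis
      using flat_tendsto_0[of "Suc n"] 3 by (simp add: has_field_derivative_iff flat_eq_0)
  qed
qed

lemma Ck1_flat: "Ck1 k (flat n)"
proof (induction k arbitrary: n)
  case 0
  show ?case
    by (auto intro!: DERIV_continuous_on[OF has_field_derivative_at_within[OF flat_deriv]])
next
  case (Suc k)
  show ?case
    by (rule Ck1_SucI[OF flat_deriv]) (intro Ck1_add Ck1_mult Ck1_const Suc)
qed

text \<open>Smooth, supported in \<open>[\<alpha> + 1/k, \<beta> - 1/k]\<close>, and convergent to the indicator of \<open>(\<alpha>, \<beta>)\<close> as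
  \<open>k\<close> grows.\<close>
definition cutoff :: "real \<Rightarrow> real \<Rightarrow> nat \<Rightarrow> real \<Rightarrow> real" where
  "cutoff \<alpha> \<beta> k x = flat 0 (real k * (x - \<alpha>) - 1) * flat 0 (real k * (\<beta> - x) - 1)"

definition cutoff' :: "real \<Rightarrow> real \<Rightarrow> nat \<Rightarrow> real \<Rightarrow> real" where
  "cutoff' \<alpha> \<beta> k x = real k * flat 2 (real k * (x - \<alpha>) - 1) * flat 0 (real k * (\<beta> - x) - 1)
     - real k * flat 0 (real k * (x - \<alpha>) - 1) * flat 2 (real k * (\<beta> - x) - 1)"

lemma Ck1_cutoff: "Ck1 j (cutoff \<alpha> \<beta> k)"
proof -
  have "cutoff \<alpha> \<beta> k = (\<lambda>x. flat 0 (real k * x + (- real k * \<alpha> - 1)) * flat 0 ((- real k) * x + (real k * \<beta> - 1)))"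
    by (simp add: fun_eq_iff cutoff_def algebra_simps)
  then show ?thesis
    by (simp only:) (intro Ck1_mult Ck1_affine Ck1_flat)
qed

lemma cutoff_deriv: "(cutoff \<alpha> \<beta> k has_real_derivative cutoff' \<alpha> \<beta> k x) (at x)"
proof -
  note d = DERIV_chain2[OF flat_deriv[of 0]]
  have "((\<lambda>x. flat 0 (real k * (x - \<alpha>) - 1) * flat 0 (real k * (\<beta> - x) - 1)) has_real_derivative cutoff' \<alpha> \<beta> k x) (at x)"
    by (rule DERIV_cong[OF DERIV_mult[OF d d]])
       (auto intro!: derivative_eq_intros simp: cutoff'_def numeral_2_eq_2)
  then show ?thesis unfolding cutoff_def[abs_def] .
qed

lemma cutoff_bounds: "0 \<le> cutoff \<alpha> \<beta> k x" "cutoff \<alpha> \<beta> k x \<le> 1"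
  unfolding cutoff_def by (simp_all add: flat_nonneg flat_0_le_1 mult_le_one)

lemma cutoff_support:
  assumes "cutoff \<alpha> \<beta> k x \<noteq> 0" shows "k > 0" "\<alpha> + 1 / real k \<le> x" "x \<le> \<beta> - 1 / real k"
proof -
  have *: "real k * (x - \<alpha>) - 1 > 0" "real k * (\<beta> - x) - 1 > 0"
    using assms by (auto simp: cutoff_def flat_def split: if_splits)
  then show "k > 0" by (cases k) auto
  then show "\<alpha> + 1 / real k \<le> x" "x \<le> \<beta> - 1 / real k"
    using * by (auto simp: field_simps)
qed

lemma cutoff_outside: "x \<le> \<alpha> \<or> x \<ge> \<beta> \<Longrightarrow> cutoff \<alpha> \<beta> k x = 0"
proof (rule ccontr)
  assume *: "x \<le> \<alpha> \<or> x \<ge> \<beta>" "cutoff \<alpha> \<beta> k x \<noteq> 0"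
  then have "1 / real k > 0" using cutoff_support(1) by simp
  then show False using cutoff_support(2,3)[OF *(2)] *(1) by linarith
qed

lemma flat_0_tendsto: assumes "x > 0" shows "(\<lambda>k. flat 0 (real k * x - 1)) \<longlonglongrightarrow> 1"
proof -
  have lim: "filterlim (\<lambda>k. real k * x - 1) at_top sequentially"
    using assms by real_asymp
  have "((\<lambda>y::real. exp (- (1 / y))) \<longlongrightarrow> exp (- 0)) at_top"
    by (intro tendsto_intros tendsto_divide_0[OF tendsto_const] filterlim_at_top_imp_at_infinity filterlim_ident)
  from filterlim_compose[OF this lim]
  have "(\<lambda>k. exp (- (1 / (real k * x - 1)))) \<longlonglongrightarrow> 1" by simp
  moreover have "\<forall>\<^sub>F k in sequentially. exp (- (1 / (real k * x - 1))) = flat 0 (real k * x - 1)"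
    using lim[THEN filterlim_at_top_dense[THEN iffD1], rule_format, of 0]
    by eventually_elim (simp add: flat_def)
  ultimately show ?thesis by (rule Lim_transform_eventually)
qed

lemma flat_2_tendsto: assumes "x > 0" shows "(\<lambda>k. real k * flat 2 (real k * x - 1)) \<longlonglongrightarrow> 0"
proof -
  have lim: "filterlim (\<lambda>k. real k * x - 1) at_top sequentially"
    using assms by real_asymp
  have "(\<lambda>k. real k * (1 / (real k * x - 1))^2 * exp (- (1 / (real k * x - 1)))) \<longlonglongrightarrow> 0"
    using assms by real_asymp
  moreover have "\<forall>\<^sub>F k in sequentially. real k * (1 / (real k * x - 1))^2 * exp (- (1 / (real k * x - 1)))
      = real k * flat 2 (real k * x - 1)"
    using lim[THEN filterlim_at_top_dense[THEN iffD1], rule_format, of 0]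
    by eventually_elim (simp add: flat_def)
  ultimately show ?thesis by (rule Lim_transform_eventually)
qed

lemma cutoff_tendsto: "(\<lambda>k. cutoff \<alpha> \<beta> k x) \<longlonglongrightarrow> (if \<alpha> < x \<and> x < \<beta> then 1 else 0)"
proof (cases "\<alpha> < x \<and> x < \<beta>")
  case True
  then have "(\<lambda>k. cutoff \<alpha> \<beta> k x) \<longlonglongrightarrow> 1 * 1"
    unfolding cutoff_def by (intro tendsto_mult flat_0_tendsto) auto
  then show ?thesis using True by simp
next
  case False
  then have "cutoff \<alpha> \<beta> k x = 0" for k by (intro cutoff_outside) auto
  then show ?thesis using False by auto
qed

lemma cutoff'_tendsto: assumes "\<alpha> < x" "x < \<beta>" shows "(\<lambda>k. cutoff' \<alpha> \<beta> k x) \<longlonglongrightarrow> 0"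
proof -
  have "(\<lambda>k. (real k * flat 2 (real k * (x - \<alpha>) - 1)) * flat 0 (real k * (\<beta> - x) - 1)
     - flat 0 (real k * (x - \<alpha>) - 1) * (real k * flat 2 (real k * (\<beta> - x) - 1))) \<longlonglongrightarrow> 0 * 1 - 1 * 0"
    by (intro tendsto_diff tendsto_mult flat_0_tendsto flat_2_tendsto) (use assms in auto)
  then show ?thesis by (simp add: cutoff'_def mult_ac)
qed

text \<open>With \<open>z = 1/y\<close> the left-hand side is \<open>(z + z\<^sup>2) exp (-z)\<close>.\<close>
lemma flat_2_bound: "(y + 1) * flat 2 y \<le> 4"
proof (cases "y > 0")
  case True
  define z where "z = 1 / y"
  have z: "z > 0" "y = 1 / z" using True by (auto simp: z_def)
  have e: "1 + z + z\<^sup>2 / 2 \<le> exp z" by (rule exp_lower_Taylor_quadratic) (use z in simp)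
  have "flat 2 y = z\<^sup>2 * exp (- z)" using True by (simp add: flat_def z_def)
  then have "(y + 1) * flat 2 y = (z + z\<^sup>2) / exp z"
  proof -
    have "(y + 1) * z\<^sup>2 = z + z\<^sup>2" using z by (simp add: field_simps power2_eq_square)
    moreover have "(y + 1) * flat 2 y = ((y + 1) * z\<^sup>2) * exp (- z)"
      unfolding \<open>flat 2 y = _\<close> by (rule mult.assoc[symmetric])
    ultimately show ?thesis by (simp add: exp_minus divide_inverse)
  qed
  also have "\<dots> \<le> 4"
  proof -
    have "z + z\<^sup>2 \<le> 4 * exp z" using e z zero_le_power2[of z] by linarith
    then show ?thesis by (simp add: divide_le_eq)
  qed
  finally show ?thesis .
qed (simp add: flat_def)

text \<open>Near the ends the derivative of the cutoff grows like the inverse distance, so it stays bounded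
  against a function that vanishes there.\<close>
lemma cutoff'_bound:
  assumes S: "\<bar>S\<bar> \<le> L * (x - \<alpha>)" "\<bar>S\<bar> \<le> L * (\<beta> - x)" and L: "L \<ge> 0"
  shows "\<bar>cutoff' \<alpha> \<beta> k x * S\<bar> \<le> 8 * L"
proof -
  have *: "\<bar>real k * flat 2 (real k * d - 1) * S\<bar> \<le> 4 * L" if "\<bar>S\<bar> \<le> L * d" for d
  proof -
    have "\<bar>real k * flat 2 (real k * d - 1) * S\<bar> = real k * flat 2 (real k * d - 1) * \<bar>S\<bar>"
      by (simp add: abs_mult flat_nonneg)
    also have "\<dots> \<le> real k * flat 2 (real k * d - 1) * (L * d)"
      by (intro mult_left_mono that) (simp add: flat_nonneg)
    also have "\<dots> = L * (((real k * d - 1) + 1) * flat 2 (real k * d - 1))" by simp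
    also have "\<dots> \<le> L * 4" by (intro mult_left_mono flat_2_bound L)
    finally show ?thesis by simp
  qed
  have **: "\<bar>u * v\<bar> \<le> w" if "\<bar>u\<bar> \<le> w" "0 \<le> v" "v \<le> 1" for u v w :: real
    using mult_mono[of "\<bar>u\<bar>" w v 1] that by (simp add: abs_mult)
  show ?thesis
  proof -
    have "cutoff' \<alpha> \<beta> k x * S = (real k * flat 2 (real k * (x - \<alpha>) - 1) * S) * flat 0 (real k * (\<beta> - x) - 1)
      - (real k * flat 2 (real k * (\<beta> - x) - 1) * S) * flat 0 (real k * (x - \<alpha>) - 1)"
      by (simp add: cutoff'_def algebra_simps)
    moreover have "\<bar>(real k * flat 2 (real k * (x - \<alpha>) - 1) * S) * flat 0 (real k * (\<beta> - x) - 1)\<bar> \<le> 4 * L"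
      by (intro ** * S L flat_nonneg flat_0_le_1)
    moreover have "\<bar>(real k * flat 2 (real k * (\<beta> - x) - 1) * S) * flat 0 (real k * (x - \<alpha>) - 1)\<bar> \<le> 4 * L"
      by (intro ** * S L flat_nonneg flat_0_le_1)
    ultimately show ?thesis by linarith
  qed
qed


lemma has_derivative_tensor:
  assumes "(f has_real_derivative f') (at (fst p))" "(g has_real_derivative g') (at (snd p))"
  shows "((\<lambda>p. c * complex_of_real (f (fst p) * g (snd p))) has_derivative
    (\<lambda>h. c * of_real (f' * fst h * g (snd p) + f (fst p) * (g' * snd h)))) (at p)"
proof -
  have 1: "((\<lambda>p. f (fst p)) has_derivative (\<lambda>h. f' * fst h)) (at p)"
    by (rule has_derivative_compose[OF has_derivative_fst[OF has_derivative_ident] assms(1)[unfolded has_field_derivative_def], simplified])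
  have 2: "((\<lambda>p. g (snd p)) has_derivative (\<lambda>h. g' * snd h)) (at p)"
    by (rule has_derivative_compose[OF has_derivative_snd[OF has_derivative_ident] assms(2)[unfolded has_field_derivative_def], simplified])
  show ?thesis
    by (rule has_derivative_eq_rhs[OF has_derivative_mult_right[OF has_derivative_of_real[OF has_derivative_mult[OF 1 2]]]])
       (simp add: fun_eq_iff algebra_simps)
qed

lemma C_k_tensor:
  "Ck1 k f \<Longrightarrow> Ck1 k g \<Longrightarrow> C_k k (\<lambda>p. c * complex_of_real (f (fst p) * g (snd p)))"
proof (induction k arbitrary: f g)
  case 0
  then have "continuous_on UNIV (\<lambda>p. f (fst p))" "continuous_on UNIV (\<lambda>p. g (snd p))"
    by (auto intro!: continuous_on_compose2[of UNIV f] continuous_on_compose2[of UNIV g] continuous_intros)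
  then show ?case by (auto intro!: continuous_intros)
next
  case (Suc k)
  obtain f' g' where d: "\<And>x. (f has_real_derivative f' x) (at x)" "Ck1 k f'"
    "\<And>x. (g has_real_derivative g' x) (at x)" "Ck1 k g'" using Suc.prems by auto
  note D = has_derivative_tensor[OF d(1) d(3), where c=c]
  have "frechet_derivative (\<lambda>p. c * complex_of_real (f (fst p) * g (snd p))) (at x)
      = (\<lambda>h. c * of_real (f' (fst x) * fst h * g (snd x) + f (fst x) * (g' (snd x) * snd h)))" for x
    using frechet_derivative_at[OF D[of x]] by simp
  moreover have "(\<lambda>p. c * complex_of_real (f (fst p) * g (snd p))) differentiable (at x)" for x
    using D[of x] unfolding differentiable_def by blast
  ultimately show ?case
    using Suc.IH[OF d(2) Ck1_mono[OF Suc.prems(2)]] Suc.IH[OF Ck1_mono[OF Suc.prems(1)] d(4)]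
    by (auto simp: Basis_prod_def)
qed

lemma C_k_add: "C_k k f \<Longrightarrow> C_k k g \<Longrightarrow> C_k k (\<lambda>p. f p + g p)"
proof (induction k arbitrary: f g)
  case 0 then show ?case by (auto intro: continuous_intros)
next
  case (Suc k)
  have d: "f differentiable (at x)" "g differentiable (at x)" for x
    using Suc.prems unfolding C_k.simps by blast+
  have "frechet_derivative (\<lambda>p. f p + g p) (at x)
      = (\<lambda>h. frechet_derivative f (at x) h + frechet_derivative g (at x) h)" for x
    using d by (intro frechet_derivative_at[symmetric] has_derivative_add)
      (simp_all flip: frechet_derivative_works)
  then show ?case using Suc.IH Suc.prems d by (simp add: differentiable_add)
qed

lemma smooth_tensor:
  "(\<And>k. Ck1 k f) \<Longrightarrow> (\<And>k. Ck1 k g) \<Longrightarrow> smooth (\<lambda>p. c * complex_of_real (f (fst p) * g (snd p)))"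
  unfolding smooth_def by (intro allI C_k_tensor)

lemma smooth_0: "smooth (\<lambda>p. 0)"
  using smooth_tensor[of "\<lambda>x. 0" "\<lambda>x. 0" 0] by simp

lemma smooth_add: "smooth f \<Longrightarrow> smooth g \<Longrightarrow> smooth (\<lambda>p. f p + g p)"
  by (simp add: smooth_def C_k_add)

lemma smooth_sum: "(\<And>i. i \<in> I \<Longrightarrow> smooth (f i)) \<Longrightarrow> smooth (\<lambda>p. \<Sum>i\<in>I. f i p)"
proof (induction I rule: infinite_finite_induct)
  case (insert i I)
  have "smooth (\<lambda>p. f i p + (\<Sum>i\<in>I. f i p))"
    by (rule smooth_add) (use insert in auto)
  then show ?case using insert by simp
qed (simp_all add: smooth_0)

lemma smooth_continuous: "smooth f \<Longrightarrow> continuous_on UNIV f"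
  unfolding smooth_def by (drule spec[of _ 0]) simp

lemma smooth_differentiable: "smooth f \<Longrightarrow> f differentiable (at x)"
  unfolding smooth_def by (metis C_k.simps(2))

lemma smooth_partial: "smooth f \<Longrightarrow> e \<in> Basis \<Longrightarrow> smooth (\<lambda>x. frechet_derivative f (at x) e)"
  unfolding smooth_def by (metis C_k.simps(2))

lemma partial_x:
  assumes "f differentiable (at p)"
  shows "((\<lambda>s. f (s, snd p)) has_vector_derivative frechet_derivative f (at p) (1, 0)) (at (fst p))"
proof -
  have f: "(f has_derivative frechet_derivative f (at p)) (at ((\<lambda>s. (s, snd p)) (fst p)))"
    using assms by (simp add: frechet_derivative_works)
  have "((\<lambda>s. (s, snd p)) has_derivative (\<lambda>h. (h, 0))) (at (fst p))"
    by (intro has_derivative_Pair has_derivative_ident has_derivative_const)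
  from has_derivative_compose[OF this f]
  have "((\<lambda>s. f (s, snd p)) has_derivative (\<lambda>h. frechet_derivative f (at p) (h, 0))) (at (fst p))" .
  moreover have "(\<lambda>h. frechet_derivative f (at p) (h, 0)) = (\<lambda>h. h *\<^sub>R frechet_derivative f (at p) (1, 0))"
  proof
    fix h
    show "frechet_derivative f (at p) (h, 0) = h *\<^sub>R frechet_derivative f (at p) (1, 0)"
      using linear_scale[OF linear_frechet_derivative[OF assms], of h "(1, 0)"] by simp
  qed
  ultimately show ?thesis by (simp only: has_vector_derivative_def)
qed

lemma partial_y:
  assumes "f differentiable (at p)"
  shows "((\<lambda>s. f (fst p, s)) has_vector_derivative frechet_derivative f (at p) (0, 1)) (at (snd p))"
proof -
  have f: "(f has_derivative frechet_derivative f (at p)) (at ((\<lambda>s. (fst p, s)) (snd p)))"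
    using assms by (simp add: frechet_derivative_works)
  have "((\<lambda>s. (fst p, s)) has_derivative (\<lambda>h. (0, h))) (at (snd p))"
    by (intro has_derivative_Pair has_derivative_ident has_derivative_const)
  from has_derivative_compose[OF this f]
  have "((\<lambda>s. f (fst p, s)) has_derivative (\<lambda>h. frechet_derivative f (at p) (0, h))) (at (snd p))" .
  moreover have "(\<lambda>h. frechet_derivative f (at p) (0, h)) = (\<lambda>h. h *\<^sub>R frechet_derivative f (at p) (0, 1))"
  proof
    fix h
    show "frechet_derivative f (at p) (0, h) = h *\<^sub>R frechet_derivative f (at p) (0, 1)"
      using linear_scale[OF linear_frechet_derivative[OF assms], of h "(0, 1)"] by simp
  qed
  ultimately show ?thesis by (simp only: has_vector_derivative_def)
qed

section \<open>Calculus on the rectangle\<close>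

lemma basis_vectors: "(1, 0) \<in> (Basis :: (real \<times> real) set)" "(0, 1) \<in> (Basis :: (real \<times> real) set)"
  by (auto simp: Basis_prod_def)

locale rect =
  fixes a b :: real
  assumes a_pos: "a > 0" and b_pos: "b > 0"
begin

definition "A = a * pi"
definition "B = b * pi"
abbreviation "\<Omega> \<equiv> rectangle a b"
abbreviation "M \<equiv> lebesgue_on (rectangle a b)"
abbreviation "wp \<equiv> weak_partial (rectangle a b)"

lemma A_pos: "A > 0" and B_pos: "B > 0" using a_pos b_pos by (simp_all add: A_def B_def)

lemma rectangle_eq: "\<Omega> = {0<..<A} \<times> {0<..<B}" by (simp add: rectangle_def A_def B_def)

lemma rectangle_box: "\<Omega> = box (0, 0) (A, B)"
  by (auto simp: rectangle_eq box_def Basis_prod_def)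

lemma rectangle_lmeasurable: "\<Omega> \<in> lmeasurable" by (simp add: rectangle_box)

lemma rectangle_sets [simp]: "\<Omega> \<in> sets lebesgue" using rectangle_lmeasurable by (rule fmeasurableD)

lemma finite_measure_M: "finite_measure M"
  by (rule finite_measure_lebesgue_on[OF rectangle_lmeasurable])

lemma rectangle_subset_cbox: "\<Omega> \<subseteq> cbox (0, 0) (A, B)"
  by (simp add: rectangle_box box_subset_cbox)

lemma continuous_measurable:
  assumes "continuous_on UNIV f" shows "f \<in> borel_measurable M"
proof -
  have "f \<in> borel_measurable borel" by (rule borel_measurable_continuous_onI) fact
  then have "f \<in> borel_measurable lebesgue" by (intro measurable_completion) simp
  then show ?thesis by (rule measurable_restrict_space1)
qed

lemma continuous_bounded:
  fixes f :: "real \<times> real \<Rightarrow> 'a::real_normed_vector"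
  assumes "continuous_on UNIV f"
  obtains K where "K \<ge> 0" "\<And>x. x \<in> cbox (0, 0) (A, B) \<Longrightarrow> norm (f x) \<le> K"
proof -
  have "compact (f ` cbox (0, 0) (A, B))"
    by (rule compact_continuous_image[OF continuous_on_subset[OF assms]]) auto
  then have "bounded (f ` cbox (0, 0) (A, B))" by (rule compact_imp_bounded)
  then obtain K where "K > 0" "\<forall>x\<in>cbox (0, 0) (A, B). norm (f x) \<le> K"
    by (auto simp: bounded_pos)
  then show ?thesis by (intro that[of K]) auto
qed

lemma continuous_L2: assumes "continuous_on UNIV f" shows "f \<in> L2 M"
proof -
  obtain K where "\<And>x. x \<in> cbox (0, 0) (A, B) \<Longrightarrow> norm (f x) \<le> K"
    using continuous_bounded[OF assms] by blast
  then show ?thesis using rectangle_subset_cbox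
    by (intro bounded_imp_L2[OF finite_measure_M continuous_measurable[OF assms], of K]) auto
qed

lemma continuous_integrable:
  fixes f :: "real \<times> real \<Rightarrow> 'a::euclidean_space"
  assumes "continuous_on UNIV f" shows "integrable M f"
proof -
  interpret finite_measure M by (rule finite_measure_M)
  obtain K where "\<And>x. x \<in> cbox (0, 0) (A, B) \<Longrightarrow> norm (f x) \<le> K"
    using continuous_bounded[OF assms] by blast
  then show ?thesis using rectangle_subset_cbox
    by (intro integrable_const_bound[where B=K] continuous_measurable[OF assms] AE_I2) auto
qed

lemma integral_iterated:
  fixes f :: "real \<times> real \<Rightarrow> 'a::euclidean_space"
  assumes f: "continuous_on UNIV f"
  shows "(\<integral>x. f x \<partial>M) = integral {0..A} (\<lambda>x. integral {0..B} (\<lambda>y. f (x, y)))"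
    and "(\<integral>x. f x \<partial>M) = integral {0..B} (\<lambda>y. integral {0..A} (\<lambda>x. f (x, y)))"
proof -
  have "(\<integral>x. f x \<partial>M) = integral \<Omega> f"
    by (rule lebesgue_integral_eq_integral[OF continuous_integrable[OF f]]) simp
  also have "\<dots> = integral (cbox (0, 0) (A, B)) f"
    by (simp add: rectangle_box integral_open_interval)
  also have "\<dots> = integral (cbox 0 A) (\<lambda>x. integral (cbox 0 B) (\<lambda>y. f (x, y)))"
    by (rule integral_prod_continuous[OF continuous_on_subset[OF f]]) auto
  finally show 1: "(\<integral>x. f x \<partial>M) = integral {0..A} (\<lambda>x. integral {0..B} (\<lambda>y. f (x, y)))"
    by simp
  have "continuous_on (cbox (0, 0) (A, B)) (\<lambda>(x, y). f (x, y))"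
    using continuous_on_subset[OF f] by simp
  from integral_swap_continuous[OF this]
  show "(\<integral>x. f x \<partial>M) = integral {0..B} (\<lambda>y. integral {0..A} (\<lambda>x. f (x, y)))"
    unfolding 1 by simp
qed

lemma divergence_x:
  fixes F :: "real \<times> real \<Rightarrow> 'a::euclidean_space"
  assumes "\<And>p. ((\<lambda>s. F (s, snd p)) has_vector_derivative F' p) (at (fst p))" "continuous_on UNIV F'"
  shows "(\<integral>p. F' p \<partial>M) = integral {0..B} (\<lambda>y. F (A, y) - F (0, y))"
proof -
  have "integral {0..A} (\<lambda>x. F' (x, y)) = F (A, y) - F (0, y)" for y
  proof (intro integral_unique fundamental_theorem_of_calculus)
    show "0 \<le> A" using A_pos by simp
    show "((\<lambda>s. F (s, y)) has_vector_derivative F' (x, y)) (at x within {0..A})" for x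
      by (rule has_vector_derivative_at_within) (use assms(1)[of "(x, y)"] in simp)
  qed
  then show ?thesis by (simp add: integral_iterated(2)[OF assms(2)])
qed

lemma divergence_y:
  fixes F :: "real \<times> real \<Rightarrow> 'a::euclidean_space"
  assumes "\<And>p. ((\<lambda>s. F (fst p, s)) has_vector_derivative F' p) (at (snd p))" "continuous_on UNIV F'"
  shows "(\<integral>p. F' p \<partial>M) = integral {0..A} (\<lambda>x. F (x, B) - F (x, 0))"
proof -
  have "integral {0..B} (\<lambda>y. F' (x, y)) = F (x, B) - F (x, 0)" for x
  proof (intro integral_unique fundamental_theorem_of_calculus)
    show "0 \<le> B" using B_pos by simp
    show "((\<lambda>s. F (x, s)) has_vector_derivative F' (x, y)) (at y within {0..B})" for y
      by (rule has_vector_derivative_at_within) (use assms(1)[of "(x, y)"] in simp)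
  qed
  then show ?thesis by (simp add: integral_iterated(1)[OF assms(2)])
qed

text \<open>The product rule and the divergence theorem; the boundary terms vanish together with \<open>g\<close>.\<close>
lemma integral_by_parts:
  fixes f g :: "real \<times> real \<Rightarrow> complex"
  assumes f: "smooth f" and g: "smooth g" and e: "e \<in> Basis"
    and g0: "\<And>p. p \<notin> \<Omega> \<Longrightarrow> g p = 0"
  shows "(\<integral>p. f p * frechet_derivative g (at p) e \<partial>M) = - (\<integral>p. frechet_derivative f (at p) e * g p \<partial>M)"
proof -
  let ?f = "\<lambda>p. frechet_derivative f (at p) e" and ?g = "\<lambda>p. frechet_derivative g (at p) e"
  have c: "continuous_on UNIV f" "continuous_on UNIV g" "continuous_on UNIV ?f" "continuous_on UNIV ?g"
    using f g e by (auto intro: smooth_continuous smooth_partial)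
  have "(\<integral>p. f p * ?g p + ?f p * g p \<partial>M) = 0"
  proof -
    consider "e = (1, 0)" | "e = (0, 1)" using e by (auto simp: Basis_prod_def)
    then show ?thesis
    proof cases
      case 1
      have "(\<integral>p. f p * ?g p + ?f p * g p \<partial>M) = integral {0..B} (\<lambda>y. f (A, y) * g (A, y) - f (0, y) * g (0, y))"
        using has_vector_derivative_mult[OF partial_x[OF smooth_differentiable[OF f]] partial_x[OF smooth_differentiable[OF g]]]
        by (intro divergence_x[of "\<lambda>p. f p * g p"] continuous_intros c) (simp add: 1)
      also have "\<dots> = 0" by (simp add: g0 rectangle_eq)
      finally show ?thesis .
    next
      case 2
      have "(\<integral>p. f p * ?g p + ?f p * g p \<partial>M) = integral {0..A} (\<lambda>x. f (x, B) * g (x, B) - f (x, 0) * g (x, 0))"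
        using has_vector_derivative_mult[OF partial_y[OF smooth_differentiable[OF f]] partial_y[OF smooth_differentiable[OF g]]]
        by (intro divergence_y[of "\<lambda>p. f p * g p"] continuous_intros c) (simp add: 2)
      also have "\<dots> = 0" by (simp add: g0 rectangle_eq)
      finally show ?thesis .
    qed
  qed
  moreover have "integrable M (\<lambda>p. f p * ?g p)" "integrable M (\<lambda>p. ?f p * g p)"
    by (auto intro!: continuous_integrable continuous_intros c)
  ultimately show ?thesis by (simp add: eq_neg_iff_add_eq_0)
qed

end


section \<open>Weak derivatives\<close>

context rect begin

lemma test_function_smooth: "\<phi> \<in> test_functions \<Omega> \<Longrightarrow> smooth \<phi>"
  by (simp add: test_functions_def)

lemma test_function_outside: "\<phi> \<in> test_functions \<Omega> \<Longrightarrow> p \<notin> \<Omega> \<Longrightarrow> \<phi> p = 0"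
  unfolding test_functions_def by blast

lemma smooth_L2: "smooth f \<Longrightarrow> f \<in> L2 M"
  by (intro continuous_L2 smooth_continuous)

lemma smooth_partial_L2: "smooth f \<Longrightarrow> e \<in> Basis \<Longrightarrow> (\<lambda>p. frechet_derivative f (at p) e) \<in> L2 M"
  by (intro smooth_L2 smooth_partial)

lemma smooth_has_weak_partial:
  assumes "smooth f" "e \<in> Basis"
  shows "has_weak_partial \<Omega> e f (\<lambda>p. frechet_derivative f (at p) e)"
  unfolding has_weak_partial_def
proof (intro conjI ballI)
  show "f \<in> L2 M" "(\<lambda>p. frechet_derivative f (at p) e) \<in> L2 M"
    using assms by (simp_all add: smooth_L2 smooth_partial_L2)
  fix \<phi> assume "\<phi> \<in> test_functions \<Omega>"
  then show "(\<integral>x. f x * frechet_derivative \<phi> (at x) e \<partial>M) = - (\<integral>x. frechet_derivative f (at x) e * \<phi> x \<partial>M)"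
    using assms by (intro integral_by_parts) (simp_all add: test_function_smooth test_function_outside)
qed

lemma has_weak_partial_add:
  assumes e: "e \<in> Basis" and u: "has_weak_partial \<Omega> e u g" and v: "has_weak_partial \<Omega> e v h"
  shows "has_weak_partial \<Omega> e (\<lambda>x. u x + v x) (\<lambda>x. g x + h x)"
  unfolding has_weak_partial_def
proof (intro conjI ballI)
  have L: "u \<in> L2 M" "v \<in> L2 M" "g \<in> L2 M" "h \<in> L2 M"
    using u v by (auto simp: has_weak_partial_def)
  then show "(\<lambda>x. u x + v x) \<in> L2 M" "(\<lambda>x. g x + h x) \<in> L2 M" by (auto intro: L2_add)
  fix \<phi> assume \<phi>: "\<phi> \<in> test_functions \<Omega>"
  then have s: "\<phi> \<in> L2 M" "(\<lambda>p. frechet_derivative \<phi> (at p) e) \<in> L2 M"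
    using e by (auto intro: smooth_L2 smooth_partial_L2 test_function_smooth)
  show "(\<integral>x. (u x + v x) * frechet_derivative \<phi> (at x) e \<partial>M) = - (\<integral>x. (g x + h x) * \<phi> x \<partial>M)"
    using u v \<phi> L2_mult_integrable[OF L(1) s(2)] L2_mult_integrable[OF L(2) s(2)]
      L2_mult_integrable[OF L(3) s(1)] L2_mult_integrable[OF L(4) s(1)]
    by (simp add: has_weak_partial_def distrib_right)
qed

lemma has_weak_partial_mult_const:
  assumes u: "has_weak_partial \<Omega> e u g"
  shows "has_weak_partial \<Omega> e (\<lambda>x. c * u x) (\<lambda>x. c * g x)"
  using u by (auto simp: has_weak_partial_def L2_mult_const mult.assoc)

lemma has_weak_partial_diff:
  assumes "e \<in> Basis" "has_weak_partial \<Omega> e u g" "has_weak_partial \<Omega> e v h"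
  shows "has_weak_partial \<Omega> e (\<lambda>x. u x - v x) (\<lambda>x. g x - h x)"
  using has_weak_partial_add[OF assms(1,2) has_weak_partial_mult_const[OF assms(3), of "-1"]] by simp

lemma has_weak_partial_cong:
  assumes e: "e \<in> Basis" and u: "has_weak_partial \<Omega> e u g" and v: "v \<in> borel_measurable M" and ae: "AE x in M. u x = v x"
  shows "has_weak_partial \<Omega> e v g"
  unfolding has_weak_partial_def
proof (intro conjI ballI)
  have L: "u \<in> L2 M" "g \<in> L2 M" using u by (auto simp: has_weak_partial_def)
  show "v \<in> L2 M" "g \<in> L2 M" using L2_cong_AE[OF L(1) v ae] L by auto
  fix \<phi> assume \<phi>: "\<phi> \<in> test_functions \<Omega>"
  then have s: "(\<lambda>p. frechet_derivative \<phi> (at p) e) \<in> borel_measurable M"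
    using e by (auto intro: L2_measurable smooth_partial_L2 test_function_smooth)
  have "(\<integral>x. v x * frechet_derivative \<phi> (at x) e \<partial>M) = (\<integral>x. u x * frechet_derivative \<phi> (at x) e \<partial>M)"
    by (rule integral_cong_AE) (use ae v s L(1) in \<open>auto intro!: borel_measurable_times L2_measurable\<close>)
  then show "(\<integral>x. v x * frechet_derivative \<phi> (at x) e \<partial>M) = - (\<integral>x. g x * \<phi> x \<partial>M)"
    using u \<phi> by (simp add: has_weak_partial_def)
qed

text \<open>Both sides of the defining identity are continuous in the \<open>L\<^sup>2\<close> norm.\<close>
lemma has_weak_partial_closed:
  assumes e: "e \<in> Basis" and d: "\<And>n::nat. has_weak_partial \<Omega> e (u n) (g n)"
    and u: "v \<in> L2 M" "(\<lambda>n. L2_norm M (\<lambda>x. u n x - v x)) \<longlonglongrightarrow> 0"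
    and g: "h \<in> L2 M" "(\<lambda>n. L2_norm M (\<lambda>x. g n x - h x)) \<longlonglongrightarrow> 0"
  shows "has_weak_partial \<Omega> e v h"
  unfolding has_weak_partial_def
proof (intro conjI ballI u g)
  fix \<phi> assume \<phi>: "\<phi> \<in> test_functions \<Omega>"
  then have s: "\<phi> \<in> L2 M" "(\<lambda>p. frechet_derivative \<phi> (at p) e) \<in> L2 M"
    using e by (auto intro: smooth_L2 smooth_partial_L2 test_function_smooth)
  have L: "u n \<in> L2 M" "g n \<in> L2 M" for n using d by (auto simp: has_weak_partial_def)
  have "(\<lambda>n. \<integral>x. u n x * frechet_derivative \<phi> (at x) e \<partial>M) \<longlonglongrightarrow> (\<integral>x. v x * frechet_derivative \<phi> (at x) e \<partial>M)"
    by (rule L2_inner_tendsto[OF _ u(1) s(2) u(2)]) (simp add: L)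
  moreover have "(\<lambda>n. - (\<integral>x. g n x * \<phi> x \<partial>M)) \<longlonglongrightarrow> - (\<integral>x. h x * \<phi> x \<partial>M)"
    by (rule tendsto_minus[OF L2_inner_tendsto[OF _ g(1) s(1) g(2)]]) (simp add: L)
  moreover have "(\<integral>x. u n x * frechet_derivative \<phi> (at x) e \<partial>M) = - (\<integral>x. g n x * \<phi> x \<partial>M)" for n
    using d[of n] \<phi> by (auto simp: has_weak_partial_def)
  ultimately show "(\<integral>x. v x * frechet_derivative \<phi> (at x) e \<partial>M) = - (\<integral>x. h x * \<phi> x \<partial>M)"
    using LIMSEQ_unique by simp
qed

lemma borel_Int_rectangle:
  assumes "S \<in> sets borel" shows "S \<inter> \<Omega> \<in> sets M"
proof -
  have "S \<in> sets lebesgue" using assms by (intro sets_completionI_sets) simp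
  then have "S \<inter> \<Omega> \<in> sets lebesgue" using rectangle_sets by (rule sets.Int)
  then show ?thesis by (simp add: sets_restrict_space_iff)
qed

text \<open>The boxes form an intersection-stable generator of the Borel sets, and a Lebesgue measurable set differs
  from a Borel set by a null set.\<close>
lemma AE_zero_if_boxes:
  fixes G :: "real \<times> real \<Rightarrow> complex"
  assumes G: "integrable M G" and box0: "\<And>p q. (LINT x:box p q \<inter> \<Omega>|M. G x) = 0"
  shows "AE x in M. G x = 0"
proof -
  interpret finite_measure M by (rule finite_measure_M)
  show ?thesis
  proof (rule density_zero[OF G])
  have int: "set_integrable M S G" if "S \<in> sets M" for S
    using G that unfolding set_integrable_def by (rule integrable_mult_indicator[rotated])
  have sets: "S \<inter> \<Omega> \<in> sets M" if "S \<in> sets borel" for S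
    using that by (rule borel_Int_rectangle)
  have borel0: "(LINT x:S \<inter> \<Omega>|M. G x) = 0" if S: "S \<in> sets borel" for S
  proof -
    have "Int_stable (range (\<lambda>(a, b). box a b :: (real \<times> real) set))"
      by (auto simp: Int_stable_def box_Int_box)
    moreover have "range (\<lambda>(a, b). box a b :: (real \<times> real) set) \<subseteq> Pow UNIV" by simp
    moreover have "S \<in> sigma_sets UNIV (range (\<lambda>(a, b). box a b))"
      using S unfolding borel_eq_box by simp
    ultimately show ?thesis
    proof (induction rule: sigma_sets_induct_disjoint)
      case (basic S) then show ?case using box0 by auto
    next
      case empty show ?case by (simp add: set_lebesgue_integral_def)
    next
      case (compl S)
      then have S: "S \<in> sets borel" unfolding borel_eq_box by simp
      have "(LINT x:\<Omega>|M. G x) = 0"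
        using box0[of "(0, 0)" "(A, B)"] by (simp add: rectangle_box)
      moreover have "(LINT x:(UNIV - S) \<inter> \<Omega> \<union> S \<inter> \<Omega>|M. G x) = (LINT x:(UNIV - S) \<inter> \<Omega>|M. G x) + (LINT x:S \<inter> \<Omega>|M. G x)"
        using S by (intro set_integral_Un int sets) auto
      moreover have "(UNIV - S) \<inter> \<Omega> \<union> S \<inter> \<Omega> = \<Omega>" by auto
      ultimately show ?case using compl by simp
    next
      case (union S)
      then have S: "S i \<in> sets borel" for i unfolding borel_eq_box by auto
      have "(LINT x:(\<Union>i. S i \<inter> \<Omega>)|M. G x) = (\<Sum>i. LINT x:S i \<inter> \<Omega>|M. G x)"
      proof (rule lebesgue_integral_countable_add)
        show "set_integrable M (\<Union>i. S i \<inter> \<Omega>) G" by (intro int sets.countable_UN) (auto intro: sets S)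
        show "S i \<inter> \<Omega> \<inter> (S j \<inter> \<Omega>) = {}" if "i \<noteq> j" for i j
          using union(1) that by (auto simp: disjoint_family_on_def)
      qed (auto intro: sets S)
      moreover have "(\<Union>i. S i \<inter> \<Omega>) = (\<Union>i. S i) \<inter> \<Omega>" by auto
      ultimately show ?case using union by simp
    qed
  qed
  fix S assume S: "S \<in> sets M"
  then have S': "S \<subseteq> \<Omega>" "S \<in> sets lebesgue" by (auto simp: sets_restrict_space_iff)
  obtain S0 N N' where d: "S = S0 \<union> N" "N \<subseteq> N'" "N' \<in> null_sets lborel" "S0 \<in> sets lborel"
    using S'(2) by (rule sets_completionE)
  have "AE x in lebesgue. x \<notin> N'" using d(3) by (intro AE_not_in null_sets_completionI)
  then have ae: "AE x in M. x \<notin> N'" by (simp add: AE_restrict_space_iff) (auto elim: eventually_mono)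
  have "(LINT x:S|M. G x) = (LINT x:S0 \<inter> \<Omega>|M. G x)"
    unfolding set_lebesgue_integral_def
  proof (rule integral_cong_AE)
    show "(\<lambda>x. indicator S x *\<^sub>R G x) \<in> borel_measurable M"
      using int[OF S] unfolding set_integrable_def by (rule borel_measurable_integrable)
    show "(\<lambda>x. indicator (S0 \<inter> \<Omega>) x *\<^sub>R G x) \<in> borel_measurable M"
      using int[OF sets] d(4) unfolding set_integrable_def by (intro borel_measurable_integrable) auto
    show "AE x in M. indicator S x *\<^sub>R G x = indicator (S0 \<inter> \<Omega>) x *\<^sub>R G x"
      using ae by eventually_elim (use S' d in \<open>auto simp: indicator_def\<close>)
  qed
  then show "(LINT x:S|M. G x) = 0" using borel0[of S0] d(4) by simp
  qed
qed

lemma cutoff_test_function: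
  assumes "0 \<le> \<alpha>" "\<beta> \<le> A" "0 \<le> \<gamma>" "\<delta> \<le> B" "\<And>k. Ck1 k f" "\<And>k. Ck1 k g"
  shows "(\<lambda>p. complex_of_real ((cutoff \<alpha> \<beta> k (fst p) * f (fst p)) * (cutoff \<gamma> \<delta> k (snd p) * g (snd p)))) \<in> test_functions \<Omega>"
proof -
  \<comment> \<open>For \<open>k = 0\<close> both cutoffs vanish identically.\<close>
  let ?K = "if k = 0 then {} else cbox (\<alpha> + 1 / real k, \<gamma> + 1 / real k) (\<beta> - 1 / real k, \<delta> - 1 / real k)"
  have "smooth (\<lambda>p. 1 * complex_of_real ((cutoff \<alpha> \<beta> k (fst p) * f (fst p)) * (cutoff \<gamma> \<delta> k (snd p) * g (snd p))))"
    using smooth_tensor[of "\<lambda>x. cutoff \<alpha> \<beta> k x * f x" "\<lambda>x. cutoff \<gamma> \<delta> k x * g x" 1] assms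
    by (simp only: Ck1_mult Ck1_cutoff)
  moreover have "compact ?K" by simp
  moreover have "?K \<subseteq> \<Omega>"
  proof (cases "k = 0")
    case False
    then have "1 / real k > 0" by simp
    moreover have "p \<in> \<Omega>" if p: "p \<in> cbox (\<alpha> + 1 / real k, \<gamma> + 1 / real k) (\<beta> - 1 / real k, \<delta> - 1 / real k)" for p
    proof (cases p)
      case (Pair x y)
      then have "\<alpha> + 1 / real k \<le> x" "x \<le> \<beta> - 1 / real k" "\<gamma> + 1 / real k \<le> y" "y \<le> \<delta> - 1 / real k"
        using p by auto
      then have "0 < x" "x < A" "0 < y" "y < B" using \<open>1 / real k > 0\<close> assms(1-4) by linarith+
      then show ?thesis using Pair by (simp add: rectangle_eq)
    qed
    ultimately show ?thesis using False by auto
  qed simp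
  moreover have "complex_of_real ((cutoff \<alpha> \<beta> k (fst p) * f (fst p)) * (cutoff \<gamma> \<delta> k (snd p) * g (snd p))) = 0" if "p \<notin> ?K" for p
  proof (rule ccontr)
    assume "complex_of_real ((cutoff \<alpha> \<beta> k (fst p) * f (fst p)) * (cutoff \<gamma> \<delta> k (snd p) * g (snd p))) \<noteq> 0"
    then have "cutoff \<alpha> \<beta> k (fst p) \<noteq> 0" "cutoff \<gamma> \<delta> k (snd p) \<noteq> 0" by auto
    from cutoff_support[OF this(1)] cutoff_support[OF this(2)] that show False
      by (cases p) auto
  qed
  ultimately show ?thesis unfolding test_functions_def by (simp only: mult_1) blast
qed

text \<open>The fundamental lemma of the calculus of variations: products of one-dimensional cutoffs are test
  functions, and they converge boundedly to the indicator of a box.\<close>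
lemma AE_zero_if_orthogonal_to_test_functions:
  fixes G :: "real \<times> real \<Rightarrow> complex"
  assumes G: "integrable M G"
    and test: "\<And>\<psi> :: real \<times> real \<Rightarrow> real. (\<lambda>p. complex_of_real (\<psi> p)) \<in> test_functions \<Omega> \<Longrightarrow>
      (\<integral>p. G p * of_real (\<psi> p) \<partial>M) = 0"
  shows "AE x in M. G x = 0"
proof (rule AE_zero_if_boxes[OF G])
  fix p q :: "real \<times> real"
  define \<alpha> \<beta> \<gamma> \<delta> where "\<alpha> = max 0 (fst p)" and "\<beta> = min A (fst q)" and "\<gamma> = max 0 (snd p)" and "\<delta> = min B (snd q)"
  let ?\<psi> = "\<lambda>k x. cutoff \<alpha> \<beta> k (fst x) * cutoff \<gamma> \<delta> k (snd x)"
  have [measurable]: "G \<in> borel_measurable M" using G by simp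
  have psi_test: "(\<lambda>x. complex_of_real (?\<psi> k x)) \<in> test_functions \<Omega>" for k
    using cutoff_test_function[of \<alpha> \<beta> \<gamma> \<delta> "\<lambda>x. 1" "\<lambda>x. 1" k] by (simp add: \<alpha>_def \<beta>_def \<gamma>_def \<delta>_def)
  then have [measurable]: "(\<lambda>x. complex_of_real (?\<psi> k x)) \<in> borel_measurable M" for k
    by (intro L2_measurable smooth_L2 test_function_smooth)
  have "(\<lambda>k. \<integral>x. G x * of_real (?\<psi> k x) \<partial>M) \<longlonglongrightarrow> (\<integral>x. indicator (box p q \<inter> \<Omega>) x *\<^sub>R G x \<partial>M)"
  proof (rule integral_dominated_convergence[where w="\<lambda>x. norm (G x)"])
    show "integrable M (\<lambda>x. norm (G x))" using G by simp
    show "(\<lambda>x. indicator (box p q \<inter> \<Omega>) x *\<^sub>R G x) \<in> borel_measurable M"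
      using integrable_mult_indicator[OF _ G, of "box p q \<inter> \<Omega>"] borel_Int_rectangle[of "box p q"] by (simp add: borel_measurable_integrable)
    show "AE x in M. (\<lambda>k. G x * of_real (?\<psi> k x)) \<longlonglongrightarrow> indicator (box p q \<inter> \<Omega>) x *\<^sub>R G x"
    proof (rule AE_I2)
      fix x assume x: "x \<in> space M"
      have "(\<lambda>k. G x * of_real (?\<psi> k x)) \<longlonglongrightarrow>
        G x * of_real ((if \<alpha> < fst x \<and> fst x < \<beta> then 1 else 0) * (if \<gamma> < snd x \<and> snd x < \<delta> then 1 else 0))"
        by (intro tendsto_intros cutoff_tendsto)
      also have "G x * of_real ((if \<alpha> < fst x \<and> fst x < \<beta> then 1 else 0) * (if \<gamma> < snd x \<and> snd x < \<delta> then 1 else 0))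
        = indicator (box p q \<inter> \<Omega>) x *\<^sub>R G x"
        using x by (cases x; cases p; cases q)
          (auto simp: rectangle_eq \<alpha>_def \<beta>_def \<gamma>_def \<delta>_def box_def Basis_prod_def indicator_def)
      finally show "(\<lambda>k. G x * of_real (?\<psi> k x)) \<longlonglongrightarrow> indicator (box p q \<inter> \<Omega>) x *\<^sub>R G x" .
    qed
    show "AE x in M. norm (G x * of_real (?\<psi> k x)) \<le> norm (G x)" for k
    proof (rule AE_I2)
      fix x
      have "\<bar>?\<psi> k x\<bar> \<le> 1" by (simp add: cutoff_bounds mult_le_one abs_mult)
      then show "norm (G x * of_real (?\<psi> k x)) \<le> norm (G x)"
        using mult_left_mono[of "\<bar>?\<psi> k x\<bar>" 1 "norm (G x)"] by (simp add: norm_mult del: of_real_mult)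
    qed
  qed (auto simp del: of_real_mult)
  then have "(\<lambda>k. 0) \<longlonglongrightarrow> (\<integral>x. indicator (box p q \<inter> \<Omega>) x *\<^sub>R G x \<partial>M)"
    using test[OF psi_test] by simp
  then show "(LINT x:box p q \<inter> \<Omega>|M. G x) = 0"
    unfolding set_lebesgue_integral_def using LIMSEQ_unique tendsto_const by metis
qed

lemma has_weak_partial_unique:
  assumes "has_weak_partial \<Omega> e u g" "has_weak_partial \<Omega> e u h"
  shows "AE x in M. g x = h x"
proof -
  have L: "g \<in> L2 M" "h \<in> L2 M" using assms by (auto simp: has_weak_partial_def)
  have "AE x in M. g x - h x = 0"
  proof (rule AE_zero_if_orthogonal_to_test_functions)
    show "integrable M (\<lambda>x. g x - h x)"
      by (intro L2_imp_integrable[OF finite_measure_M] L2_diff L)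
    fix \<psi> :: "real \<times> real \<Rightarrow> real" assume \<psi>: "(\<lambda>p. complex_of_real (\<psi> p)) \<in> test_functions \<Omega>"
    then have s: "(\<lambda>p. complex_of_real (\<psi> p)) \<in> L2 M"
      by (auto intro: smooth_L2 test_function_smooth)
    have "(\<integral>x. g x * of_real (\<psi> x) \<partial>M) = (\<integral>x. h x * of_real (\<psi> x) \<partial>M)"
      using assms \<psi> by (simp add: has_weak_partial_def)
    then show "(\<integral>x. (g x - h x) * of_real (\<psi> x) \<partial>M) = 0"
      using L2_mult_integrable[OF L(1) s] L2_mult_integrable[OF L(2) s] by (simp add: left_diff_distrib)
  qed
  then show ?thesis by eventually_elim simp
qed

lemma has_weak_partial_weak_partial:
  "has_weak_partial \<Omega> e u g \<Longrightarrow> has_weak_partial \<Omega> e u (wp e u)"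
  unfolding weak_partial_def by (rule someI[where P="has_weak_partial \<Omega> e u"])

text \<open>By uniqueness, the arbitrary choice in the definition of the weak derivative does not matter.\<close>
lemma weak_partial_eq:
  "has_weak_partial \<Omega> e u g \<Longrightarrow> AE x in M. wp e u x = g x"
  by (rule has_weak_partial_unique[OF has_weak_partial_weak_partial])

lemma L2_norm_weak_partial:
  assumes "has_weak_partial \<Omega> e u g" shows "L2_norm M (wp e u) = L2_norm M g"
  by (rule L2_norm_cong_AE[OF _ _ weak_partial_eq[OF assms]])
     (use assms has_weak_partial_weak_partial[OF assms] in \<open>auto simp: has_weak_partial_def L2_def\<close>)

lemma H1_weak_partial: "u \<in> H1 \<Omega> \<Longrightarrow> e \<in> Basis \<Longrightarrow> has_weak_partial \<Omega> e u (wp e u)"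
  unfolding H1_def using has_weak_partial_weak_partial by blast

lemma H1_L2: "u \<in> H1 \<Omega> \<Longrightarrow> u \<in> L2 M" by (simp add: H1_def)

lemma weak_partial_L2: "u \<in> H1 \<Omega> \<Longrightarrow> e \<in> Basis \<Longrightarrow> wp e u \<in> L2 M"
  using H1_weak_partial by (auto simp: has_weak_partial_def)

lemma smooth_H1: "smooth f \<Longrightarrow> f \<in> H1 \<Omega>"
  unfolding H1_def using smooth_L2 smooth_has_weak_partial by blast

lemma H1_norm_sq:
  assumes "has_weak_partial \<Omega> (1, 0) u g" "has_weak_partial \<Omega> (0, 1) u h"
  shows "(H1_norm \<Omega> u)\<^sup>2 = (L2_norm M u)\<^sup>2 + (L2_norm M g)\<^sup>2 + (L2_norm M h)\<^sup>2"
  unfolding H1_norm_def grad_norm_def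
  using assms by (simp add: Basis_prod_def L2_norm_weak_partial)

lemma H1_norm_nonneg: "0 \<le> H1_norm \<Omega> u" by (simp add: H1_norm_def)

lemma L2_norm_le_H1_norm: "L2_norm M u \<le> H1_norm \<Omega> u"
  unfolding H1_norm_def by (rule real_le_rsqrt) simp

lemma L2_norm_weak_partial_le_H1_norm:
  assumes "e \<in> Basis" shows "L2_norm M (wp e u) \<le> H1_norm \<Omega> u"
proof -
  have "(L2_norm M (wp e u))\<^sup>2 \<le> (\<Sum>e\<in>Basis. (L2_norm M (wp e u))\<^sup>2)"
    by (rule member_le_sum) (use assms in auto)
  also have "\<dots> = (grad_norm \<Omega> u)\<^sup>2"
    unfolding grad_norm_def by (rule real_sqrt_pow2[symmetric]) (auto intro: sum_nonneg)
  finally show ?thesis unfolding H1_norm_def by (intro real_le_rsqrt) (simp add: add_increasing)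
qed

end

section \<open>The sine basis\<close>

lemma integral_cos_multiple:
  fixes j :: int
  assumes "r > 0"
  shows "integral {0..r * pi} (\<lambda>x. cos (of_int j * x / r)) = (if j = 0 then r * pi else 0)"
proof (cases "j = 0")
  case False
  have "((\<lambda>x. cos (of_int j * x / r)) has_integral
      (r / of_int j * sin (of_int j * (r * pi) / r) - r / of_int j * sin (of_int j * 0 / r))) {0..r * pi}"
    by (rule fundamental_theorem_of_calculus)
       (use assms False in \<open>auto intro!: derivative_eq_intros simp flip: has_real_derivative_iff_has_vector_derivative\<close>)
  then show ?thesis using assms False
    by (auto dest!: integral_unique simp: sin_npi_int mult.commute)
qed (use assms in simp)

lemma integral_trig_orthogonal:
  fixes m k :: nat
  assumes r: "r > 0" and mk: "m \<ge> 1" "k \<ge> 1" and f: "f \<in> {sin, cos}"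
  shows "integral {0..r * pi} (\<lambda>x. f (real m * x / r) * f (real k * x / r)) = (if m = k then r * pi / 2 else 0)"
proof -
  define s :: real where "s = (if f = sin then -1 else 1)"
  have ne: "sin \<noteq> (cos :: real \<Rightarrow> real)" by (metis cos_zero sin_zero zero_neq_one)
  have "f (real m * x / r) * f (real k * x / r)
      = cos (of_int (int m - int k) * x / r) / 2 + s * cos (of_int (int m + int k) * x / r) / 2" for x
  proof -
    have e: "of_int (int m - int k) * x / r = real m * x / r - real k * x / r"
      "of_int (int m + int k) * x / r = real m * x / r + real k * x / r"
      by (simp_all add: left_diff_distrib distrib_right diff_divide_distrib add_divide_distrib)
    show ?thesis unfolding e
      using f ne by (auto simp: s_def sin_times_sin cos_times_cos add_divide_distrib diff_divide_distrib)
  qed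
  moreover have "(\<lambda>x. cos (of_int j * x / r)) integrable_on {0..r * pi}" for j :: int
    by (intro integrable_continuous_interval continuous_intros) (use r in auto)
  then have i: "(\<lambda>x. cos (of_int j * x / r) / 2) integrable_on {0..r * pi}"
      "(\<lambda>x. s * cos (of_int j * x / r) / 2) integrable_on {0..r * pi}" for j :: int
    by (auto intro!: integrable_on_divide integrable_on_mult_right)
  ultimately have "integral {0..r * pi} (\<lambda>x. f (real m * x / r) * f (real k * x / r))
      = integral {0..r * pi} (\<lambda>x. cos (of_int (int m - int k) * x / r)) / 2
        + s * integral {0..r * pi} (\<lambda>x. cos (of_int (int m + int k) * x / r)) / 2"
    using integral_add[OF i(1)[of "int m - int k"] i(2)[of "int m + int k"]] by (simp only: integral_divide integral_mult_right)
  also have "\<dots> = (if m = k then r * pi / 2 else 0)"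
    using mk by (simp add: integral_cos_multiple[OF r] del: of_int_diff of_int_add)
  finally show ?thesis .
qed

context rect begin

text \<open>With \<open>f\<close> and \<open>g\<close> ranging over sine and cosine, this covers the sine basis and all its derivatives, up
  to constant factors.\<close>
definition mode :: "(real \<Rightarrow> real) \<Rightarrow> (real \<Rightarrow> real) \<Rightarrow> nat \<times> nat \<Rightarrow> real \<times> real \<Rightarrow> real" where
  "mode f g q p = f (real (fst q) * fst p / a) * g (real (snd q) * snd p / b)"

definition J :: "(nat \<times> nat) set" where "J = {1..} \<times> {1..}"

definition I :: "nat \<Rightarrow> (nat \<times> nat) set" where "I N = {1..N} \<times> {1..N}"

lemma I_props: "finite (I N)" "I N \<subseteq> J" "incseq I" "J \<subseteq> (\<Union>n. I n)"
proof -
  show "J \<subseteq> (\<Union>n. I n)"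
  proof
    fix q assume "q \<in> J"
    then have "q \<in> I (max (fst q) (snd q))" by (cases q) (auto simp: I_def J_def)
    then show "q \<in> (\<Union>n. I n)" by blast
  qed
qed (auto simp: I_def J_def incseq_def)

definition "\<kappa> = A * B / 4"

lemma kappa_pos: "\<kappa> > 0" using A_pos B_pos by (simp add: \<kappa>_def)

lemma continuous_mode:
  assumes "f \<in> {sin, cos}" "g \<in> {sin, cos}" shows "continuous_on UNIV (mode f g q)"
proof -
  have "continuous_on UNIV f" "continuous_on UNIV g" using assms by (auto intro: continuous_intros)
  then show ?thesis unfolding mode_def using a_pos b_pos
    by (auto intro!: continuous_intros continuous_on_compose2[of UNIV f] continuous_on_compose2[of UNIV g])
qed

lemma mode_L2:
  "f \<in> {sin, cos} \<Longrightarrow> g \<in> {sin, cos} \<Longrightarrow> (\<lambda>p. complex_of_real (mode f g q p)) \<in> L2 M"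
  by (intro continuous_L2 continuous_on_of_real continuous_mode)

lemma mode_bounded: "f \<in> {sin, cos} \<Longrightarrow> g \<in> {sin, cos} \<Longrightarrow> \<bar>mode f g q p\<bar> \<le> 1"
  by (auto simp: mode_def abs_mult mult_le_one)

lemma integral_mode_mult:
  assumes f: "f \<in> {sin, cos}" and g: "g \<in> {sin, cos}" and pq: "p \<in> J" "q \<in> J"
  shows "(\<integral>x. mode f g p x * mode f g q x \<partial>M) = (if p = q then \<kappa> else 0)"
proof -
  have "(\<integral>x. mode f g p x * mode f g q x \<partial>M)
      = integral {0..A} (\<lambda>x. integral {0..B} (\<lambda>y. (f (real (fst p) * x / a) * f (real (fst q) * x / a)) *
          (g (real (snd p) * y / b) * g (real (snd q) * y / b))))"
    by (subst integral_iterated(1)[OF continuous_on_mult[OF continuous_mode[OF f g] continuous_mode[OF f g]]])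
       (simp add: mode_def mult_ac)
  also have "\<dots> = integral {0..A} (\<lambda>x. f (real (fst p) * x / a) * f (real (fst q) * x / a)) *
      integral {0..B} (\<lambda>y. g (real (snd p) * y / b) * g (real (snd q) * y / b))"
    by simp
  also have "\<dots> = (if p = q then \<kappa> else 0)"
    using pq unfolding A_def B_def
    by (subst (1 2) integral_trig_orthogonal) (use f g a_pos b_pos in \<open>auto simp: J_def \<kappa>_def A_def B_def prod_eq_iff\<close>)
  finally show ?thesis .
qed

lemma mode_orthogonal:
  assumes "f \<in> {sin, cos}" "g \<in> {sin, cos}" shows "orthogonal_system M (mode f g) J \<kappa>"
  by (rule orthogonal_system.intro[OF finite_measure_M mode_L2[OF assms] kappa_pos integral_mode_mult[OF assms]])

inductive sine_span :: "(real \<times> real \<Rightarrow> real) \<Rightarrow> bool" where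
  mode: "sine_span (mode sin sin q)"
| add: "sine_span g \<Longrightarrow> sine_span h \<Longrightarrow> sine_span (\<lambda>p. g p + h p)"
| scale: "sine_span g \<Longrightarrow> sine_span (\<lambda>p. c * g p)"

lemma sine_span_continuous: "sine_span g \<Longrightarrow> continuous_on UNIV g"
  by (induction rule: sine_span.induct)
    (simp_all only: continuous_mode insertI1 continuous_on_add continuous_on_mult continuous_on_const)

text \<open>Multipliers of the span form an algebra that contains the constants and the two basic cosines,
  hence one to which the Stone--Weierstrass theorem applies.\<close>
definition multipliers :: "(real \<times> real \<Rightarrow> real) set" where
  "multipliers = {q. continuous_on UNIV q \<and> (\<forall>g. sine_span g \<longrightarrow> sine_span (\<lambda>p. q p * g p))}"

text \<open>The coefficients are zero for \<open>m = 0\<close>, where truncated subtraction would make the addition formula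
  wrong.\<close>
lemma cos_sin_step:
  "cos t * sin (real m * t) = (if m = 0 then 0 else 1/2) * sin (real (Suc m) * t) + (if m = 0 then 0 else 1/2) * sin (real (m - 1) * t)"
proof (cases m)
  case (Suc n)
  have "sin (real (Suc n) * t) * cos t = (sin (real (Suc n) * t + t) + sin (real (Suc n) * t - t)) / 2"
    by (rule sin_times_cos)
  also have "real (Suc n) * t + t = real (Suc (Suc n)) * t" by (simp add: algebra_simps)
  also have "real (Suc n) * t - t = real n * t" by (simp add: algebra_simps)
  finally show ?thesis using Suc by (simp add: mult.commute add_divide_distrib)
qed simp

lemma cos_in_multipliers:
  shows "(\<lambda>p. cos (fst p / a)) \<in> multipliers" and "(\<lambda>p. cos (snd p / b)) \<in> multipliers"
proof -
  have mult: "sine_span (\<lambda>p. q p * g p)" if "sine_span g" and base: "\<And>k. sine_span (\<lambda>p. q p * mode sin sin k p)" for q g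
    using that(1)
  proof induction
    case (mode k) show ?case by (rule base)
  next
    case (add g h)
    then show ?case by (simp only: distrib_left sine_span.add)
  next
    case (scale g c)
    then show ?case by (simp only: mult.left_commute[of "q _"] sine_span.scale)
  qed
  have "(\<lambda>p. cos (fst p / a) * mode sin sin q p)
      = (\<lambda>p. (if fst q = 0 then 0 else 1/2) * mode sin sin (Suc (fst q), snd q) p
          + (if fst q = 0 then 0 else 1/2) * mode sin sin (fst q - 1, snd q) p)" for q
  proof
    fix p
    show "cos (fst p / a) * mode sin sin q p = (if fst q = 0 then 0 else 1/2) * mode sin sin (Suc (fst q), snd q) p
          + (if fst q = 0 then 0 else 1/2) * mode sin sin (fst q - 1, snd q) p"
    proof (cases "fst q = 0")
      case True then show ?thesis by (simp add: mode_def)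
    next
      case False
      have "cos (fst p / a) * mode sin sin q p = (cos (fst p / a) * sin (real (fst q) * (fst p / a))) * sin (real (snd q) * snd p / b)"
        by (simp add: mode_def)
      also have "cos (fst p / a) * sin (real (fst q) * (fst p / a))
          = 1/2 * sin (real (Suc (fst q)) * (fst p / a)) + 1/2 * sin (real (fst q - 1) * (fst p / a))"
        using cos_sin_step[of "fst p / a" "fst q"] False by simp
      also have "(1/2 * sin (real (Suc (fst q)) * (fst p / a)) + 1/2 * sin (real (fst q - 1) * (fst p / a))) * sin (real (snd q) * snd p / b)
          = 1/2 * mode sin sin (Suc (fst q), snd q) p + 1/2 * mode sin sin (fst q - 1, snd q) p"
        by (simp add: mode_def distrib_right)
      finally show ?thesis using False by (simp only: if_False)
    qed
  qed
  then have "sine_span (\<lambda>p. cos (fst p / a) * mode sin sin q p)" for q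
    by (simp only:) (intro sine_span.intros)
  then have "\<forall>g. sine_span g \<longrightarrow> sine_span (\<lambda>p. cos (fst p / a) * g p)"
    using mult[of _ "\<lambda>p. cos (fst p / a)"] by blast
  moreover have "continuous_on UNIV (\<lambda>p::real \<times> real. cos (fst p / a))"
    using a_pos by (intro continuous_intros) simp
  ultimately show "(\<lambda>p. cos (fst p / a)) \<in> multipliers"
    unfolding multipliers_def by blast
  have "(\<lambda>p. cos (snd p / b) * mode sin sin q p)
      = (\<lambda>p. (if snd q = 0 then 0 else 1/2) * mode sin sin (fst q, Suc (snd q)) p
          + (if snd q = 0 then 0 else 1/2) * mode sin sin (fst q, snd q - 1) p)" for q
  proof
    fix p
    show "cos (snd p / b) * mode sin sin q p = (if snd q = 0 then 0 else 1/2) * mode sin sin (fst q, Suc (snd q)) p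
          + (if snd q = 0 then 0 else 1/2) * mode sin sin (fst q, snd q - 1) p"
    proof (cases "snd q = 0")
      case True then show ?thesis by (simp add: mode_def)
    next
      case False
      have "cos (snd p / b) * mode sin sin q p = (cos (snd p / b) * sin (real (snd q) * (snd p / b))) * sin (real (fst q) * fst p / a)"
        by (simp add: mode_def)
      also have "cos (snd p / b) * sin (real (snd q) * (snd p / b))
          = 1/2 * sin (real (Suc (snd q)) * (snd p / b)) + 1/2 * sin (real (snd q - 1) * (snd p / b))"
        using cos_sin_step[of "snd p / b" "snd q"] False by simp
      also have "(1/2 * sin (real (Suc (snd q)) * (snd p / b)) + 1/2 * sin (real (snd q - 1) * (snd p / b))) * sin (real (fst q) * fst p / a)
          = 1/2 * mode sin sin (fst q, Suc (snd q)) p + 1/2 * mode sin sin (fst q, snd q - 1) p"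
        by (simp add: mode_def distrib_left mult.commute[of _ "sin (real (fst q) * fst p / a)"])
      finally show ?thesis using False by (simp only: if_False)
    qed
  qed
  then have "sine_span (\<lambda>p. cos (snd p / b) * mode sin sin q p)" for q
    by (simp only:) (intro sine_span.intros)
  then have "\<forall>g. sine_span g \<longrightarrow> sine_span (\<lambda>p. cos (snd p / b) * g p)"
    using mult[of _ "\<lambda>p. cos (snd p / b)"] by blast
  moreover have "continuous_on UNIV (\<lambda>p::real \<times> real. cos (snd p / b))"
    using b_pos by (intro continuous_intros) simp
  ultimately show "(\<lambda>p. cos (snd p / b)) \<in> multipliers"
    unfolding multipliers_def by blast
qed

lemma multipliers_ring: "function_ring_on multipliers (cbox (0, 0) (A, B))"
proof
  show "compact (cbox (0, 0) (A, B))" by (rule compact_cbox)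
  show "continuous_on (cbox (0, 0) (A, B)) f" if "f \<in> multipliers" for f
    using that unfolding multipliers_def by (blast intro: continuous_on_subset)
  show "(\<lambda>x. f x + g x) \<in> multipliers" "(\<lambda>x. f x * g x) \<in> multipliers"
    if "f \<in> multipliers" "g \<in> multipliers" for f g
    using that unfolding multipliers_def
    by (auto intro!: continuous_intros sine_span.add simp: distrib_right mult.assoc)
  show "(\<lambda>_. c) \<in> multipliers" for c
    unfolding multipliers_def by (auto intro: sine_span.scale)
  fix x y :: "real \<times> real"
  assume "x \<in> cbox (0, 0) (A, B)" "y \<in> cbox (0, 0) (A, B)" and ne: "x \<noteq> y"
  then have x: "0 \<le> fst x / a" "fst x / a \<le> pi" "0 \<le> snd x / b" "snd x / b \<le> pi"
    and y: "0 \<le> fst y / a" "fst y / a \<le> pi" "0 \<le> snd y / b" "snd y / b \<le> pi"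
    using a_pos b_pos by (cases x; cases y; auto simp: A_def B_def divide_le_eq mult.commute)+
  show "\<exists>f\<in>multipliers. f x \<noteq> f y"
  proof (cases "fst x = fst y")
    case False
    then have "cos (fst x / a) \<noteq> cos (fst y / a)"
      using cos_inj_pi[of "fst x / a" "fst y / a"] x y a_pos by auto
    then show ?thesis using cos_in_multipliers(1) by (intro bexI[of _ "\<lambda>p. cos (fst p / a)"])
  next
    case True
    then have "snd x \<noteq> snd y" using ne by (simp add: prod_eq_iff)
    then have "cos (snd x / b) \<noteq> cos (snd y / b)"
      using cos_inj_pi[of "snd x / b" "snd y / b"] x y b_pos by auto
    then show ?thesis using cos_in_multipliers(2) by (intro bexI[of _ "\<lambda>p. cos (snd p / b)"])
  qed
qed

text \<open>It suffices to test against compactly supported continuous functions. Such a function is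
  \<open>sin (x/a) sin (y/b)\<close> times a continuous function, and the latter is a uniform limit of multipliers.\<close>
lemma sine_system_total:
  assumes f: "f \<in> L2 M" and orth: "\<And>q. q \<in> J \<Longrightarrow> (\<integral>x. f x * of_real (mode sin sin q x) \<partial>M) = 0"
  shows "AE x in M. f x = 0"
proof (rule AE_zero_if_orthogonal_to_test_functions)
  show fint: "integrable M f" by (rule L2_imp_integrable[OF finite_measure_M f])
  have int: "integrable M (\<lambda>x. f x * complex_of_real (g x))" if "continuous_on UNIV g" for g
    by (intro L2_mult_integrable f continuous_L2 continuous_on_of_real that)
  have span0: "(\<integral>x. f x * complex_of_real (g x) \<partial>M) = 0" if "sine_span g" for g
    using that
  proof induction
    case (mode q)
    show ?case
    proof (cases "q \<in> J")
      case False
      then have "mode sin sin q p = 0" for p by (cases q) (auto simp: J_def mode_def not_le)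
      then show ?thesis by simp
    qed (rule orth)
  next
    case (add g h)
    then show ?case
      using int[of g] int[of h] sine_span_continuous by (simp add: distrib_left)
  next
    case (scale g c)
    then show ?case by (simp add: mult.left_commute[of _ "complex_of_real c"])
  qed
  fix \<psi> :: "real \<times> real \<Rightarrow> real" assume \<psi>: "(\<lambda>p. complex_of_real (\<psi> p)) \<in> test_functions \<Omega>"
  then obtain K where K: "compact K" "K \<subseteq> \<Omega>" "\<And>x. x \<notin> K \<Longrightarrow> \<psi> x = 0"
    unfolding test_functions_def using of_real_eq_0_iff by blast
  have "continuous_on UNIV (\<lambda>p. Re (complex_of_real (\<psi> p)))"
    by (intro continuous_on_Re smooth_continuous test_function_smooth \<psi>)
  then have cont: "continuous_on UNIV \<psi>" by simp
  let ?s = "mode sin sin (1, 1)"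
  have s_pos: "?s p > 0" if "p \<in> \<Omega>" for p
  proof -
    have "0 < fst p / a" "fst p / a < pi" "0 < snd p / b" "snd p / b < pi"
      using that a_pos b_pos by (auto simp: rectangle_def divide_less_eq mult.commute)
    then show ?thesis by (simp add: mode_def sin_gt_zero)
  qed
  have s_cont: "continuous_on UNIV ?s" by (rule continuous_mode) auto
  obtain \<eta> where \<eta>: "\<eta> > 0" "\<And>p. p \<in> K \<Longrightarrow> ?s p \<ge> \<eta>"
  proof (cases "K = {}")
    case True then show ?thesis by (intro that[of 1]) auto
  next
    case False
    obtain p0 where "p0 \<in> K" "\<forall>p\<in>K. ?s p0 \<le> ?s p"
      using continuous_attains_inf[OF K(1) False continuous_on_subset[OF s_cont]] by auto
    then show ?thesis using K(2) s_pos[of p0] by (intro that[of "?s p0"]) blast+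
  qed
  \<comment> \<open>The maximum changes nothing on the support of \<open>\<psi>\<close> and makes the quotient continuous everywhere.\<close>
  define q where "q p = \<psi> p / max (?s p) \<eta>" for p
  have q_cont: "continuous_on UNIV q"
    unfolding q_def using \<eta>(1) by (intro continuous_intros cont s_cont) (auto simp: max_def)
  have \<psi>_eq: "\<psi> p = q p * ?s p" for p
    using \<eta>(1) \<eta>(2)[of p] K(3)[of p] by (cases "p \<in> K") (auto simp: q_def max_absorb1)
  interpret function_ring_on multipliers "cbox (0, 0) (A, B)" by (rule multipliers_ring)
  obtain F where F: "\<And>n::nat. F n \<in> multipliers" "uniform_limit (cbox (0, 0) (A, B)) F q sequentially"
    using Stone_Weierstrass[OF continuous_on_subset[OF q_cont]] by (auto simp: Pi_iff)
  have "norm (\<integral>p. f p * of_real (\<psi> p) \<partial>M) \<le> e * (\<integral>p. norm (f p) \<partial>M)" if "e > 0" for e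
  proof -
    obtain n where n: "\<forall>p\<in>cbox (0, 0) (A, B). dist (F n p) (q p) < e"
      using uniform_limitD[OF F(2) \<open>e > 0\<close>] by (auto simp: eventually_sequentially)
    have "sine_span (\<lambda>p. F n p * ?s p)" using F(1)[of n] unfolding multipliers_def by (auto intro: sine_span.mode)
    then have F0: "(\<integral>p. f p * of_real (F n p * ?s p) \<partial>M) = 0" and F_cont: "continuous_on UNIV (\<lambda>p. F n p * ?s p)"
      using span0 sine_span_continuous by blast+
    have "(\<integral>p. f p * of_real (\<psi> p) \<partial>M) = (\<integral>p. f p * of_real (\<psi> p) - f p * of_real (F n p * ?s p) \<partial>M)"
      using F0 int[OF cont] int[OF F_cont] by simp
    also have "norm \<dots> \<le> (\<integral>p. norm (f p * of_real (\<psi> p) - f p * of_real (F n p * ?s p)) \<partial>M)"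
      by (rule integral_norm_bound)
    also have "\<dots> \<le> (\<integral>p. e * norm (f p) \<partial>M)"
    proof (rule integral_mono)
      show "integrable M (\<lambda>p. norm (f p * of_real (\<psi> p) - f p * of_real (F n p * ?s p)))"
        using int[OF cont] int[OF F_cont] by (intro integrable_norm Bochner_Integration.integrable_diff)
      show "integrable M (\<lambda>p. e * norm (f p))" using fint by simp
      fix p assume "p \<in> space M"
      then have "p \<in> cbox (0, 0) (A, B)" using rectangle_subset_cbox by auto
      then have "\<bar>q p - F n p\<bar> \<le> e" using n by (simp add: dist_real_def abs_minus_commute less_imp_le)
      then have "\<bar>q p - F n p\<bar> * \<bar>?s p\<bar> \<le> e * 1"
        using mode_bounded[of sin sin "(1, 1)" p] by (intro mult_mono) (use \<open>e > 0\<close> in auto)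
      moreover have "f p * of_real (\<psi> p) - f p * of_real (F n p * ?s p) = f p * of_real ((q p - F n p) * ?s p)"
        by (simp add: \<psi>_eq algebra_simps)
      ultimately show "norm (f p * of_real (\<psi> p) - f p * of_real (F n p * ?s p)) \<le> e * norm (f p)"
        using mult_left_mono[of "\<bar>q p - F n p\<bar> * \<bar>?s p\<bar>" e "norm (f p)"]
        by (simp only: norm_mult norm_of_real abs_mult) (simp add: mult.commute)
    qed
    finally show ?thesis by simp
  qed
  note le = this
  have "((\<lambda>e. e * (\<integral>p. norm (f p) \<partial>M)) \<longlongrightarrow> 0 * (\<integral>p. norm (f p) \<partial>M)) (at_right 0)"
    by (intro tendsto_intros)
  then have "norm (\<integral>p. f p * of_real (\<psi> p) \<partial>M) \<le> 0 * (\<integral>p. norm (f p) \<partial>M)"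
  proof (rule tendsto_lowerbound)
    show "\<forall>\<^sub>F e in at_right 0. norm (\<integral>p. f p * of_real (\<psi> p) \<partial>M) \<le> e * (\<integral>p. norm (f p) \<partial>M)"
      using eventually_at_right_less[of 0] by eventually_elim (rule le)
  qed simp
  then show "(\<integral>p. f p * of_real (\<psi> p) \<partial>M) = 0" by simp
qed

end

section \<open>Fourier coefficients of functions in the domain of the Laplacian\<close>

text \<open>Sine modes cut off near the ends of the interval: products of two of them are test functions.\<close>
definition cut_sin :: "real \<Rightarrow> nat \<Rightarrow> nat \<Rightarrow> real \<Rightarrow> real" where
  "cut_sin r m k x = cutoff 0 (r * pi) k x * sin (real m * x / r)"

definition cut_sin' :: "real \<Rightarrow> nat \<Rightarrow> nat \<Rightarrow> real \<Rightarrow> real" where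
  "cut_sin' r m k x = cutoff' 0 (r * pi) k x * sin (real m * x / r)
     + cutoff 0 (r * pi) k x * (real m / r * cos (real m * x / r))"

lemma cut_sin_deriv: "r > 0 \<Longrightarrow> (cut_sin r m k has_real_derivative cut_sin' r m k x) (at x)"
  unfolding cut_sin_def[abs_def]
  by (rule DERIV_cong[OF DERIV_mult[OF cutoff_deriv]])
     (auto intro!: derivative_eq_intros simp: cut_sin'_def mult_ac)

lemma abs_sin_le: "\<bar>sin x\<bar> \<le> \<bar>x\<bar>" for x :: real
  by (rule abs_sin_x_le_abs_x)

lemma cut_sin_bound: "\<bar>cut_sin r m k x\<bar> \<le> 1"
  unfolding cut_sin_def abs_mult by (intro mult_le_one) (auto simp: cutoff_bounds)

lemma cut_sin'_bound:
  assumes r: "r > 0" and x: "0 \<le> x" "x \<le> r * pi"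
  shows "\<bar>cut_sin' r m k x\<bar> \<le> 9 * (real m / r)"
proof -
  have "\<bar>sin (real m * x / r)\<bar> \<le> real m / r * (x - 0)"
    using abs_sin_le[of "real m * x / r"] r x by simp
  moreover have "\<bar>sin (real m * x / r)\<bar> \<le> real m / r * (r * pi - x)"
  proof -
    \<comment> \<open>The sine vanishes at the right end, too; reflect it there.\<close>
    have e: "real m * x / r = real m * pi - real m / r * (r * pi - x)" using r by (simp add: field_simps)
    have c: "\<bar>cos (real m * pi)\<bar> = 1"
      by (simp add: cos_npi power_abs)
    have "\<bar>sin (real m * x / r)\<bar> = \<bar>sin (real m / r * (r * pi - x))\<bar>"
      unfolding e sin_diff abs_mult using c by (simp add: abs_mult)
    also have "\<dots> \<le> \<bar>real m / r * (r * pi - x)\<bar>" by (rule abs_sin_le)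
    finally show ?thesis using r x by simp
  qed
  ultimately have 1: "\<bar>cutoff' 0 (r * pi) k x * sin (real m * x / r)\<bar> \<le> 8 * (real m / r)"
    by (rule cutoff'_bound) (use r in simp)
  have "\<bar>cutoff 0 (r * pi) k x * (real m / r * cos (real m * x / r))\<bar> \<le> 1 * (real m / r * 1)"
    unfolding abs_mult by (intro mult_mono) (use r in \<open>auto simp: cutoff_bounds\<close>)
  with 1 have "\<bar>cutoff' 0 (r * pi) k x * sin (real m * x / r)\<bar> + \<bar>cutoff 0 (r * pi) k x * (real m / r * cos (real m * x / r))\<bar>
      \<le> 8 * (real m / r) + 1 * (real m / r * 1)" by (rule add_mono)
  with abs_triangle_ineq show ?thesis unfolding cut_sin'_def by (rule order_trans[THEN order_trans]) simp
qed

lemma cut_sin_tendsto: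
  assumes "0 < x" "x < r * pi"
  shows "(\<lambda>k. cut_sin r m k x) \<longlonglongrightarrow> sin (real m * x / r)"
    and "(\<lambda>k. cut_sin' r m k x) \<longlonglongrightarrow> real m / r * cos (real m * x / r)"
proof -
  have c: "(\<lambda>k. cutoff 0 (r * pi) k x) \<longlonglongrightarrow> 1" using cutoff_tendsto[of 0 "r * pi" x] assms by simp
  show "(\<lambda>k. cut_sin r m k x) \<longlonglongrightarrow> sin (real m * x / r)"
    using tendsto_mult[OF c tendsto_const[of "sin (real m * x / r)"]] by (simp add: cut_sin_def)
  show "(\<lambda>k. cut_sin' r m k x) \<longlonglongrightarrow> real m / r * cos (real m * x / r)"
    using tendsto_add[OF tendsto_mult[OF cutoff'_tendsto[OF assms] tendsto_const[of "sin (real m * x / r)"]]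
        tendsto_mult[OF c tendsto_const[of "real m / r * cos (real m * x / r)"]]]
    by (simp add: cut_sin'_def)
qed

context rect begin

definition "mx q = real (fst q) / a" for q :: "nat \<times> nat"
definition "my q = real (snd q) / b" for q :: "nat \<times> nat"
definition "lam q = (mx q)\<^sup>2 + (my q)\<^sup>2"

definition dtrig :: "(real \<Rightarrow> real) \<Rightarrow> real \<Rightarrow> real" where
  "dtrig f = (if f = sin then cos else (\<lambda>x. - sin x))"

lemma sin_neq_cos: "sin \<noteq> (cos :: real \<Rightarrow> real)" by (metis cos_zero sin_zero zero_neq_one)

lemma dtrig_simps: "dtrig sin = cos" "dtrig cos = (\<lambda>x. - sin x)"
  using sin_neq_cos by (auto simp: dtrig_def)

lemma dtrig_deriv: "f \<in> {sin, cos} \<Longrightarrow> (f has_real_derivative dtrig f x) (at x)"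
  by (auto simp: dtrig_simps intro!: derivative_eq_intros)

lemma Ck1_trig: "f \<in> {sin, cos} \<Longrightarrow> Ck1 k (\<lambda>x. f (m * x / r))"
  using Ck1_affine[of k f "m / r" 0] Ck1_sin_cos[of k] by auto

lemma smooth_mode:
  assumes "f \<in> {sin, cos}" "g \<in> {sin, cos}"
  shows "smooth (\<lambda>p. c * complex_of_real (mode f g q p))"
  unfolding mode_def by (intro smooth_tensor Ck1_trig assms)

lemma mode_has_derivative:
  assumes f: "f \<in> {sin, cos}" and g: "g \<in> {sin, cos}"
  shows "((\<lambda>p. c * complex_of_real (mode f g q p)) has_derivative
    (\<lambda>h. c * of_real (mx q * mode (dtrig f) g q p * fst h + my q * mode f (dtrig g) q p * snd h))) (at p)"
proof -
  have 1: "((\<lambda>x. f (real (fst q) * x / a)) has_real_derivative mx q * dtrig f (real (fst q) * fst p / a)) (at (fst p))"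
    by (rule DERIV_cong[OF DERIV_chain2[OF dtrig_deriv[OF f]]])
       (use a_pos in \<open>auto intro!: derivative_eq_intros simp: mx_def\<close>)
  have 2: "((\<lambda>x. g (real (snd q) * x / b)) has_real_derivative my q * dtrig g (real (snd q) * snd p / b)) (at (snd p))"
    by (rule DERIV_cong[OF DERIV_chain2[OF dtrig_deriv[OF g]]])
       (use b_pos in \<open>auto intro!: derivative_eq_intros simp: my_def\<close>)
  show ?thesis
    using has_derivative_tensor[OF 1 2, of c] unfolding mode_def
    by (rule has_derivative_eq_rhs) (simp add: fun_eq_iff algebra_simps)
qed

lemma mode_frechet:
  assumes "f \<in> {sin, cos}" "g \<in> {sin, cos}"
  shows "frechet_derivative (\<lambda>p. c * complex_of_real (mode f g q p)) (at p) h
    = c * of_real (mx q * mode (dtrig f) g q p * fst h + my q * mode f (dtrig g) q p * snd h)"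
  by (rule fun_cong[OF frechet_derivative_at[OF mode_has_derivative[OF assms]], symmetric])

text \<open>A weak derivative may be tested against a sine mode, which is a limit of test functions with
  uniformly bounded derivatives.\<close>
lemma weak_partial_against_sine:
  assumes w: "has_weak_partial \<Omega> e w h" and e: "e \<in> Basis"
  shows "(\<integral>p. w p * of_real (mx q * mode cos sin q p * fst e + my q * mode sin cos q p * snd e) \<partial>M)
    = - (\<integral>p. h p * of_real (mode sin sin q p) \<partial>M)"
proof -
  have wL: "w \<in> L2 M" and hL: "h \<in> L2 M" using w by (auto simp: has_weak_partial_def)
  have wI: "integrable M w" and hI: "integrable M h" by (intro L2_imp_integrable[OF finite_measure_M] wL hL)+
  have [measurable]: "w \<in> borel_measurable M" "h \<in> borel_measurable M" using wL hL by (auto simp: L2_def)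
  let ?F = "cut_sin a (fst q)" and ?G = "cut_sin b (snd q)"
  let ?F' = "cut_sin' a (fst q)" and ?G' = "cut_sin' b (snd q)"
  let ?\<psi> = "\<lambda>k p. complex_of_real (?F k (fst p) * ?G k (snd p))"
  let ?D = "\<lambda>k p. ?F' k (fst p) * fst e * ?G k (snd p) + ?F k (fst p) * (?G' k (snd p) * snd e)"
  let ?E = "\<lambda>p. mx q * mode cos sin q p * fst e + my q * mode sin cos q p * snd e"
  have test: "?\<psi> k \<in> test_functions \<Omega>" for k
    using cutoff_test_function[of 0 A 0 B "\<lambda>x. sin (real (fst q) * x / a)" "\<lambda>x. sin (real (snd q) * x / b)" k]
    by (simp add: cut_sin_def A_def B_def Ck1_trig)
  have deriv: "frechet_derivative (?\<psi> k) (at p) e = of_real (?D k p)" for k p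
  proof -
    have "((\<lambda>p. 1 * ?\<psi> k p) has_derivative (\<lambda>h. 1 * of_real (?F' k (fst p) * fst h * ?G k (snd p) + ?F k (fst p) * (?G' k (snd p) * snd h)))) (at p)"
      by (rule has_derivative_tensor[OF cut_sin_deriv[OF a_pos] cut_sin_deriv[OF b_pos]])
    from fun_cong[OF frechet_derivative_at[OF this[unfolded mult_1]], of e, symmetric] show ?thesis .
  qed
  have e1: "\<bar>fst e\<bar> \<le> 1" "\<bar>snd e\<bar> \<le> 1" using e by (auto simp: Basis_prod_def)
  have psi_meas [measurable]: "?\<psi> k \<in> borel_measurable M" for k
    by (intro L2_measurable smooth_L2 test_function_smooth test)
  have "(\<lambda>p. frechet_derivative (?\<psi> k) (at p) e) \<in> borel_measurable M" for k
    by (intro L2_measurable smooth_partial_L2 test_function_smooth test e)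
  then have D_meas [measurable]: "(\<lambda>p. complex_of_real (?D k p)) \<in> borel_measurable M" for k
    unfolding deriv .
  have cont: "continuous_on UNIV ?E" by (intro continuous_intros continuous_mode) auto
  have coords: "0 < fst p" "fst p < a * pi" "0 < snd p" "snd p < b * pi" if "p \<in> space M" for p
    using that by (auto simp: rectangle_def)
  have "(\<lambda>k. \<integral>p. w p * of_real (?D k p) \<partial>M) \<longlonglongrightarrow> (\<integral>p. w p * of_real (?E p) \<partial>M)"
  proof (rule integral_dominated_convergence[where w="\<lambda>p. (9 * mx q + 9 * my q) * norm (w p)"])
    show "(\<lambda>p. w p * complex_of_real (?E p)) \<in> borel_measurable M"
      by (rule borel_measurable_times[OF L2_measurable[OF wL] continuous_measurable[OF continuous_on_of_real[OF cont]]])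
    show "(\<lambda>p. w p * complex_of_real (?D k p)) \<in> borel_measurable M" for k
      by (rule borel_measurable_times[OF L2_measurable[OF wL] D_meas])
    show "integrable M (\<lambda>p. (9 * mx q + 9 * my q) * norm (w p))" using wI by simp
    show "AE p in M. (\<lambda>k. w p * complex_of_real (?D k p)) \<longlonglongrightarrow> w p * complex_of_real (?E p)"
    proof (rule AE_I2)
      fix p assume p: "p \<in> space M"
      note t1 = cut_sin_tendsto[OF coords(1,2)[OF p], of "fst q"]
      note t2 = cut_sin_tendsto[OF coords(3,4)[OF p], of "snd q"]
      have "(\<lambda>k. ?D k p) \<longlonglongrightarrow> real (fst q) / a * cos (real (fst q) * fst p / a) * fst e * sin (real (snd q) * snd p / b)
        + sin (real (fst q) * fst p / a) * (real (snd q) / b * cos (real (snd q) * snd p / b) * snd e)"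
        by (intro tendsto_intros t1 t2)
      also have "real (fst q) / a * cos (real (fst q) * fst p / a) * fst e * sin (real (snd q) * snd p / b)
        + sin (real (fst q) * fst p / a) * (real (snd q) / b * cos (real (snd q) * snd p / b) * snd e) = ?E p"
        by (simp add: mode_def mx_def my_def mult_ac)
      finally show "(\<lambda>k. w p * complex_of_real (?D k p)) \<longlonglongrightarrow> w p * complex_of_real (?E p)"
        by (intro tendsto_mult tendsto_const tendsto_of_real)
    qed
    show "AE p in M. norm (w p * complex_of_real (?D k p)) \<le> (9 * mx q + 9 * my q) * norm (w p)" for k
    proof (rule AE_I2)
      fix p assume p: "p \<in> space M"
      note c = coords[OF p]
      have b1: "\<bar>?F' k (fst p)\<bar> \<le> 9 * mx q" using cut_sin'_bound[OF a_pos, of "fst p" "fst q" k] c by (simp add: mx_def)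
      have b2: "\<bar>?G' k (snd p)\<bar> \<le> 9 * my q" using cut_sin'_bound[OF b_pos, of "snd p" "snd q" k] c by (simp add: my_def)
      have "\<bar>?F' k (fst p) * fst e * ?G k (snd p)\<bar> \<le> 9 * mx q * 1 * 1"
        unfolding abs_mult by (intro mult_mono b1 e1 cut_sin_bound) (use b1 in auto)
      moreover have "\<bar>?F k (fst p) * (?G' k (snd p) * snd e)\<bar> \<le> 1 * (9 * my q * 1)"
        unfolding abs_mult by (intro mult_mono b2 e1 cut_sin_bound) (use b2 in auto)
      ultimately have "\<bar>?D k p\<bar> \<le> 9 * mx q + 9 * my q" by linarith
      then show "norm (w p * complex_of_real (?D k p)) \<le> (9 * mx q + 9 * my q) * norm (w p)"
        unfolding norm_mult norm_of_real by (subst mult.commute) (intro mult_right_mono; simp)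
    qed
  qed
  moreover have "(\<lambda>k. - (\<integral>p. h p * ?\<psi> k p \<partial>M)) \<longlonglongrightarrow> - (\<integral>p. h p * of_real (mode sin sin q p) \<partial>M)"
  proof (intro tendsto_minus integral_dominated_convergence[where w="\<lambda>p. norm (h p)"])
    show "(\<lambda>p. h p * complex_of_real (mode sin sin q p)) \<in> borel_measurable M"
      using mode_L2[of sin sin q] by (auto intro!: borel_measurable_times L2_measurable)
    show "(\<lambda>p. h p * ?\<psi> k p) \<in> borel_measurable M" for k
      by (rule borel_measurable_times[OF L2_measurable[OF hL] psi_meas])
    show "integrable M (\<lambda>p. norm (h p))" using hI by simp
    show "AE p in M. (\<lambda>k. h p * ?\<psi> k p) \<longlonglongrightarrow> h p * complex_of_real (mode sin sin q p)"
    proof (rule AE_I2)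
      fix p assume p: "p \<in> space M"
      show "(\<lambda>k. h p * ?\<psi> k p) \<longlonglongrightarrow> h p * complex_of_real (mode sin sin q p)"
        unfolding mode_def using cut_sin_tendsto(1)[OF coords(1,2)[OF p]] cut_sin_tendsto(1)[OF coords(3,4)[OF p]]
        by (intro tendsto_mult tendsto_const tendsto_of_real)
    qed
    show "AE p in M. norm (h p * ?\<psi> k p) \<le> norm (h p)" for k
    proof (rule AE_I2)
      fix p
      have "\<bar>?F k (fst p) * ?G k (snd p)\<bar> \<le> 1"
        unfolding abs_mult by (intro mult_le_one cut_sin_bound) auto
      then show "norm (h p * ?\<psi> k p) \<le> norm (h p)"
        unfolding norm_mult norm_of_real using mult_left_mono[of _ 1 "norm (h p)"] by simp
    qed
  qed
  moreover have "(\<integral>p. w p * of_real (?D k p) \<partial>M) = - (\<integral>p. h p * ?\<psi> k p \<partial>M)" for k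
  proof -
    have "(\<integral>p. w p * frechet_derivative (?\<psi> k) (at p) e \<partial>M) = - (\<integral>p. h p * ?\<psi> k p \<partial>M)"
      using w test[of k] unfolding has_weak_partial_def by blast
    then show ?thesis unfolding deriv .
  qed
  ultimately show ?thesis using LIMSEQ_unique by simp
qed

text \<open>For a function in \<open>H\<^sup>1\<^sub>0\<close> the roles are exchanged: it is itself a limit of test functions.\<close>
lemma H10_against_smooth:
  assumes u: "u \<in> H10 \<Omega>" and e: "e \<in> Basis" and \<eta>: "smooth \<eta>"
  shows "(\<integral>p. wp e u p * \<eta> p \<partial>M) = - (\<integral>p. u p * frechet_derivative \<eta> (at p) e \<partial>M)"
proof -
  obtain \<phi> where \<phi>: "\<And>n::nat. \<phi> n \<in> test_functions \<Omega>" and lim: "(\<lambda>n. H1_norm \<Omega> (\<lambda>x. \<phi> n x - u x)) \<longlonglongrightarrow> 0"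
    and u1: "u \<in> H1 \<Omega>" using u unfolding H10_def by blast
  note wp = H1_weak_partial[OF u1 e]
  have s: "smooth (\<phi> n)" for n by (rule test_function_smooth[OF \<phi>])
  have L: "u \<in> L2 M" "wp e u \<in> L2 M" using u1 e by (auto intro: H1_L2 weak_partial_L2)
  have d: "has_weak_partial \<Omega> e (\<lambda>x. \<phi> n x - u x) (\<lambda>x. frechet_derivative (\<phi> n) (at x) e - wp e u x)" for n
    by (intro has_weak_partial_diff e wp smooth_has_weak_partial s)
  have lim1: "(\<lambda>n. L2_norm M (\<lambda>x. \<phi> n x - u x)) \<longlonglongrightarrow> 0"
    by (rule Lim_null_comparison[OF _ lim]) (simp add: L2_norm_le_H1_norm)
  have lim2: "(\<lambda>n. L2_norm M (\<lambda>x. frechet_derivative (\<phi> n) (at x) e - wp e u x)) \<longlonglongrightarrow> 0"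
    by (rule Lim_null_comparison[OF _ lim])
       (use L2_norm_weak_partial_le_H1_norm[OF e] in \<open>simp add: L2_norm_weak_partial[OF d, symmetric]\<close>)
  have "(\<lambda>n. \<integral>x. frechet_derivative (\<phi> n) (at x) e * \<eta> x \<partial>M) \<longlonglongrightarrow> (\<integral>x. wp e u x * \<eta> x \<partial>M)"
    by (rule L2_inner_tendsto[OF _ L(2) smooth_L2[OF \<eta>] lim2]) (simp add: smooth_partial_L2[OF s e])
  moreover have "(\<lambda>n. - (\<integral>x. \<phi> n x * frechet_derivative \<eta> (at x) e \<partial>M)) \<longlonglongrightarrow> - (\<integral>x. u x * frechet_derivative \<eta> (at x) e \<partial>M)"
    by (rule tendsto_minus[OF L2_inner_tendsto[OF _ L(1) smooth_partial_L2[OF \<eta> e] lim1]]) (simp add: smooth_L2[OF s])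
  moreover have "(\<integral>x. frechet_derivative (\<phi> n) (at x) e * \<eta> x \<partial>M) = - (\<integral>x. \<phi> n x * frechet_derivative \<eta> (at x) e \<partial>M)" for n
    using integral_by_parts[OF \<eta> s[of n] e test_function_outside[OF \<phi>[of n]]] by (simp add: mult.commute)
  ultimately show ?thesis using LIMSEQ_unique by simp
qed

text \<open>The Fourier coefficients with respect to the sine basis.\<close>
definition fc :: "(real \<times> real \<Rightarrow> complex) \<Rightarrow> nat \<times> nat \<Rightarrow> complex" where
  "fc = orthogonal_system.coef M (mode sin sin) \<kappa>"

lemma sine_orthogonal: "orthogonal_system M (mode sin sin) J \<kappa>" by (rule mode_orthogonal) auto

lemma fc_eq: "fc u q = (\<integral>x. u x * of_real (mode sin sin q x) \<partial>M) / of_real \<kappa>"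
  unfolding fc_def orthogonal_system.coef_def[OF sine_orthogonal] ..

lemma fc_add: "u \<in> L2 M \<Longrightarrow> v \<in> L2 M \<Longrightarrow> fc (\<lambda>x. u x + v x) q = fc u q + fc v q"
  using L2_mult_integrable[OF _ mode_L2[of sin sin q]]
  by (simp add: fc_eq distrib_right add_divide_distrib)

lemma fc_mult_const: "fc (\<lambda>x. c * u x) q = c * fc u q"
  by (simp add: fc_eq mult.assoc)

lemma fc_diff: "u \<in> L2 M \<Longrightarrow> v \<in> L2 M \<Longrightarrow> fc (\<lambda>x. u x - v x) q = fc u q - fc v q"
  using fc_add[of u "\<lambda>x. (-1) * v x" q] L2_mult_const[of v M "-1"] fc_mult_const[of "-1" v q] by simp

lemma fc_bound: assumes "u \<in> L2 M" shows "cmod (fc u q) \<le> L2_norm M u * (L2_norm M (\<lambda>x. of_real (mode sin sin q x)) / \<kappa>)"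
  using L2_inner_bound[OF assms mode_L2[of sin sin q]] kappa_pos
  by (simp add: fc_eq norm_divide divide_right_mono)

lemma fc_cong_AE:
  assumes "u \<in> borel_measurable M" "v \<in> borel_measurable M" "AE x in M. u x = v x"
  shows "fc u q = fc v q"
proof -
  have "(\<integral>x. u x * of_real (mode sin sin q x) \<partial>M) = (\<integral>x. v x * of_real (mode sin sin q x) \<partial>M)"
    by (rule integral_cong_AE)
       (use assms mode_L2[of sin sin q] in \<open>auto intro!: borel_measurable_times L2_measurable\<close>)
  then show ?thesis by (simp add: fc_eq)
qed

text \<open>Both derivatives are moved onto the sine mode: the first one because the mode vanishes on the boundary, the
  second one because \<open>u\<close> does.\<close>
lemma fc_second_partial:
  assumes u: "u \<in> dom_laplacian \<Omega>" and e: "e \<in> Basis"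
  shows "fc (wp e (wp e u)) q
    = - of_real ((mx q)\<^sup>2 * fst e + (my q)\<^sup>2 * snd e) * fc u q"
proof -
  let ?g = "wp e u"
  let ?E = "\<lambda>p. mx q * mode cos sin q p * fst e + my q * mode sin cos q p * snd e"
  have u10: "u \<in> H10 \<Omega>" and g: "?g \<in> H1 \<Omega>" using u e by (auto simp: dom_laplacian_def H2_def)
  consider "e = (1, 0)" | "e = (0, 1)" using e by (auto simp: Basis_prod_def)
  then have "smooth (\<lambda>p. complex_of_real (?E p)) \<and>
    (\<forall>p. frechet_derivative (\<lambda>p. complex_of_real (?E p)) (at p) e
        = - of_real ((mx q)\<^sup>2 * fst e + (my q)\<^sup>2 * snd e) * of_real (mode sin sin q p))"
  proof cases
    case 1
    have eq: "(\<lambda>p. complex_of_real (?E p)) = (\<lambda>p. of_real (mx q) * of_real (mode cos sin q p))" by (simp add: 1)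
    have "frechet_derivative (\<lambda>p. of_real (mx q) * complex_of_real (mode cos sin q p)) (at p) e
        = - of_real ((mx q)\<^sup>2 * fst e + (my q)\<^sup>2 * snd e) * of_real (mode sin sin q p)" for p
      by (subst mode_frechet) (simp_all add: 1 dtrig_simps mode_def power2_eq_square)
    then show ?thesis unfolding eq using smooth_mode[of cos sin] by auto
  next
    case 2
    have eq: "(\<lambda>p. complex_of_real (?E p)) = (\<lambda>p. of_real (my q) * of_real (mode sin cos q p))" by (simp add: 2)
    have "frechet_derivative (\<lambda>p. of_real (my q) * complex_of_real (mode sin cos q p)) (at p) e
        = - of_real ((mx q)\<^sup>2 * fst e + (my q)\<^sup>2 * snd e) * of_real (mode sin sin q p)" for p
      by (subst mode_frechet) (simp_all add: 2 dtrig_simps mode_def power2_eq_square)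
    then show ?thesis unfolding eq using smooth_mode[of sin cos] by auto
  qed
  then have sm: "smooth (\<lambda>p. complex_of_real (?E p))"
    and fd: "\<And>p. frechet_derivative (\<lambda>p. complex_of_real (?E p)) (at p) e
        = - of_real ((mx q)\<^sup>2 * fst e + (my q)\<^sup>2 * snd e) * of_real (mode sin sin q p)" by auto
  have "(\<integral>p. wp e ?g p * of_real (mode sin sin q p) \<partial>M) = - (\<integral>p. ?g p * of_real (?E p) \<partial>M)"
    using weak_partial_against_sine[OF H1_weak_partial[OF g e] e, of q] by (simp add: eq_neg_iff_add_eq_0 add.commute)
  also have "\<dots> = (\<integral>p. u p * (- of_real ((mx q)\<^sup>2 * fst e + (my q)\<^sup>2 * snd e) * of_real (mode sin sin q p)) \<partial>M)"
    unfolding H10_against_smooth[OF u10 e sm] fd by simp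
  also have "\<dots> = - of_real ((mx q)\<^sup>2 * fst e + (my q)\<^sup>2 * snd e) * (\<integral>p. u p * of_real (mode sin sin q p) \<partial>M)"
    unfolding mult.left_commute[of "u _"] by (rule integral_mult_right_zero)
  finally show ?thesis by (simp add: fc_eq)
qed

lemma second_partial_L2:
  assumes "u \<in> dom_laplacian \<Omega>" "e \<in> Basis" "e' \<in> Basis"
  shows "wp e' (wp e u) \<in> L2 M"
proof -
  have "wp e u \<in> H1 \<Omega>" using assms unfolding dom_laplacian_def H2_def by blast
  then show ?thesis using assms by (intro weak_partial_L2)
qed

lemma laplacian_L2: assumes "u \<in> dom_laplacian \<Omega>" shows "laplacian \<Omega> u \<in> L2 M"
proof -
  have "laplacian \<Omega> u = (\<lambda>x. \<Sum>e\<in>Basis. wp e (wp e u) x)"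
    by (simp add: laplacian_def fun_eq_iff)
  then show ?thesis using assms by (simp only:) (intro L2_sum second_partial_L2)
qed

lemma dom_L2: "u \<in> dom_laplacian \<Omega> \<Longrightarrow> u \<in> L2 M"
  by (auto simp: dom_laplacian_def H2_def H1_def)

lemma fc_laplacian:
  assumes u: "u \<in> dom_laplacian \<Omega>"
  shows "fc (laplacian \<Omega> u) q = - of_real (lam q) * fc u q"
proof -
  have eq: "laplacian \<Omega> u = (\<lambda>x. wp (1, 0) (wp (1, 0) u) x + wp (0, 1) (wp (0, 1) u) x)"
    by (simp add: laplacian_def fun_eq_iff Basis_prod_def)
  have "(1, 0) \<in> (Basis :: (real \<times> real) set)" "(0, 1) \<in> (Basis :: (real \<times> real) set)" by (auto simp: Basis_prod_def)
  then show ?thesis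
    unfolding eq using u
    by (simp add: fc_add second_partial_L2 fc_second_partial lam_def algebra_simps)
qed

end

section \<open>Approximation by sine polynomials\<close>

context rect begin

definition tsum :: "(real \<Rightarrow> real) \<Rightarrow> (real \<Rightarrow> real) \<Rightarrow> (nat \<times> nat \<Rightarrow> complex) \<Rightarrow> nat \<Rightarrow> real \<times> real \<Rightarrow> complex" where
  "tsum f g c N p = (\<Sum>q\<in>I N. c q * of_real (mode f g q p))"

lemma tsum_eq_comb:
  assumes "f \<in> {sin, cos}" "g \<in> {sin, cos}"
  shows "tsum f g c N = orthogonal_system.comb (mode f g) c (I N)"
  by (simp add: fun_eq_iff tsum_def orthogonal_system.comb_def[OF mode_orthogonal[OF assms]])

lemma smooth_tsum: "f \<in> {sin, cos} \<Longrightarrow> g \<in> {sin, cos} \<Longrightarrow> smooth (tsum f g c N)"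
  unfolding tsum_def[abs_def] by (intro smooth_sum smooth_mode)

lemma tsum_L2: "f \<in> {sin, cos} \<Longrightarrow> g \<in> {sin, cos} \<Longrightarrow> tsum f g c N \<in> L2 M"
  by (intro smooth_L2 smooth_tsum)

lemma norm_tsum:
  assumes "f \<in> {sin, cos}" "g \<in> {sin, cos}"
  shows "(L2_norm M (tsum f g c N))\<^sup>2 = \<kappa> * (\<Sum>q\<in>I N. (cmod (c q))\<^sup>2)"
  unfolding tsum_eq_comb[OF assms]
  by (rule orthogonal_system.norm_comb[OF mode_orthogonal[OF assms] I_props(1,2)])

lemma tsum_frechet:
  assumes f: "f \<in> {sin, cos}" and g: "g \<in> {sin, cos}"
  shows "frechet_derivative (tsum f g c N) (at p) h =
    (\<Sum>q\<in>I N. c q * of_real (mx q * mode (dtrig f) g q p * fst h + my q * mode f (dtrig g) q p * snd h))"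
proof -
  have "(tsum f g c N has_derivative (\<lambda>h. \<Sum>q\<in>I N. c q * of_real (mx q * mode (dtrig f) g q p * fst h + my q * mode f (dtrig g) q p * snd h))) (at p)"
    unfolding tsum_def[abs_def] by (intro has_derivative_sum mode_has_derivative assms)
  from fun_cong[OF frechet_derivative_at[OF this], symmetric] show ?thesis .
qed

lemma tsum_partials:
  assumes g: "g \<in> {sin, cos}"
  shows "frechet_derivative (tsum sin g c N) (at p) (1, 0) = tsum cos g (\<lambda>q. of_real (mx q) * c q) N p"
    and "frechet_derivative (tsum cos g c N) (at p) (1, 0) = tsum sin g (\<lambda>q. - of_real (mx q) * c q) N p"
    and "frechet_derivative (tsum g sin c N) (at p) (0, 1) = tsum g cos (\<lambda>q. of_real (my q) * c q) N p"
    and "frechet_derivative (tsum g cos c N) (at p) (0, 1) = tsum g sin (\<lambda>q. - of_real (my q) * c q) N p"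
  using g by (simp_all only: tsum_frechet insertI1 insertI2 singletonI)
    (simp_all add: tsum_def dtrig_simps mode_def sum_negf mult_ac)

lemma continuous_tsum: "f \<in> {sin, cos} \<Longrightarrow> g \<in> {sin, cos} \<Longrightarrow> continuous_on UNIV (tsum f g c N)"
  by (intro smooth_continuous smooth_tsum)

text \<open>Square summable coefficients give the partial derivatives of the approximating functions some limit in
  \<open>L\<^sup>2\<close>, which has to be the weak derivative because weak derivatives are closed under limits.\<close>
lemma tsum_weak_limit:
  assumes e: "e \<in> Basis" and V: "\<And>N. smooth (V N)" and v: "v \<in> L2 M"
    and lim: "(\<lambda>N. L2_norm M (\<lambda>x. V N x - v x)) \<longlonglongrightarrow> 0"
    and f: "f \<in> {sin, cos}" and g: "g \<in> {sin, cos}"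
    and d: "\<And>N p. frechet_derivative (V N) (at p) e = tsum f g c N p"
    and bound: "\<And>N. (\<Sum>q\<in>I N. (cmod (c q))\<^sup>2) \<le> K"
  shows "has_weak_partial \<Omega> e v (wp e v)"
    and "(\<lambda>N. L2_norm M (\<lambda>x. tsum f g c N x - wp e v x)) \<longlonglongrightarrow> 0"
proof -
  obtain h where h: "h \<in> L2 M" "(\<lambda>N. L2_norm M (\<lambda>x. tsum f g c N x - h x)) \<longlonglongrightarrow> 0"
    using orthogonal_system.comb_convergent[OF mode_orthogonal[OF f g] I_props(1-3) bound]
    unfolding tsum_eq_comb[OF f g] by blast
  have vh: "has_weak_partial \<Omega> e v h"
  proof (rule has_weak_partial_closed[OF e _ v lim h])
    show "has_weak_partial \<Omega> e (V n) (\<lambda>x. tsum f g c n x)" for n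
      using smooth_has_weak_partial[OF V[of n] e] unfolding d .
  qed
  then show wp: "has_weak_partial \<Omega> e v (wp e v)" by (rule has_weak_partial_weak_partial)
  then have L: "wp e v \<in> L2 M" by (simp add: has_weak_partial_def)
  have "L2_norm M (\<lambda>x. tsum f g c N x - wp e v x) = L2_norm M (\<lambda>x. tsum f g c N x - h x)" for N
  proof (rule L2_norm_cong_AE)
    show "AE x in M. tsum f g c N x - wp e v x = tsum f g c N x - h x"
      using weak_partial_eq[OF vh] by eventually_elim simp
  qed (intro L2_measurable L2_diff tsum_L2 f g L h)+
  then show "(\<lambda>N. L2_norm M (\<lambda>x. tsum f g c N x - wp e v x)) \<longlonglongrightarrow> 0"
    using h(2) by simp
qed

text \<open>The frequencies \<open>mx\<close> and \<open>my\<close> are at least \<open>1/a\<close> and \<open>1/b\<close>. Therefore the symbol of every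
  derivative of order one or two is at most a constant times the symbol \<open>lam\<close> of the negative Laplacian.\<close>
definition bound_const :: real where "bound_const = max 1 (max a b)"

lemma freq_ge: assumes "q \<in> J" shows "1 \<le> a * mx q" "1 \<le> b * my q"
  using assms a_pos b_pos by (auto simp: J_def mx_def my_def)

lemma freq_nonneg: "0 \<le> mx q" "0 \<le> my q" "0 \<le> lam q"
  using a_pos b_pos by (auto simp: mx_def my_def lam_def)

lemma freq_bounds:
  assumes "q \<in> J"
  shows "mx q \<le> bound_const * lam q" "my q \<le> bound_const * lam q"
    "(mx q)\<^sup>2 \<le> bound_const * lam q" "(my q)\<^sup>2 \<le> bound_const * lam q" "mx q * my q \<le> bound_const * lam q"
proof -
  have K: "bound_const \<ge> 1" "bound_const \<ge> a" "bound_const \<ge> b" by (auto simp: bound_const_def)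
  have l: "(mx q)\<^sup>2 \<le> lam q" "(my q)\<^sup>2 \<le> lam q" "mx q * my q \<le> lam q"
  proof -
    have "2 * mx q * my q \<le> lam q" unfolding lam_def by (rule sum_squares_bound)
    moreover have "0 \<le> mx q * my q" by (intro mult_nonneg_nonneg freq_nonneg)
    ultimately show "mx q * my q \<le> lam q" by linarith
  qed (simp_all add: lam_def)
  have *: "t \<le> bound_const * lam q" if "t \<le> lam q" for t
    using that K(1) freq_nonneg(3)[of q] mult_right_mono[of 1 bound_const "lam q"] by linarith
  show "(mx q)\<^sup>2 \<le> bound_const * lam q" "(my q)\<^sup>2 \<le> bound_const * lam q" "mx q * my q \<le> bound_const * lam q"
    by (intro * l)+
  have **: "t \<le> bound_const * lam q" if "1 \<le> r * t" "0 < r" "r \<le> bound_const" "t\<^sup>2 \<le> lam q" "0 \<le> t" for r t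
  proof -
    have "t \<le> (r * t) * t" using mult_right_mono[OF that(1,5)] by simp
    also have "\<dots> = r * t\<^sup>2" by (simp add: power2_eq_square)
    also have "\<dots> \<le> bound_const * lam q" using that K(1) by (intro mult_mono) auto
    finally show ?thesis .
  qed
  show "mx q \<le> bound_const * lam q" "my q \<le> bound_const * lam q"
    using **[OF freq_ge(1)[OF assms] a_pos K(2) l(1) freq_nonneg(1)]
      **[OF freq_ge(2)[OF assms] b_pos K(3) l(2) freq_nonneg(2)] by auto
qed

text \<open>In terms of coefficients this is the elliptic estimate: a multiplier that is dominated by \<open>lam\<close> is
  controlled by \<open>\<parallel>\<Delta>u\<parallel>\<close>, by Bessel's inequality for \<open>\<Delta>u\<close>.\<close>
lemma sum_sq_bound:
  assumes u: "u \<in> dom_laplacian \<Omega>" and d: "\<And>q. q \<in> J \<Longrightarrow> \<bar>r q\<bar> \<le> K * lam q" and "K \<ge> 0"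
  shows "(\<Sum>q\<in>I N. (cmod (of_real (r q) * fc u q))\<^sup>2) \<le> K\<^sup>2 * (dom_norm \<Omega> u)\<^sup>2 / \<kappa>"
proof -
  have "(\<Sum>q\<in>I N. (cmod (of_real (r q) * fc u q))\<^sup>2) \<le> (\<Sum>q\<in>I N. K\<^sup>2 * (cmod (fc (laplacian \<Omega> u) q))\<^sup>2)"
  proof (rule sum_mono)
    fix q assume "q \<in> I N"
    then have "q \<in> J" using I_props(2) by blast
    have "(cmod (of_real (r q) * fc u q))\<^sup>2 = \<bar>r q\<bar>\<^sup>2 * (cmod (fc u q))\<^sup>2" by (simp add: norm_mult power_mult_distrib)
    also have "\<dots> \<le> (K * lam q)\<^sup>2 * (cmod (fc u q))\<^sup>2"
      by (intro mult_right_mono power_mono d \<open>q \<in> J\<close>) auto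
    also have "\<dots> = K\<^sup>2 * (cmod (fc (laplacian \<Omega> u) q))\<^sup>2"
      by (simp add: fc_laplacian[OF u] norm_mult power_mult_distrib)
    finally show "(cmod (of_real (r q) * fc u q))\<^sup>2 \<le> K\<^sup>2 * (cmod (fc (laplacian \<Omega> u) q))\<^sup>2" .
  qed
  also have "\<dots> = K\<^sup>2 * (\<Sum>q\<in>I N. (cmod (fc (laplacian \<Omega> u) q))\<^sup>2)" by (simp add: sum_distrib_left)
  also have "\<dots> \<le> K\<^sup>2 * ((dom_norm \<Omega> u)\<^sup>2 / \<kappa>)"
  proof (rule mult_left_mono)
    have "\<kappa> * (\<Sum>q\<in>I N. (cmod (fc (laplacian \<Omega> u) q))\<^sup>2) \<le> (dom_norm \<Omega> u)\<^sup>2"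
      unfolding dom_norm_def fc_def
      by (rule orthogonal_system.Bessel[OF sine_orthogonal laplacian_L2[OF u] I_props(1,2)])
    then show "(\<Sum>q\<in>I N. (cmod (fc (laplacian \<Omega> u) q))\<^sup>2) \<le> (dom_norm \<Omega> u)\<^sup>2 / \<kappa>"
      using kappa_pos by (simp add: pos_le_divide_eq mult.commute)
  qed simp
  finally show ?thesis by simp
qed

lemma fourier_tendsto:
  assumes "u \<in> L2 M"
  shows "(\<lambda>N. L2_norm M (\<lambda>x. tsum sin sin (fc u) N x - u x)) \<longlonglongrightarrow> 0"
proof -
  have "tsum sin sin (fc u) N = orthogonal_system.comb (mode sin sin) (fc u) (I N)" for N
    by (rule tsum_eq_comb) auto
  then show ?thesis
    using orthogonal_system.expansion_tendsto[OF sine_orthogonal assms sine_system_total I_props]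
    by (simp add: fc_def)
qed

lemma fourier_gradient_tendsto:
  assumes u: "u \<in> dom_laplacian \<Omega>"
  shows "(\<lambda>N. L2_norm M (\<lambda>x. tsum cos sin (\<lambda>q. of_real (mx q) * fc u q) N x - wp (1, 0) u x)) \<longlonglongrightarrow> 0"
    and "(\<lambda>N. L2_norm M (\<lambda>x. tsum sin cos (\<lambda>q. of_real (my q) * fc u q) N x - wp (0, 1) u x)) \<longlonglongrightarrow> 0"
proof -
  note B = basis_vectors
  have K: "bound_const \<ge> 0" by (simp add: bound_const_def)
  have sq: "(\<Sum>q\<in>I N. (cmod (of_real (r q) * fc u q))\<^sup>2) \<le> bound_const\<^sup>2 * (dom_norm \<Omega> u)\<^sup>2 / \<kappa>"
    if "\<And>q. q \<in> J \<Longrightarrow> r q \<le> bound_const * lam q" "\<And>q. 0 \<le> r q" for r N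
    by (rule sum_sq_bound[OF u _ K]) (use that in simp)
  show "(\<lambda>N. L2_norm M (\<lambda>x. tsum cos sin (\<lambda>q. of_real (mx q) * fc u q) N x - wp (1, 0) u x)) \<longlonglongrightarrow> 0"
    by (rule tsum_weak_limit(2)[OF B(1) smooth_tsum dom_L2[OF u] fourier_tendsto[OF dom_L2[OF u]] _ _ tsum_partials(1) sq])
      (simp_all add: freq_bounds freq_nonneg)
  show "(\<lambda>N. L2_norm M (\<lambda>x. tsum sin cos (\<lambda>q. of_real (my q) * fc u q) N x - wp (0, 1) u x)) \<longlonglongrightarrow> 0"
    by (rule tsum_weak_limit(2)[OF B(2) smooth_tsum dom_L2[OF u] fourier_tendsto[OF dom_L2[OF u]] _ _ tsum_partials(3) sq])
      (simp_all add: freq_bounds freq_nonneg)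
qed

text \<open>The same argument once more, with the first derivatives in the role of \<open>u\<close>. For the mixed derivative
  \<open>mx my \<le> lam\<close> is used, the special case of elliptic regularity that holds for free on a rectangle.\<close>
lemma fourier_hessian_tendsto:
  assumes u: "u \<in> dom_laplacian \<Omega>"
  shows "(\<lambda>N. L2_norm M (\<lambda>x. tsum sin sin (\<lambda>q. - of_real (mx q) * (of_real (mx q) * fc u q)) N x
      - wp (1, 0) (wp (1, 0) u) x)) \<longlonglongrightarrow> 0"
    and "(\<lambda>N. L2_norm M (\<lambda>x. tsum cos cos (\<lambda>q. of_real (my q) * (of_real (mx q) * fc u q)) N x
      - wp (0, 1) (wp (1, 0) u) x)) \<longlonglongrightarrow> 0"
    and "(\<lambda>N. L2_norm M (\<lambda>x. tsum cos cos (\<lambda>q. of_real (mx q) * (of_real (my q) * fc u q)) N x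
      - wp (1, 0) (wp (0, 1) u) x)) \<longlonglongrightarrow> 0"
    and "(\<lambda>N. L2_norm M (\<lambda>x. tsum sin sin (\<lambda>q. - of_real (my q) * (of_real (my q) * fc u q)) N x
      - wp (0, 1) (wp (0, 1) u) x)) \<longlonglongrightarrow> 0"
proof -
  note B = basis_vectors
  have K: "bound_const \<ge> 0" by (simp add: bound_const_def)
  have sq: "(\<Sum>q\<in>I N. (cmod (of_real (r q) * fc u q))\<^sup>2) \<le> bound_const\<^sup>2 * (dom_norm \<Omega> u)\<^sup>2 / \<kappa>"
    if "\<And>q. q \<in> J \<Longrightarrow> \<bar>r q\<bar> \<le> bound_const * lam q" for r N
    by (rule sum_sq_bound[OF u _ K]) (use that in simp)
  have P: "\<bar>mx q * mx q\<bar> \<le> bound_const * lam q" "\<bar>my q * mx q\<bar> \<le> bound_const * lam q"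
    "\<bar>mx q * my q\<bar> \<le> bound_const * lam q" "\<bar>my q * my q\<bar> \<le> bound_const * lam q" if "q \<in> J" for q
    using freq_bounds[OF that] freq_nonneg[of q] by (simp_all add: abs_mult power2_eq_square mult.commute)
  have L: "wp e u \<in> L2 M" if "e \<in> Basis" for e
    using u that unfolding dom_laplacian_def H2_def by (blast intro: weak_partial_L2)
  show "(\<lambda>N. L2_norm M (\<lambda>x. tsum sin sin (\<lambda>q. - of_real (mx q) * (of_real (mx q) * fc u q)) N x
      - wp (1, 0) (wp (1, 0) u) x)) \<longlonglongrightarrow> 0"
  proof (rule tsum_weak_limit(2)[OF B(1) smooth_tsum L[OF B(1)] fourier_gradient_tendsto(1)[OF u] _ _ tsum_partials(2)])
    show "(\<Sum>q\<in>I N. (cmod (- of_real (mx q) * (of_real (mx q) * fc u q)))\<^sup>2) \<le> bound_const\<^sup>2 * (dom_norm \<Omega> u)\<^sup>2 / \<kappa>" for N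
    proof -
      have "cmod (- of_real (mx q) * (of_real (mx q) * fc u q)) = cmod (of_real (mx q * mx q) * fc u q)" for q
        by (simp add: norm_mult)
      then show ?thesis by (simp only:) (rule sq, rule P)
    qed
  qed simp_all
  show "(\<lambda>N. L2_norm M (\<lambda>x. tsum cos cos (\<lambda>q. of_real (my q) * (of_real (mx q) * fc u q)) N x
      - wp (0, 1) (wp (1, 0) u) x)) \<longlonglongrightarrow> 0"
  proof (rule tsum_weak_limit(2)[OF B(2) smooth_tsum L[OF B(1)] fourier_gradient_tendsto(1)[OF u] _ _ tsum_partials(3)])
    show "(\<Sum>q\<in>I N. (cmod (of_real (my q) * (of_real (mx q) * fc u q)))\<^sup>2) \<le> bound_const\<^sup>2 * (dom_norm \<Omega> u)\<^sup>2 / \<kappa>" for N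
    proof -
      have "cmod (of_real (my q) * (of_real (mx q) * fc u q)) = cmod (of_real (my q * mx q) * fc u q)" for q
        by (simp add: norm_mult)
      then show ?thesis by (simp only:) (rule sq, rule P)
    qed
  qed simp_all
  show "(\<lambda>N. L2_norm M (\<lambda>x. tsum cos cos (\<lambda>q. of_real (mx q) * (of_real (my q) * fc u q)) N x
      - wp (1, 0) (wp (0, 1) u) x)) \<longlonglongrightarrow> 0"
  proof (rule tsum_weak_limit(2)[OF B(1) smooth_tsum L[OF B(2)] fourier_gradient_tendsto(2)[OF u] _ _ tsum_partials(1)])
    show "(\<Sum>q\<in>I N. (cmod (of_real (mx q) * (of_real (my q) * fc u q)))\<^sup>2) \<le> bound_const\<^sup>2 * (dom_norm \<Omega> u)\<^sup>2 / \<kappa>" for N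
    proof -
      have "cmod (of_real (mx q) * (of_real (my q) * fc u q)) = cmod (of_real (mx q * my q) * fc u q)" for q
        by (simp add: norm_mult)
      then show ?thesis by (simp only:) (rule sq, rule P)
    qed
  qed simp_all
  show "(\<lambda>N. L2_norm M (\<lambda>x. tsum sin sin (\<lambda>q. - of_real (my q) * (of_real (my q) * fc u q)) N x
      - wp (0, 1) (wp (0, 1) u) x)) \<longlonglongrightarrow> 0"
  proof (rule tsum_weak_limit(2)[OF B(2) smooth_tsum L[OF B(2)] fourier_gradient_tendsto(2)[OF u] _ _ tsum_partials(4)])
    show "(\<Sum>q\<in>I N. (cmod (- of_real (my q) * (of_real (my q) * fc u q)))\<^sup>2) \<le> bound_const\<^sup>2 * (dom_norm \<Omega> u)\<^sup>2 / \<kappa>" for N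
    proof -
      have "cmod (- of_real (my q) * (of_real (my q) * fc u q)) = cmod (of_real (my q * my q) * fc u q)" for q
        by (simp add: norm_mult)
      then show ?thesis by (simp only:) (rule sq, rule P)
    qed
  qed simp_all
qed

end

section \<open>The boundary and traces\<close>

lemma borel_measurable_pair_fst: "f \<in> borel_measurable borel \<Longrightarrow> (\<lambda>s::real. f (s, c::real)) \<in> borel_measurable borel"
  by (rule measurable_compose[of "\<lambda>s. (s, c)" borel borel]) (auto intro!: borel_measurable_Pair)

lemma borel_measurable_pair_snd: "f \<in> borel_measurable borel \<Longrightarrow> (\<lambda>s::real. f (c::real, s)) \<in> borel_measurable borel"
  by (rule measurable_compose[of "\<lambda>s. (c, s)" borel borel]) (auto intro!: borel_measurable_Pair)

lemma integrable_on_open_interval: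
  fixes h :: "real \<Rightarrow> real"
  assumes [measurable]: "h \<in> borel_measurable borel" and "\<And>s. l < s \<Longrightarrow> s < u \<Longrightarrow> \<bar>h s\<bar> \<le> K"
  shows "integrable lborel (\<lambda>s. indicator {l<..<u} s * h s)"
proof (rule Bochner_Integration.integrable_bound)
  show "integrable lborel (\<lambda>s. indicator {l<..<u} s * K)"
    by (intro integrable_mult_left integrable_real_indicator emeasure_bounded_finite) auto
  show "(\<lambda>s. indicator {l<..<u} s * h s) \<in> borel_measurable lborel" by measurable
  show "AE s in lborel. norm (indicator {l<..<u} s * h s) \<le> norm (indicator {l<..<u} s * K)"
    using assms(2) by (intro AE_I2) (auto simp: indicator_def intro: order_trans[OF _ abs_ge_self])
qed

lemma integral_open_interval_eq:
  fixes h :: "real \<Rightarrow> real"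
  assumes h: "continuous_on UNIV h"
  shows "(\<integral>s. indicator {l<..<u} s * h s \<partial>lborel) = integral {l..u} h"
proof -
  have "bounded (h ` {l..u})"
    by (intro compact_imp_bounded compact_continuous_image continuous_on_subset[OF h]) auto
  then obtain K where "\<forall>x\<in>{l..u}. \<bar>h x\<bar> \<le> K" by (auto simp: bounded_iff)
  then have "integrable lborel (\<lambda>s. indicator {l<..<u} s * h s)"
    by (intro integrable_on_open_interval[where K=K] borel_measurable_continuous_onI h) auto
  then have "set_integrable lborel {l<..<u} h" by (simp add: set_integrable_def)
  from set_borel_integral_eq_integral(2)[OF this]
  show ?thesis by (simp add: set_lebesgue_integral_def integral_open_interval_real)
qed

context rect begin

abbreviation "\<sigma> \<equiv> boundary_measure a b"

definition "perimeter = 2 * A + 2 * B"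

lemma param_eq: "boundary_param a b s =
     (if s < A then (s, 0) else if s < A + B then (A, s - A)
      else if s < 2 * A + B then (2 * A + B - s, B) else (0, perimeter - s))"
  by (simp add: boundary_param_def A_def B_def perimeter_def algebra_simps)

lemma boundary_param_measurable [measurable]: "boundary_param a b \<in> borel_measurable borel"
proof -
  have "(\<lambda>s. if s < A then (s, 0) else if s < A + B then (A, s - A)
      else if s < 2 * A + B then (2 * A + B - s, B) else (0, perimeter - s)) \<in> borel_measurable (borel :: real measure)"
    by (intro measurable_If borel_measurable_Pair) measurable
  then show ?thesis unfolding param_eq[abs_def, symmetric] by (simp add: param_eq[abs_def])
qed

lemma sets_boundary_measure [simp, measurable_cong]: "sets \<sigma> = sets borel"
  and space_boundary_measure [simp]: "space \<sigma> = UNIV"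
  by (simp_all add: boundary_measure_def)

lemma param_restrict_measurable:
  "boundary_param a b \<in> restrict_space lborel {0..<2 * (a + b) * pi} \<rightarrow>\<^sub>M borel"
  by (rule measurable_restrict_space1) simp

lemma finite_boundary_measure: "finite_measure \<sigma>"
  unfolding boundary_measure_def
  by (intro finite_measure.finite_measure_distr param_restrict_measurable finite_measureI)
     (use emeasure_bounded_finite[of "{0..<2 * (a + b) * pi}"] in \<open>simp_all add: emeasure_restrict_space space_restrict_space\<close>)

definition edge_integral :: "(real \<times> real \<Rightarrow> real) \<Rightarrow> real" where
  "edge_integral g = (\<integral>s. indicator {0<..<A} s * g (s, 0) \<partial>lborel) + (\<integral>s. indicator {0<..<B} s * g (A, s) \<partial>lborel)
    + (\<integral>s. indicator {0<..<A} s * g (s, B) \<partial>lborel) + (\<integral>s. indicator {0<..<B} s * g (0, s) \<partial>lborel)"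

lemma edge_integrable:
  assumes g: "g \<in> borel_measurable borel" and K: "\<And>p. p \<in> cbox (0, 0) (A, B) \<Longrightarrow> \<bar>g p\<bar> \<le> (K :: real)"
  shows "integrable lborel (\<lambda>s. indicator {0<..<A} s * g (s, 0))" "integrable lborel (\<lambda>s. indicator {0<..<B} s * g (A, s))"
    "integrable lborel (\<lambda>s. indicator {0<..<A} s * g (s, B))" "integrable lborel (\<lambda>s. indicator {0<..<B} s * g (0, s))"
  using A_pos B_pos
  by (auto intro!: integrable_on_open_interval[where K=K] K borel_measurable_pair_fst borel_measurable_pair_snd g)

text \<open>Off the four corners, the parametrization is a translation or a reflection on each side.\<close>
lemma boundary_integral:
  assumes g: "g \<in> borel_measurable borel" and K: "\<And>p. p \<in> cbox (0, 0) (A, B) \<Longrightarrow> \<bar>g p\<bar> \<le> (K :: real)"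
  shows "integrable \<sigma> g" and "(\<integral>p. g p \<partial>\<sigma>) = edge_integral g"
proof -
  note ei = edge_integrable[OF g K]
  define g1 g2 g3 g4 where "g1 s = indicator {0<..<A} s * g (s, 0)" and "g2 s = indicator {0<..<B} s * g (A, s)"
    and "g3 s = indicator {0<..<A} s * g (s, B)" and "g4 s = indicator {0<..<B} s * g (0, s)" for s
  have i: "integrable lborel g1" "integrable lborel g2" "integrable lborel g3" "integrable lborel g4"
    using ei by (simp_all add: g1_def[abs_def] g2_def[abs_def] g3_def[abs_def] g4_def[abs_def])
  have i2: "integrable lborel (\<lambda>s. g2 (- A + 1 * s))" "integrable lborel (\<lambda>s. g3 ((2 * A + B) + (-1) * s))"
    "integrable lborel (\<lambda>s. g4 (perimeter + (-1) * s))"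
    by (intro lborel_integrable_real_affine i; simp)+
  let ?h = "\<lambda>s. g1 s + g2 (- A + 1 * s) + g3 ((2 * A + B) + (-1) * s) + g4 (perimeter + (-1) * s)"
  have P: "2 * (a + b) * pi = perimeter" by (simp add: perimeter_def A_def B_def algebra_simps)
  have ae: "AE s in lborel. ?h s = indicator {0..<perimeter} s *\<^sub>R g (boundary_param a b s)"
  proof -
    have "AE s in lborel. s \<noteq> 0 \<and> s \<noteq> A \<and> s \<noteq> A + B \<and> s \<noteq> 2 * A + B"
      by (intro AE_conjI AE_lborel_singleton)
    then show ?thesis
    proof eventually_elim
      case (elim s)
      then show ?case using A_pos B_pos
        by (auto simp: param_eq g1_def g2_def g3_def g4_def perimeter_def indicator_def)
    qed
  qed
  have meas: "(\<lambda>s. indicator {0..<perimeter} s *\<^sub>R g (boundary_param a b s)) \<in> borel_measurable lborel"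
    using measurable_compose[OF boundary_param_measurable g] by simp
  have hi: "integrable lborel ?h" using i(1) i2 by auto
  have int: "integrable lborel (\<lambda>s. indicator {0..<perimeter} s *\<^sub>R g (boundary_param a b s))"
    by (rule Bochner_Integration.integrable_cong_AE_imp[OF hi meas]) (use ae in \<open>simp add: eq_commute\<close>)
  then show "integrable \<sigma> g"
    unfolding boundary_measure_def P
    by (subst integrable_distr_eq[OF param_restrict_measurable[unfolded P] g]) (simp add: integrable_restrict_space)
  have "(\<integral>p. g p \<partial>\<sigma>) = (\<integral>s. g (boundary_param a b s) \<partial>restrict_space lborel {0..<perimeter})"
    unfolding boundary_measure_def P by (rule integral_distr[OF param_restrict_measurable[unfolded P] g])
  also have "\<dots> = (\<integral>s. indicator {0..<perimeter} s *\<^sub>R g (boundary_param a b s) \<partial>lborel)"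
    by (subst integral_restrict_space) auto
  also have "\<dots> = (\<integral>s. ?h s \<partial>lborel)"
    by (rule integral_cong_AE[OF meas]) (use hi ae in \<open>auto simp: eq_commute\<close>)
  also have "\<dots> = (\<integral>s. g1 s \<partial>lborel) + (\<integral>s. g2 (- A + 1 * s) \<partial>lborel) + (\<integral>s. g3 ((2 * A + B) + (-1) * s) \<partial>lborel) + (\<integral>s. g4 (perimeter + (-1) * s) \<partial>lborel)"
    using i(1) i2 by simp
  also have "\<dots> = edge_integral g"
    using lborel_integral_real_affine[of 1 g2 "- A"] lborel_integral_real_affine[of "-1" g3 "2 * A + B"]
      lborel_integral_real_affine[of "-1" g4 perimeter]
    by (simp add: edge_integral_def g1_def[abs_def] g2_def[abs_def] g3_def[abs_def] g4_def[abs_def])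
  finally show "(\<integral>p. g p \<partial>\<sigma>) = edge_integral g" .
qed

lemma continuous_L2_boundary:
  fixes \<phi> :: "real \<times> real \<Rightarrow> complex"
  assumes "continuous_on UNIV \<phi>" shows "\<phi> \<in> L2 \<sigma>"
proof -
  have m: "\<phi> \<in> borel_measurable borel" by (rule borel_measurable_continuous_onI[OF assms])
  have c: "continuous_on UNIV (\<lambda>p. (cmod (\<phi> p))\<^sup>2)" by (intro continuous_intros assms)
  obtain K where K: "\<And>p. p \<in> cbox (0, 0) (A, B) \<Longrightarrow> norm ((cmod (\<phi> p))\<^sup>2) \<le> K"
    using continuous_bounded[OF c] by blast
  have "integrable \<sigma> (\<lambda>p. (cmod (\<phi> p))\<^sup>2)"
    by (rule boundary_integral(1)[OF borel_measurable_continuous_onI[OF c]]) (use K in simp)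
  moreover have "\<phi> \<in> borel_measurable \<sigma>" using m by simp
  ultimately show ?thesis by (simp add: L2_def)
qed

lemma boundary_norm_sq:
  fixes \<phi> :: "real \<times> real \<Rightarrow> complex"
  assumes \<phi>: "continuous_on UNIV \<phi>"
  shows "(L2_norm \<sigma> \<phi>)\<^sup>2 = integral {0..A} (\<lambda>x. (cmod (\<phi> (x, B)))\<^sup>2 + (cmod (\<phi> (x, 0)))\<^sup>2)
    + integral {0..B} (\<lambda>y. (cmod (\<phi> (A, y)))\<^sup>2 + (cmod (\<phi> (0, y)))\<^sup>2)"
proof -
  have c: "continuous_on UNIV (\<lambda>p. (cmod (\<phi> p))\<^sup>2)" by (intro continuous_intros \<phi>)
  obtain K where K: "\<And>p. p \<in> cbox (0, 0) (A, B) \<Longrightarrow> norm ((cmod (\<phi> p))\<^sup>2) \<le> K"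
    using continuous_bounded[OF c] by blast
  have c1: "continuous_on UNIV (\<lambda>s. (cmod (\<phi> (s, r)))\<^sup>2)" and c2: "continuous_on UNIV (\<lambda>s. (cmod (\<phi> (r, s)))\<^sup>2)" for r
    by (auto intro!: continuous_intros continuous_on_compose2[OF \<phi>])
  have i1: "(\<lambda>s. (cmod (\<phi> (s, r)))\<^sup>2) integrable_on {l..u}" and i2: "(\<lambda>s. (cmod (\<phi> (r, s)))\<^sup>2) integrable_on {l..u}" for r l u
    by (intro integrable_continuous_interval continuous_on_subset[OF c1] continuous_on_subset[OF c2]; simp)+
  have "(L2_norm \<sigma> \<phi>)\<^sup>2 = edge_integral (\<lambda>p. (cmod (\<phi> p))\<^sup>2)"
    unfolding L2_norm_sq by (rule boundary_integral(2)[OF borel_measurable_continuous_onI[OF c]]) (use K in simp)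
  then show ?thesis
    by (simp add: edge_integral_def integral_open_interval_eq c1 c2 integral_add i1 i2)
qed

definition "trace_const = 2 / A + 2 / B + 2"

lemma trace_const_pos: "trace_const > 0"
  unfolding trace_const_def using A_pos B_pos by (simp add: add_pos_pos)

lemma inner_self_cmod: "z \<bullet> z = (cmod z)\<^sup>2" by (simp add: power2_norm_eq_inner)

text \<open>The volume side of the divergence theorem for the fields used below; \<open>w\<close> stands for \<open>2x - A\<close> or \<open>2y - B\<close> and
  \<open>\<phi>'\<close> for the derivative of \<open>\<phi>\<close> in the same direction.\<close>
lemma trace_inequality_direction:
  fixes \<phi> \<phi>' :: "real \<times> real \<Rightarrow> complex" and w :: "real \<times> real \<Rightarrow> real"
  assumes c: "continuous_on UNIV \<phi>" "continuous_on UNIV \<phi>'" "continuous_on UNIV w" and w: "\<And>p. p \<in> \<Omega> \<Longrightarrow> \<bar>w p\<bar> \<le> L"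
    and "L > 0"
  shows "(\<integral>p. 2 * (\<phi> p \<bullet> \<phi> p) + w p * (2 * (\<phi> p \<bullet> \<phi>' p)) \<partial>M) \<le> (2 + L) * (L2_norm M \<phi>)\<^sup>2 + L * (L2_norm M \<phi>')\<^sup>2"
proof -
  have "(\<integral>p. 2 * (\<phi> p \<bullet> \<phi> p) + w p * (2 * (\<phi> p \<bullet> \<phi>' p)) \<partial>M) \<le> (\<integral>p. (2 + L) * (cmod (\<phi> p))\<^sup>2 + L * (cmod (\<phi>' p))\<^sup>2 \<partial>M)"
  proof (rule integral_mono)
    show "integrable M (\<lambda>p. 2 * (\<phi> p \<bullet> \<phi> p) + w p * (2 * (\<phi> p \<bullet> \<phi>' p)))"
      "integrable M (\<lambda>p. (2 + L) * (cmod (\<phi> p))\<^sup>2 + L * (cmod (\<phi>' p))\<^sup>2)"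
      by (intro continuous_integrable continuous_intros c)+
    fix p assume "p \<in> space M"
    then have wp: "\<bar>w p\<bar> \<le> L" using w by simp
    have "\<bar>2 * (\<phi> p \<bullet> \<phi>' p)\<bar> \<le> (cmod (\<phi> p))\<^sup>2 + (cmod (\<phi>' p))\<^sup>2"
      using Cauchy_Schwarz_ineq2[of "\<phi> p" "\<phi>' p"] sum_squares_bound[of "cmod (\<phi> p)" "cmod (\<phi>' p)"] by simp
    then have "\<bar>w p\<bar> * \<bar>2 * (\<phi> p \<bullet> \<phi>' p)\<bar> \<le> L * ((cmod (\<phi> p))\<^sup>2 + (cmod (\<phi>' p))\<^sup>2)"
      using wp \<open>L > 0\<close> by (intro mult_mono) auto
    then have "w p * (2 * (\<phi> p \<bullet> \<phi>' p)) \<le> L * ((cmod (\<phi> p))\<^sup>2 + (cmod (\<phi>' p))\<^sup>2)"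
      using abs_ge_self[of "w p * (2 * (\<phi> p \<bullet> \<phi>' p))"] unfolding abs_mult[of "w p"] by linarith
    then show "2 * (\<phi> p \<bullet> \<phi> p) + w p * (2 * (\<phi> p \<bullet> \<phi>' p)) \<le> (2 + L) * (cmod (\<phi> p))\<^sup>2 + L * (cmod (\<phi>' p))\<^sup>2"
      by (simp add: inner_self_cmod algebra_simps)
  qed
  also have "\<dots> = (2 + L) * (L2_norm M \<phi>)\<^sup>2 + L * (L2_norm M \<phi>')\<^sup>2"
    using L2_integrable_sq[OF continuous_L2[OF c(1)]] L2_integrable_sq[OF continuous_L2[OF c(2)]]
    by (simp add: L2_norm_sq)
  finally show ?thesis .
qed

text \<open>The vector fields \<open>(2x - A, 0)\<close> and \<open>(0, 2y - B)\<close> point outwards on the two sides that they meet, so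
  the divergence theorem controls the boundary values.\<close>
lemma trace_inequality:
  fixes \<phi> :: "real \<times> real \<Rightarrow> complex"
  assumes \<phi>: "smooth \<phi>"
  shows "(L2_norm \<sigma> \<phi>)\<^sup>2 \<le> trace_const * (H1_norm \<Omega> \<phi>)\<^sup>2"
proof -
  let ?x = "\<lambda>p. frechet_derivative \<phi> (at p) (1, 0)" and ?y = "\<lambda>p. frechet_derivative \<phi> (at p) (0, 1)"
  note B = basis_vectors
  have c: "continuous_on UNIV \<phi>" "continuous_on UNIV ?x" "continuous_on UNIV ?y"
    using \<phi> B by (auto intro: smooth_continuous smooth_partial)
  note dx = partial_x[OF smooth_differentiable[OF \<phi>]] and dy = partial_y[OF smooth_differentiable[OF \<phi>]]
  have "A * integral {0..B} (\<lambda>y. (cmod (\<phi> (A, y)))\<^sup>2 + (cmod (\<phi> (0, y)))\<^sup>2)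
      = integral {0..B} (\<lambda>y. (2 * fst (A, y) - A) * (\<phi> (A, y) \<bullet> \<phi> (A, y)) - (2 * fst (0, y) - A) * (\<phi> (0, y) \<bullet> \<phi> (0, y)))"
    by (simp add: inner_self_cmod algebra_simps flip: integral_mult_right)
  also have "\<dots> = (\<integral>p. 2 * (\<phi> p \<bullet> \<phi> p) + (2 * fst p - A) * (2 * (\<phi> p \<bullet> ?x p)) \<partial>M)"
  proof (rule divergence_x[symmetric])
    fix p :: "real \<times> real"
    have 1: "((\<lambda>s. 2 * s - A) has_vector_derivative 2) (at (fst p))"
      by (auto intro!: derivative_eq_intros simp flip: has_real_derivative_iff_has_vector_derivative)
    have 2: "((\<lambda>s. \<phi> (s, snd p) \<bullet> \<phi> (s, snd p)) has_vector_derivative \<phi> p \<bullet> ?x p + ?x p \<bullet> \<phi> p) (at (fst p))"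
      using bounded_bilinear.has_vector_derivative[OF bounded_bilinear_inner dx[of p] dx[of p]] by simp
    show "((\<lambda>s. (2 * fst (s, snd p) - A) * (\<phi> (s, snd p) \<bullet> \<phi> (s, snd p))) has_vector_derivative
        2 * (\<phi> p \<bullet> \<phi> p) + (2 * fst p - A) * (2 * (\<phi> p \<bullet> ?x p))) (at (fst p))"
      using has_vector_derivative_mult[OF 1 2] by (simp add: inner_commute algebra_simps)
  qed (intro continuous_intros c)
  also have "\<dots> \<le> (2 + A) * (L2_norm M \<phi>)\<^sup>2 + A * (L2_norm M ?x)\<^sup>2"
    by (rule trace_inequality_direction) (auto intro!: continuous_intros c A_pos simp: rectangle_eq)
  finally have 1: "integral {0..B} (\<lambda>y. (cmod (\<phi> (A, y)))\<^sup>2 + (cmod (\<phi> (0, y)))\<^sup>2)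
      \<le> (2 / A + 1) * (L2_norm M \<phi>)\<^sup>2 + (L2_norm M ?x)\<^sup>2"
    using A_pos by (simp add: field_simps)
  have "B * integral {0..A} (\<lambda>x. (cmod (\<phi> (x, B)))\<^sup>2 + (cmod (\<phi> (x, 0)))\<^sup>2)
      = integral {0..A} (\<lambda>x. (2 * snd (x, B) - B) * (\<phi> (x, B) \<bullet> \<phi> (x, B)) - (2 * snd (x, 0) - B) * (\<phi> (x, 0) \<bullet> \<phi> (x, 0)))"
    by (simp add: inner_self_cmod algebra_simps flip: integral_mult_right)
  also have "\<dots> = (\<integral>p. 2 * (\<phi> p \<bullet> \<phi> p) + (2 * snd p - B) * (2 * (\<phi> p \<bullet> ?y p)) \<partial>M)"
  proof (rule divergence_y[symmetric])
    fix p :: "real \<times> real"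
    have 1: "((\<lambda>s. 2 * s - B) has_vector_derivative 2) (at (snd p))"
      by (auto intro!: derivative_eq_intros simp flip: has_real_derivative_iff_has_vector_derivative)
    have 2: "((\<lambda>s. \<phi> (fst p, s) \<bullet> \<phi> (fst p, s)) has_vector_derivative \<phi> p \<bullet> ?y p + ?y p \<bullet> \<phi> p) (at (snd p))"
      using bounded_bilinear.has_vector_derivative[OF bounded_bilinear_inner dy[of p] dy[of p]] by simp
    show "((\<lambda>s. (2 * snd (fst p, s) - B) * (\<phi> (fst p, s) \<bullet> \<phi> (fst p, s))) has_vector_derivative
        2 * (\<phi> p \<bullet> \<phi> p) + (2 * snd p - B) * (2 * (\<phi> p \<bullet> ?y p))) (at (snd p))"
      using has_vector_derivative_mult[OF 1 2] by (simp add: inner_commute algebra_simps)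
  qed (intro continuous_intros c)
  also have "\<dots> \<le> (2 + B) * (L2_norm M \<phi>)\<^sup>2 + B * (L2_norm M ?y)\<^sup>2"
    by (rule trace_inequality_direction) (auto intro!: continuous_intros c B_pos simp: rectangle_eq)
  finally have 2: "integral {0..A} (\<lambda>x. (cmod (\<phi> (x, B)))\<^sup>2 + (cmod (\<phi> (x, 0)))\<^sup>2)
      \<le> (2 / B + 1) * (L2_norm M \<phi>)\<^sup>2 + (L2_norm M ?y)\<^sup>2"
    using B_pos by (simp add: field_simps)
  have "(L2_norm \<sigma> \<phi>)\<^sup>2 \<le> trace_const * (L2_norm M \<phi>)\<^sup>2 + (L2_norm M ?x)\<^sup>2 + (L2_norm M ?y)\<^sup>2"
    using 1 2 unfolding boundary_norm_sq[OF c(1)] trace_const_def by (simp add: algebra_simps)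
  also have "\<dots> \<le> trace_const * (L2_norm M \<phi>)\<^sup>2 + trace_const * (L2_norm M ?x)\<^sup>2 + trace_const * (L2_norm M ?y)\<^sup>2"
  proof -
    have "trace_const \<ge> 1" using A_pos B_pos by (simp add: trace_const_def add_nonneg_nonneg)
    then have "t \<le> trace_const * t" if "t \<ge> 0" for t using mult_right_mono[of 1 trace_const t] that by simp
    then show ?thesis by (intro add_mono) auto
  qed
  also have "\<dots> = trace_const * (H1_norm \<Omega> \<phi>)\<^sup>2"
    using H1_norm_sq[OF smooth_has_weak_partial[OF \<phi> B(1)] smooth_has_weak_partial[OF \<phi> B(2)]] by (simp add: algebra_simps)
  finally show ?thesis .
qed

lemma H1_norm_le_sum:
  assumes "has_weak_partial \<Omega> (1, 0) u g" "has_weak_partial \<Omega> (0, 1) u h"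
  shows "H1_norm \<Omega> u \<le> L2_norm M u + L2_norm M g + L2_norm M h"
proof (rule power2_le_imp_le)
  have "(x::real)\<^sup>2 + y\<^sup>2 + z\<^sup>2 \<le> (x + y + z)\<^sup>2" if "x \<ge> 0" "y \<ge> 0" "z \<ge> 0" for x y z
    using that by (simp add: power2_eq_square algebra_simps)
  then show "(H1_norm \<Omega> u)\<^sup>2 \<le> (L2_norm M u + L2_norm M g + L2_norm M h)\<^sup>2"
    unfolding H1_norm_sq[OF assms] by simp
qed simp

text \<open>Each of the three parts of the norm on the left is at most the sum on the right; a constant factor does no
  harm to convergence statements.\<close>
lemma H1_norm_diff_triangle:
  assumes "f \<in> H1 \<Omega>" "g \<in> H1 \<Omega>" "w \<in> H1 \<Omega>"
  shows "H1_norm \<Omega> (\<lambda>x. f x - g x) \<le> 3 * (H1_norm \<Omega> (\<lambda>x. f x - w x) + H1_norm \<Omega> (\<lambda>x. g x - w x))"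
proof -
  note B = basis_vectors
  let ?S = "H1_norm \<Omega> (\<lambda>x. f x - w x) + H1_norm \<Omega> (\<lambda>x. g x - w x)"
  have tri: "L2_norm M (\<lambda>x. u x - v x) \<le> L2_norm M (\<lambda>x. u x - z x) + L2_norm M (\<lambda>x. v x - z x)"
    if "u \<in> L2 M" "v \<in> L2 M" "z \<in> L2 M" for u v z
    using L2_norm_diff_triangle[OF that(1) that(3) that(2)] L2_norm_minus_commute[of M v z] by simp
  have d: "has_weak_partial \<Omega> e (\<lambda>x. u x - v x) (\<lambda>x. wp e u x - wp e v x)"
    if "u \<in> H1 \<Omega>" "v \<in> H1 \<Omega>" "e \<in> Basis" for u v e
    by (intro has_weak_partial_diff H1_weak_partial that)
  have part: "L2_norm M (\<lambda>x. wp e f x - wp e g x) \<le> ?S" if e: "e \<in> Basis" for e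
  proof -
    have "L2_norm M (\<lambda>x. wp e u x - wp e w x) \<le> H1_norm \<Omega> (\<lambda>x. u x - w x)" if "u \<in> H1 \<Omega>" for u
      using L2_norm_weak_partial_le_H1_norm[OF e, of "\<lambda>x. u x - w x"] L2_norm_weak_partial[OF d[OF that assms(3) e]] by simp
    from this[OF assms(1)] this[OF assms(2)] show ?thesis
      using tri[of "wp e f" "wp e g" "wp e w"] assms e
      by (simp add: weak_partial_L2)
  qed
  have "L2_norm M (\<lambda>x. f x - g x) \<le> ?S"
    using tri[OF H1_L2[OF assms(1)] H1_L2[OF assms(2)] H1_L2[OF assms(3)]]
      L2_norm_le_H1_norm[of "\<lambda>x. f x - w x"] L2_norm_le_H1_norm[of "\<lambda>x. g x - w x"] by linarith
  then have "H1_norm \<Omega> (\<lambda>x. f x - g x) \<le> ?S + ?S + ?S"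
    using H1_norm_le_sum[OF d[OF assms(1,2) B(1)] d[OF assms(1,2) B(2)]] part[OF B(1)] part[OF B(2)]
    by (elim order_trans) (intro add_mono)
  then show ?thesis by simp
qed

lemma smooth_diff: assumes "smooth f" "smooth g" shows "smooth (\<lambda>p. f p - g p)"
proof -
  have neg: "C_k k (\<lambda>p. - h p)" if "C_k k h" for h k
    using that
  proof (induction k arbitrary: h)
    case 0 then show ?case by (auto intro: continuous_intros)
  next
    case (Suc k)
    have d: "h differentiable (at x)" for x using Suc.prems unfolding C_k.simps by blast
    have "frechet_derivative (\<lambda>p. - h p) (at x) = (\<lambda>e. - frechet_derivative h (at x) e)" for x
      using d by (intro frechet_derivative_at[symmetric] has_derivative_minus) (simp flip: frechet_derivative_works)
    then show ?case using Suc.IH Suc.prems d by (simp add: differentiable_minus)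
  qed
  have "smooth (\<lambda>p. f p + (- g p))"
    using assms unfolding smooth_def by (intro allI C_k_add neg) auto
  then show ?thesis by simp
qed

lemma smooth_boundary_L2: "smooth \<phi> \<Longrightarrow> \<phi> \<in> L2 \<sigma>"
  by (intro continuous_L2_boundary smooth_continuous)

lemma trace_difference:
  assumes \<phi>: "smooth \<phi>" and \<psi>: "smooth \<psi>" and w: "w \<in> H1 \<Omega>"
  shows "L2_norm \<sigma> (\<lambda>x. \<phi> x - \<psi> x) \<le> sqrt trace_const * (3 * (H1_norm \<Omega> (\<lambda>x. \<phi> x - w x) + H1_norm \<Omega> (\<lambda>x. \<psi> x - w x)))"
proof -
  have "L2_norm \<sigma> (\<lambda>x. \<phi> x - \<psi> x) \<le> sqrt trace_const * H1_norm \<Omega> (\<lambda>x. \<phi> x - \<psi> x)"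
    by (rule power2_le_imp_le)
      (use trace_inequality[OF smooth_diff[OF \<phi> \<psi>]] trace_const_pos H1_norm_nonneg in \<open>simp_all add: power_mult_distrib\<close>)
  also have "\<dots> \<le> sqrt trace_const * (3 * (H1_norm \<Omega> (\<lambda>x. \<phi> x - w x) + H1_norm \<Omega> (\<lambda>x. \<psi> x - w x)))"
    using trace_const_pos by (intro mult_left_mono H1_norm_diff_triangle smooth_H1 \<phi> \<psi> w) auto
  finally show ?thesis .
qed

text \<open>By the trace inequality the boundary values of any sequence of smooth functions that converges to \<open>w\<close> in
  \<open>H\<^sup>1\<close> form a Cauchy sequence, and two such sequences have the same limit. Hence the trace exists, and it does
  not matter which sequence the definition has chosen.\<close>
lemma boundary_trace_tendsto:
  assumes w: "w \<in> H1 \<Omega>" and \<phi>: "\<And>n::nat. smooth (\<phi> n)" and lim: "(\<lambda>n. H1_norm \<Omega> (\<lambda>x. \<phi> n x - w x)) \<longlonglongrightarrow> 0"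
  shows "boundary_trace a b w \<in> L2 \<sigma>" and "(\<lambda>n. L2_norm \<sigma> (\<lambda>x. \<phi> n x - boundary_trace a b w x)) \<longlonglongrightarrow> 0"
proof -
  let ?C = "sqrt trace_const"
  have C: "?C > 0" using trace_const_pos by simp
  have "\<exists>N. \<forall>m\<ge>N. \<forall>n\<ge>N. L2_norm \<sigma> (\<lambda>x. \<phi> m x - \<phi> n x) < e" if "e > 0" for e
  proof -
    have "e / (6 * ?C) > 0" using that C by simp
    then obtain N where N: "\<And>n. n \<ge> N \<Longrightarrow> H1_norm \<Omega> (\<lambda>x. \<phi> n x - w x) < e / (6 * ?C)"
      using LIMSEQ_D[OF lim] H1_norm_nonneg by (metis diff_zero real_norm_def abs_of_nonneg)
    have "L2_norm \<sigma> (\<lambda>x. \<phi> m x - \<phi> n x) < e" if "m \<ge> N" "n \<ge> N" for m n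
    proof -
      have "L2_norm \<sigma> (\<lambda>x. \<phi> m x - \<phi> n x) \<le> ?C * (3 * (H1_norm \<Omega> (\<lambda>x. \<phi> m x - w x) + H1_norm \<Omega> (\<lambda>x. \<phi> n x - w x)))"
        by (rule trace_difference[OF \<phi> \<phi> w])
      also have "\<dots> < ?C * (3 * (e / (6 * ?C) + e / (6 * ?C)))"
        using N[OF that(1)] N[OF that(2)] C by (intro mult_strict_left_mono) auto
      also have "\<dots> = e" using C by simp
      finally show ?thesis .
    qed
    then show ?thesis by blast
  qed
  from L2_complete[of \<sigma> \<phi>, OF finite_boundary_measure smooth_boundary_L2[OF \<phi>] this]
  obtain g where "g \<in> L2 \<sigma>" "(\<lambda>n. L2_norm \<sigma> (\<lambda>x. \<phi> n x - g x)) \<longlonglongrightarrow> 0" by auto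
  then have "has_boundary_trace a b w g"
    unfolding has_boundary_trace_def using w \<phi> lim by blast
  then have "has_boundary_trace a b w (boundary_trace a b w)"
    unfolding boundary_trace_def by (rule someI[where P="has_boundary_trace a b w"])
  then obtain \<psi> where g: "boundary_trace a b w \<in> L2 \<sigma>" and \<psi>: "\<And>n::nat. smooth (\<psi> n)"
    and lim1: "(\<lambda>n. H1_norm \<Omega> (\<lambda>x. \<psi> n x - w x)) \<longlonglongrightarrow> 0"
    and lim2: "(\<lambda>n. L2_norm \<sigma> (\<lambda>x. \<psi> n x - boundary_trace a b w x)) \<longlonglongrightarrow> 0"
    unfolding has_boundary_trace_def by blast
  show "boundary_trace a b w \<in> L2 \<sigma>" by (rule g)
  have "(\<lambda>n. ?C * (3 * (H1_norm \<Omega> (\<lambda>x. \<phi> n x - w x) + H1_norm \<Omega> (\<lambda>x. \<psi> n x - w x))) + L2_norm \<sigma> (\<lambda>x. \<psi> n x - boundary_trace a b w x))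
      \<longlonglongrightarrow> ?C * (3 * (0 + 0)) + 0"
    by (intro tendsto_intros lim lim1 lim2)
  then have lim3: "(\<lambda>n. ?C * (3 * (H1_norm \<Omega> (\<lambda>x. \<phi> n x - w x) + H1_norm \<Omega> (\<lambda>x. \<psi> n x - w x))) + L2_norm \<sigma> (\<lambda>x. \<psi> n x - boundary_trace a b w x))
      \<longlonglongrightarrow> 0" by simp
  have "norm (L2_norm \<sigma> (\<lambda>x. \<phi> n x - boundary_trace a b w x))
      \<le> ?C * (3 * (H1_norm \<Omega> (\<lambda>x. \<phi> n x - w x) + H1_norm \<Omega> (\<lambda>x. \<psi> n x - w x))) + L2_norm \<sigma> (\<lambda>x. \<psi> n x - boundary_trace a b w x)" for n
    using L2_norm_diff_triangle[OF smooth_boundary_L2[OF \<phi>[of n]] smooth_boundary_L2[OF \<psi>[of n]] g]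
      trace_difference[OF \<phi>[of n] \<psi>[of n] w] L2_norm_nonneg[of \<sigma> "\<lambda>x. \<phi> n x - boundary_trace a b w x"]
    unfolding real_norm_def by linarith
  then show "(\<lambda>n. L2_norm \<sigma> (\<lambda>x. \<phi> n x - boundary_trace a b w x)) \<longlonglongrightarrow> 0"
    by (intro Lim_null_comparison[OF _ lim3] always_eventually allI)
qed

end

section \<open>Normal derivatives\<close>

context rect begin

text \<open>The normal derivatives of a sine mode and, with \<open>normal_sum\<close>, of a sine polynomial.\<close>
definition normal_mode :: "nat \<times> nat \<Rightarrow> real \<times> real \<Rightarrow> real" where
  "normal_mode q p = fst (outward_normal a b p) * (mx q * mode cos sin q p) + snd (outward_normal a b p) * (my q * mode sin cos q p)"

definition normal_sum :: "(nat \<times> nat \<Rightarrow> complex) \<Rightarrow> nat \<Rightarrow> real \<times> real \<Rightarrow> complex" where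
  "normal_sum c N p = (\<Sum>q\<in>I N. c q * of_real (normal_mode q p))"

abbreviation "dx c \<equiv> (\<lambda>q. complex_of_real (mx q) * c q)"
abbreviation "dy c \<equiv> (\<lambda>q. complex_of_real (my q) * c q)"

lemma normal_sum_eq: "normal_sum c N p = of_real (fst (outward_normal a b p)) * tsum cos sin (dx c) N p
    + of_real (snd (outward_normal a b p)) * tsum sin cos (dy c) N p"
  by (simp add: normal_sum_def normal_mode_def tsum_def sum_distrib_left sum.distrib algebra_simps)

lemma normal_derivative_eq: "normal_derivative a b u p = of_real (fst (outward_normal a b p)) * boundary_trace a b (wp (1, 0) u) p
    + of_real (snd (outward_normal a b p)) * boundary_trace a b (wp (0, 1) u) p"
  by (simp add: normal_derivative_def Basis_prod_def inner_prod_def scaleR_conv_of_real)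

lemma outward_normal_measurable:
  "(\<lambda>p. fst (outward_normal a b p)) \<in> borel_measurable borel" "(\<lambda>p. snd (outward_normal a b p)) \<in> borel_measurable borel"
proof -
  have m [measurable]: "(\<lambda>p::real \<times> real. fst p) \<in> borel_measurable borel" "(\<lambda>p::real \<times> real. snd p) \<in> borel_measurable borel"
    by (auto intro!: borel_measurable_continuous_onI continuous_intros)
  have 1: "(\<lambda>p. fst (outward_normal a b p)) = (\<lambda>p. if fst p = 0 then -1 else if fst p = a * pi then 1 else 0)"
   and 2: "(\<lambda>p. snd (outward_normal a b p)) = (\<lambda>p. if fst p = 0 then 0 else if fst p = a * pi then 0 else if snd p = 0 then -1 else 1)"
    by (auto simp: outward_normal_def fun_eq_iff)
  show "(\<lambda>p. fst (outward_normal a b p)) \<in> borel_measurable borel" "(\<lambda>p. snd (outward_normal a b p)) \<in> borel_measurable borel"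
    unfolding 1 2 by measurable
qed

lemma outward_normal_bounded: "\<bar>fst (outward_normal a b p)\<bar> \<le> 1" "\<bar>snd (outward_normal a b p)\<bar> \<le> 1"
  by (auto simp: outward_normal_def)

lemma normal_combination:
  assumes "f \<in> L2 \<sigma>" "g \<in> L2 \<sigma>"
  defines "h \<equiv> \<lambda>p. of_real (fst (outward_normal a b p)) * f p + of_real (snd (outward_normal a b p)) * g p"
  shows "h \<in> L2 \<sigma>" "L2_norm \<sigma> h \<le> L2_norm \<sigma> f + L2_norm \<sigma> g"
proof -
  have m: "(\<lambda>p. complex_of_real (fst (outward_normal a b p))) \<in> borel_measurable \<sigma>"
    "(\<lambda>p. complex_of_real (snd (outward_normal a b p))) \<in> borel_measurable \<sigma>"
    using outward_normal_measurable by simp_all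
  have L: "(\<lambda>p. of_real (fst (outward_normal a b p)) * f p) \<in> L2 \<sigma>" "(\<lambda>p. of_real (snd (outward_normal a b p)) * g p) \<in> L2 \<sigma>"
    by (rule L2_mult_bounded[where B=1]; use assms m outward_normal_bounded in simp)+
  show "h \<in> L2 \<sigma>" unfolding h_def by (rule L2_add[OF L])
  have "L2_norm \<sigma> (\<lambda>p. of_real (fst (outward_normal a b p)) * f p) \<le> 1 * L2_norm \<sigma> f"
    by (rule L2_norm_mult_bounded) (use assms m outward_normal_bounded in simp_all)
  moreover have "L2_norm \<sigma> (\<lambda>p. of_real (snd (outward_normal a b p)) * g p) \<le> 1 * L2_norm \<sigma> g"
    by (rule L2_norm_mult_bounded) (use assms m outward_normal_bounded in simp_all)
  ultimately show "L2_norm \<sigma> h \<le> L2_norm \<sigma> f + L2_norm \<sigma> g"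
    using L2_norm_triangle[OF L] unfolding h_def by linarith
qed

lemma tsum_boundary_L2: "f \<in> {sin, cos} \<Longrightarrow> g \<in> {sin, cos} \<Longrightarrow> tsum f g c N \<in> L2 \<sigma>"
  by (intro smooth_boundary_L2 smooth_tsum)

lemma normal_sum_L2: "normal_sum c N \<in> L2 \<sigma>"
  unfolding normal_sum_eq[abs_def] by (intro normal_combination(1) tsum_boundary_L2) auto

lemma trace_of_partials:
  assumes u: "u \<in> dom_laplacian \<Omega>"
  shows "boundary_trace a b (wp (1, 0) u) \<in> L2 \<sigma>"
    "(\<lambda>N. L2_norm \<sigma> (\<lambda>p. tsum cos sin (dx (fc u)) N p - boundary_trace a b (wp (1, 0) u) p)) \<longlonglongrightarrow> 0"
    "boundary_trace a b (wp (0, 1) u) \<in> L2 \<sigma>"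
    "(\<lambda>N. L2_norm \<sigma> (\<lambda>p. tsum sin cos (dy (fc u)) N p - boundary_trace a b (wp (0, 1) u) p)) \<longlonglongrightarrow> 0"
proof -
  note B = basis_vectors
  have H1: "wp e u \<in> H1 \<Omega>" if "e \<in> Basis" for e
    using u that unfolding dom_laplacian_def H2_def by blast
  have lim: "(\<lambda>N. H1_norm \<Omega> (\<lambda>x. \<phi> N x - wp e u x)) \<longlonglongrightarrow> 0"
    if e: "e \<in> Basis" and s: "\<And>N. smooth (\<phi> N)"
      and 0: "(\<lambda>N. L2_norm M (\<lambda>x. \<phi> N x - wp e u x)) \<longlonglongrightarrow> 0"
      and 1: "(\<lambda>N. L2_norm M (\<lambda>x. frechet_derivative (\<phi> N) (at x) (1, 0) - wp (1, 0) (wp e u) x)) \<longlonglongrightarrow> 0"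
      and 2: "(\<lambda>N. L2_norm M (\<lambda>x. frechet_derivative (\<phi> N) (at x) (0, 1) - wp (0, 1) (wp e u) x)) \<longlonglongrightarrow> 0"
    for e \<phi>
  proof -
    have d: "has_weak_partial \<Omega> e' (\<lambda>x. \<phi> N x - wp e u x)
        (\<lambda>x. frechet_derivative (\<phi> N) (at x) e' - wp e' (wp e u) x)" if "e' \<in> Basis" for e' N
      by (intro has_weak_partial_diff smooth_has_weak_partial s H1_weak_partial H1 e that)
    show ?thesis
    proof (rule Lim_null_comparison)
      show "(\<lambda>N. L2_norm M (\<lambda>x. \<phi> N x - wp e u x)
        + L2_norm M (\<lambda>x. frechet_derivative (\<phi> N) (at x) (1, 0) - wp (1, 0) (wp e u) x)
        + L2_norm M (\<lambda>x. frechet_derivative (\<phi> N) (at x) (0, 1) - wp (0, 1) (wp e u) x)) \<longlonglongrightarrow> 0"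
        using tendsto_add[OF tendsto_add[OF 0 1] 2] by simp
    qed (use H1_norm_le_sum[OF d[OF B(1)] d[OF B(2)]] in \<open>simp add: H1_norm_nonneg\<close>)
  qed
  have s: "smooth (tsum cos sin (dx (fc u)) N)" "smooth (tsum sin cos (dy (fc u)) N)" for N
    by (intro smooth_tsum; simp)+
  have l1: "(\<lambda>N. H1_norm \<Omega> (\<lambda>x. tsum cos sin (dx (fc u)) N x - wp (1, 0) u x)) \<longlonglongrightarrow> 0"
    by (rule lim[OF B(1) s(1)]) (simp_all only: tsum_partials insertI1 insertI2 fourier_gradient_tendsto[OF u] fourier_hessian_tendsto[OF u])
  have l2: "(\<lambda>N. H1_norm \<Omega> (\<lambda>x. tsum sin cos (dy (fc u)) N x - wp (0, 1) u x)) \<longlonglongrightarrow> 0"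
    by (rule lim[OF B(2) s(2)]) (simp_all only: tsum_partials insertI1 insertI2 fourier_gradient_tendsto[OF u] fourier_hessian_tendsto[OF u])
  show "boundary_trace a b (wp (1, 0) u) \<in> L2 \<sigma>"
    "(\<lambda>N. L2_norm \<sigma> (\<lambda>p. tsum cos sin (dx (fc u)) N p - boundary_trace a b (wp (1, 0) u) p)) \<longlonglongrightarrow> 0"
    by (rule boundary_trace_tendsto[OF H1[OF B(1)] s(1) l1])+
  show "boundary_trace a b (wp (0, 1) u) \<in> L2 \<sigma>"
    "(\<lambda>N. L2_norm \<sigma> (\<lambda>p. tsum sin cos (dy (fc u)) N p - boundary_trace a b (wp (0, 1) u) p)) \<longlonglongrightarrow> 0"
    by (rule boundary_trace_tendsto[OF H1[OF B(2)] s(2) l2])+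
qed

lemma normal_sum_tendsto:
  assumes u: "u \<in> dom_laplacian \<Omega>"
  shows "normal_derivative a b u \<in> L2 \<sigma>"
    "(\<lambda>N. L2_norm \<sigma> (\<lambda>p. normal_sum (fc u) N p - normal_derivative a b u p)) \<longlonglongrightarrow> 0"
proof -
  note t = trace_of_partials[OF u]
  show "normal_derivative a b u \<in> L2 \<sigma>"
    unfolding normal_derivative_eq[abs_def] by (rule normal_combination(1)[OF t(1) t(3)])
  have diff: "(\<lambda>p. normal_sum (fc u) N p - normal_derivative a b u p) =
    (\<lambda>p. of_real (fst (outward_normal a b p)) * (tsum cos sin (dx (fc u)) N p - boundary_trace a b (wp (1, 0) u) p)
       + of_real (snd (outward_normal a b p)) * (tsum sin cos (dy (fc u)) N p - boundary_trace a b (wp (0, 1) u) p))" for N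
    by (simp add: fun_eq_iff normal_sum_eq normal_derivative_eq algebra_simps)
  show "(\<lambda>N. L2_norm \<sigma> (\<lambda>p. normal_sum (fc u) N p - normal_derivative a b u p)) \<longlonglongrightarrow> 0"
  proof (rule Lim_null_comparison)
    show "(\<lambda>N. L2_norm \<sigma> (\<lambda>p. tsum cos sin (dx (fc u)) N p - boundary_trace a b (wp (1, 0) u) p)
      + L2_norm \<sigma> (\<lambda>p. tsum sin cos (dy (fc u)) N p - boundary_trace a b (wp (0, 1) u) p)) \<longlonglongrightarrow> 0"
      using tendsto_add[OF t(2) t(4)] by simp
    show "\<forall>\<^sub>F N in sequentially. norm (L2_norm \<sigma> (\<lambda>p. normal_sum (fc u) N p - normal_derivative a b u p)) \<le>
      L2_norm \<sigma> (\<lambda>p. tsum cos sin (dx (fc u)) N p - boundary_trace a b (wp (1, 0) u) p)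
      + L2_norm \<sigma> (\<lambda>p. tsum sin cos (dy (fc u)) N p - boundary_trace a b (wp (0, 1) u) p)"
      unfolding diff real_norm_def abs_of_nonneg[OF L2_norm_nonneg]
      by (intro always_eventually allI normal_combination(2) L2_diff tsum_boundary_L2 t) auto
  qed
qed

definition "normal_const = 2 * sqrt (trace_const * (3 * bound_const\<^sup>2))"

text \<open>The bound is uniform in \<open>N\<close>; it provides the dominating function for the passage to the limit under the
  integral in time.\<close>
lemma normal_sum_bound:
  assumes u: "u \<in> dom_laplacian \<Omega>"
  shows "L2_norm \<sigma> (normal_sum (fc u) N) \<le> normal_const * dom_norm \<Omega> u"
proof -
  have K: "bound_const \<ge> 0" by (simp add: bound_const_def)
  have D: "0 \<le> dom_norm \<Omega> u" by (simp add: dom_norm_def)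
  have sq: "\<kappa> * (\<Sum>q\<in>I N. (cmod (of_real (r q) * fc u q))\<^sup>2) \<le> bound_const\<^sup>2 * (dom_norm \<Omega> u)\<^sup>2"
    if "\<And>q. q \<in> J \<Longrightarrow> \<bar>r q\<bar> \<le> bound_const * lam q" for r
    using sum_sq_bound[OF u that K, of N] kappa_pos by (simp add: pos_le_divide_eq mult.commute)
  have *: "L2_norm \<sigma> \<phi> \<le> sqrt (trace_const * (3 * bound_const\<^sup>2)) * dom_norm \<Omega> u"
    if s: "smooth \<phi>" and b: "(L2_norm M \<phi>)\<^sup>2 \<le> bound_const\<^sup>2 * (dom_norm \<Omega> u)\<^sup>2"
      "(L2_norm M (\<lambda>p. frechet_derivative \<phi> (at p) (1, 0)))\<^sup>2 \<le> bound_const\<^sup>2 * (dom_norm \<Omega> u)\<^sup>2"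
      "(L2_norm M (\<lambda>p. frechet_derivative \<phi> (at p) (0, 1)))\<^sup>2 \<le> bound_const\<^sup>2 * (dom_norm \<Omega> u)\<^sup>2" for \<phi>
  proof (rule power2_le_imp_le)
    have "(L2_norm \<sigma> \<phi>)\<^sup>2 \<le> trace_const * (H1_norm \<Omega> \<phi>)\<^sup>2" by (rule trace_inequality[OF s])
    also have "\<dots> \<le> trace_const * (3 * bound_const\<^sup>2 * (dom_norm \<Omega> u)\<^sup>2)"
      unfolding H1_norm_sq[OF smooth_has_weak_partial[OF s basis_vectors(1)] smooth_has_weak_partial[OF s basis_vectors(2)]]
      using trace_const_pos b by (intro mult_left_mono) auto
    also have "\<dots> = (sqrt (trace_const * (3 * bound_const\<^sup>2)) * dom_norm \<Omega> u)\<^sup>2"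
      using trace_const_pos by (simp add: power_mult_distrib)
    finally show "(L2_norm \<sigma> \<phi>)\<^sup>2 \<le> (sqrt (trace_const * (3 * bound_const\<^sup>2)) * dom_norm \<Omega> u)\<^sup>2" .
  qed (use D trace_const_pos in simp)
  have P: "\<bar>mx q\<bar> \<le> bound_const * lam q" "\<bar>my q\<bar> \<le> bound_const * lam q"
    "\<bar>mx q * mx q\<bar> \<le> bound_const * lam q" "\<bar>my q * mx q\<bar> \<le> bound_const * lam q"
    "\<bar>mx q * my q\<bar> \<le> bound_const * lam q" "\<bar>my q * my q\<bar> \<le> bound_const * lam q" if "q \<in> J" for q
    using freq_bounds[OF that] freq_nonneg[of q] by (simp_all add: abs_mult power2_eq_square mult.commute)
  have n: "cmod (- z * (w * c)) = cmod (z * w * c)" "cmod (- z * w * c) = cmod (z * w * c)" "cmod (z * (w * c)) = cmod (z * w * c)" for z w c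
    by (simp_all add: norm_mult)
  have 1: "L2_norm \<sigma> (tsum cos sin (dx (fc u)) N) \<le> sqrt (trace_const * (3 * bound_const\<^sup>2)) * dom_norm \<Omega> u"
  proof (rule *)
    show "smooth (tsum cos sin (dx (fc u)) N)" by (intro smooth_tsum) auto
    show "(L2_norm M (tsum cos sin (dx (fc u)) N))\<^sup>2 \<le> bound_const\<^sup>2 * (dom_norm \<Omega> u)\<^sup>2"
      by (subst norm_tsum) (simp_all only: insertI1 insertI2 sq P)
    show "(L2_norm M (\<lambda>p. frechet_derivative (tsum cos sin (dx (fc u)) N) (at p) (1, 0)))\<^sup>2 \<le> bound_const\<^sup>2 * (dom_norm \<Omega> u)\<^sup>2"
      by (subst tsum_partials, simp, subst norm_tsum) (simp_all only: insertI1 insertI2 n of_real_mult[symmetric] sq P)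
    show "(L2_norm M (\<lambda>p. frechet_derivative (tsum cos sin (dx (fc u)) N) (at p) (0, 1)))\<^sup>2 \<le> bound_const\<^sup>2 * (dom_norm \<Omega> u)\<^sup>2"
      by (subst tsum_partials, simp, subst norm_tsum) (simp_all only: insertI1 insertI2 n of_real_mult[symmetric] sq P)
  qed
  have 2: "L2_norm \<sigma> (tsum sin cos (dy (fc u)) N) \<le> sqrt (trace_const * (3 * bound_const\<^sup>2)) * dom_norm \<Omega> u"
  proof (rule *)
    show "smooth (tsum sin cos (dy (fc u)) N)" by (intro smooth_tsum) auto
    show "(L2_norm M (tsum sin cos (dy (fc u)) N))\<^sup>2 \<le> bound_const\<^sup>2 * (dom_norm \<Omega> u)\<^sup>2"
      by (subst norm_tsum) (simp_all only: insertI1 insertI2 sq P)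
    show "(L2_norm M (\<lambda>p. frechet_derivative (tsum sin cos (dy (fc u)) N) (at p) (1, 0)))\<^sup>2 \<le> bound_const\<^sup>2 * (dom_norm \<Omega> u)\<^sup>2"
      by (subst tsum_partials, simp, subst norm_tsum) (simp_all only: insertI1 insertI2 n of_real_mult[symmetric] sq P)
    show "(L2_norm M (\<lambda>p. frechet_derivative (tsum sin cos (dy (fc u)) N) (at p) (0, 1)))\<^sup>2 \<le> bound_const\<^sup>2 * (dom_norm \<Omega> u)\<^sup>2"
      by (subst tsum_partials, simp, subst norm_tsum) (simp_all only: insertI1 insertI2 n of_real_mult[symmetric] sq P)
  qed
  have "L2_norm \<sigma> (normal_sum (fc u) N) \<le> L2_norm \<sigma> (tsum cos sin (dx (fc u)) N) + L2_norm \<sigma> (tsum sin cos (dy (fc u)) N)"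
    unfolding normal_sum_eq[abs_def] by (intro normal_combination(2) tsum_boundary_L2) auto
  also have "\<dots> \<le> normal_const * dom_norm \<Omega> u" using 1 2 by (simp add: normal_const_def)
  finally show ?thesis .
qed

section \<open>The multiplier identity\<close>

lemma tsum_zero_x: "tsum sin g c N (0, y) = 0" "tsum sin g c N (A, y) = 0"
  and tsum_zero_y: "tsum f sin c N (x, 0) = 0" "tsum f sin c N (x, B) = 0"
proof -
  have "mode sin g q (0, y) = 0" "mode sin g q (A, y) = 0" "mode f sin q (x, 0) = 0" "mode f sin q (x, B) = 0" for q
    using a_pos b_pos by (simp_all add: mode_def A_def B_def)
  then show "tsum sin g c N (0, y) = 0" "tsum sin g c N (A, y) = 0" "tsum f sin c N (x, 0) = 0" "tsum f sin c N (x, B) = 0"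
    by (simp_all add: tsum_def)
qed

text \<open>The integral of \<open>(m \<bullet> n) \<bar>\<partial>U/\<partial>n\<bar>\<^sup>2\<close> over the boundary, for the sine polynomial with coefficients \<open>c\<close>. For
  \<open>x\<^sub>0\<close> in \<open>{0, A}\<close> the side opposite to \<open>x = x\<^sub>0\<close> is \<open>x = A - x\<^sub>0\<close>, and \<open>m \<bullet> n = A\<close> there.\<close>
definition boundary_energy :: "real \<Rightarrow> real \<Rightarrow> (nat \<times> nat \<Rightarrow> complex) \<Rightarrow> nat \<Rightarrow> real" where
  "boundary_energy x0 y0 c N = A * integral {0..B} (\<lambda>y. (cmod (tsum cos sin (dx c) N (A - x0, y)))\<^sup>2)
    + B * integral {0..A} (\<lambda>x. (cmod (tsum sin cos (dy c) N (x, B - y0)))\<^sup>2)"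

lemma tsum_deriv_x:
  assumes f: "f \<in> {sin, cos}" and g: "g \<in> {sin, cos}"
  shows "((\<lambda>s. tsum f g c N (s, snd p)) has_vector_derivative frechet_derivative (tsum f g c N) (at p) (1, 0)) (at (fst p))"
    and "((\<lambda>s. tsum f g c N (fst p, s)) has_vector_derivative frechet_derivative (tsum f g c N) (at p) (0, 1)) (at (snd p))"
  by (intro partial_x partial_y smooth_differentiable smooth_tsum assms)+

lemma inner_deriv:
  fixes u v :: "real \<Rightarrow> complex"
  assumes "(u has_vector_derivative u') (at t)" "(v has_vector_derivative v') (at t)"
  shows "((\<lambda>s. u s \<bullet> v s) has_vector_derivative u t \<bullet> v' + u' \<bullet> v t) (at t)"
  using bounded_bilinear.has_vector_derivative[OF bounded_bilinear_inner assms] .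

lemma affine_mult_deriv:
  fixes h :: "real \<Rightarrow> real"
  assumes "(h has_vector_derivative h') (at t)"
  shows "((\<lambda>s. (s - r) * h s) has_vector_derivative (t - r) * h' + h t) (at t)"
proof -
  have "((\<lambda>s. s - r) has_vector_derivative 1) (at t)"
    by (auto intro!: derivative_eq_intros simp flip: has_real_derivative_iff_has_vector_derivative)
  from has_vector_derivative_mult[OF this assms] show ?thesis by simp
qed

lemma Rellich_algebra:
  fixes X Y XX YY XY :: complex and s t :: real
  shows "(XX + YY) \<bullet> (2 *\<^sub>R (s *\<^sub>R X + t *\<^sub>R Y))
    = (s * ((X \<bullet> XX + XX \<bullet> X) - (Y \<bullet> XY + XY \<bullet> Y)) + (X \<bullet> X - Y \<bullet> Y) + (2 * t) * (X \<bullet> XY + XX \<bullet> Y))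
    + (t * ((Y \<bullet> YY + YY \<bullet> Y) - (X \<bullet> XY + XY \<bullet> X)) + (Y \<bullet> Y - X \<bullet> X) + (2 * s) * (X \<bullet> YY + XY \<bullet> Y))"
  by (simp add: inner_complex_def algebra_simps)

lemma multiplier_algebra:
  fixes V X Y :: complex and s t :: real
  shows "V \<bullet> (2 *\<^sub>R (s *\<^sub>R X + t *\<^sub>R Y))
    = (s * (V \<bullet> X + X \<bullet> V) + V \<bullet> V) + (t * (V \<bullet> Y + Y \<bullet> V) + V \<bullet> V) - 2 * (V \<bullet> V)"
  by (simp add: inner_complex_def algebra_simps)

text \<open>Rellich's identity: the vector field
  \<open>2 (m \<bullet> \<nabla>U) \<nabla>U - \<bar>\<nabla>U\<bar>\<^sup>2 m\<close> with \<open>m = (x - x\<^sub>0, y - y\<^sub>0)\<close> has divergence \<open>2 (m \<bullet> \<nabla>U) \<Delta>U\<close> in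
  the plane. Its flux is a square of the normal derivative with weight \<open>m \<bullet> n\<close>, which vanishes
  on the two sides through the corner \<open>(x\<^sub>0, y\<^sub>0)\<close>.\<close>
lemma Rellich_identity:
  assumes x0: "x0 \<in> {0, A}" and y0: "y0 \<in> {0, B}"
  shows "(\<integral>p. tsum sin sin (\<lambda>q. - of_real (lam q) * c q) N p \<bullet>
      (2 *\<^sub>R ((fst p - x0) *\<^sub>R tsum cos sin (dx c) N p + (snd p - y0) *\<^sub>R tsum sin cos (dy c) N p)) \<partial>M)
    = boundary_energy x0 y0 c N"
proof -
  let ?X = "tsum cos sin (dx c) N" and ?Y = "tsum sin cos (dy c) N"
  let ?XX = "tsum sin sin (\<lambda>q. - of_real (mx q) * dx c q) N" and ?YY = "tsum sin sin (\<lambda>q. - of_real (my q) * dy c q) N"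
  let ?XY = "tsum cos cos (dx (dy c)) N"
  have sym: "tsum cos cos (dy (dx c)) N = ?XY" by (simp add: mult.left_commute)
  have Xx: "((\<lambda>s. ?X (s, snd p)) has_vector_derivative ?XX p) (at (fst p))"
    and Xy: "((\<lambda>s. ?X (fst p, s)) has_vector_derivative ?XY p) (at (snd p))"
    and Yx: "((\<lambda>s. ?Y (s, snd p)) has_vector_derivative ?XY p) (at (fst p))"
    and Yy: "((\<lambda>s. ?Y (fst p, s)) has_vector_derivative ?YY p) (at (snd p))" for p
    using tsum_deriv_x[of cos sin "dx c" N p] tsum_deriv_x[of sin cos "dy c" N p]
    by (simp_all only: tsum_partials insertI1 insertI2 sym)
  have cont: "continuous_on UNIV ?X" "continuous_on UNIV ?Y" "continuous_on UNIV ?XX" "continuous_on UNIV ?YY" "continuous_on UNIV ?XY"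
    by (intro continuous_tsum; simp)+
  let ?W1 = "\<lambda>p. (fst p - x0) * (?X p \<bullet> ?X p - ?Y p \<bullet> ?Y p) + (2 * (snd p - y0)) * (?X p \<bullet> ?Y p)"
  let ?W2 = "\<lambda>p. (snd p - y0) * (?Y p \<bullet> ?Y p - ?X p \<bullet> ?X p) + (2 * (fst p - x0)) * (?X p \<bullet> ?Y p)"
  let ?D1 = "\<lambda>p. (fst p - x0) * ((?X p \<bullet> ?XX p + ?XX p \<bullet> ?X p) - (?Y p \<bullet> ?XY p + ?XY p \<bullet> ?Y p)) + (?X p \<bullet> ?X p - ?Y p \<bullet> ?Y p)
    + (2 * (snd p - y0)) * (?X p \<bullet> ?XY p + ?XX p \<bullet> ?Y p)"
  let ?D2 = "\<lambda>p. (snd p - y0) * ((?Y p \<bullet> ?YY p + ?YY p \<bullet> ?Y p) - (?X p \<bullet> ?XY p + ?XY p \<bullet> ?X p)) + (?Y p \<bullet> ?Y p - ?X p \<bullet> ?X p)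
    + (2 * (fst p - x0)) * ((?X p \<bullet> ?YY p + ?XY p \<bullet> ?Y p))"
  have D1: "((\<lambda>s. ?W1 (s, snd p)) has_vector_derivative ?D1 p) (at (fst p))" for p
    using has_vector_derivative_add[OF affine_mult_deriv[OF has_vector_derivative_diff[OF inner_deriv[OF Xx[of p] Xx[of p]] inner_deriv[OF Yx[of p] Yx[of p]]], of x0]
      bounded_linear.has_vector_derivative[OF bounded_linear_mult_right[of "2 * (snd p - y0)"] inner_deriv[OF Xx[of p] Yx[of p]]]]
    by (simp only: fst_conv snd_conv prod.collapse)
  have D2: "((\<lambda>s. ?W2 (fst p, s)) has_vector_derivative ?D2 p) (at (snd p))" for p
    using has_vector_derivative_add[OF affine_mult_deriv[OF has_vector_derivative_diff[OF inner_deriv[OF Yy[of p] Yy[of p]] inner_deriv[OF Xy[of p] Xy[of p]]], of y0]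
      bounded_linear.has_vector_derivative[OF bounded_linear_mult_right[of "2 * (fst p - x0)"] inner_deriv[OF Xy[of p] Yy[of p]]]]
    by (simp only: fst_conv snd_conv prod.collapse)
  have cD: "continuous_on UNIV ?D1" "continuous_on UNIV ?D2" by (intro continuous_intros cont)+
  have I1: "(\<integral>p. ?D1 p \<partial>M) = A * integral {0..B} (\<lambda>y. (cmod (?X (A - x0, y)))\<^sup>2)"
  proof -
    have "(\<integral>p. ?D1 p \<partial>M) = integral {0..B} (\<lambda>y. ?W1 (A, y) - ?W1 (0, y))"
      by (rule divergence_x[OF D1 cD(1)])
    also have "\<dots> = integral {0..B} (\<lambda>y. A * (cmod (?X (A - x0, y)))\<^sup>2)"
      using x0 by (intro arg_cong[where f="integral _"]) (auto simp: fun_eq_iff tsum_zero_x inner_self_cmod)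
    finally show ?thesis by simp
  qed
  have I2: "(\<integral>p. ?D2 p \<partial>M) = B * integral {0..A} (\<lambda>x. (cmod (?Y (x, B - y0)))\<^sup>2)"
  proof -
    have "(\<integral>p. ?D2 p \<partial>M) = integral {0..A} (\<lambda>x. ?W2 (x, B) - ?W2 (x, 0))"
      by (rule divergence_y[OF D2 cD(2)])
    also have "\<dots> = integral {0..A} (\<lambda>x. B * (cmod (?Y (x, B - y0)))\<^sup>2)"
      using y0 by (intro arg_cong[where f="integral _"]) (auto simp: fun_eq_iff tsum_zero_y inner_self_cmod)
    finally show ?thesis by simp
  qed
  have lap: "tsum sin sin (\<lambda>q. - of_real (lam q) * c q) N p = ?XX p + ?YY p" for p
    by (simp add: tsum_def sum.distrib[symmetric] lam_def power2_eq_square algebra_simps)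
  have eq: "(?XX p + ?YY p) \<bullet> (2 *\<^sub>R ((fst p - x0) *\<^sub>R ?X p + (snd p - y0) *\<^sub>R ?Y p)) = ?D1 p + ?D2 p" for p
    by (rule Rellich_algebra)
  show ?thesis
    unfolding lap eq boundary_energy_def I1[symmetric] I2[symmetric]
    by (rule Bochner_Integration.integral_add) (intro continuous_integrable cD)+
qed

text \<open>Here \<open>2 V (m \<bullet> \<nabla>V) = m \<bullet> \<nabla>\<bar>V\<bar>\<^sup>2\<close>, the divergence of \<open>m\<close> is two, and \<open>V\<close> vanishes on the boundary.\<close>
lemma multiplier_divergence:
  shows "(\<integral>p. tsum sin sin c N p \<bullet> (2 *\<^sub>R ((fst p - x0) *\<^sub>R tsum cos sin (dx c) N p + (snd p - y0) *\<^sub>R tsum sin cos (dy c) N p)) \<partial>M)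
    = - 2 * (L2_norm M (tsum sin sin c N))\<^sup>2"
proof -
  let ?V = "tsum sin sin c N" and ?X = "tsum cos sin (dx c) N" and ?Y = "tsum sin cos (dy c) N"
  have Vx: "((\<lambda>s. ?V (s, snd p)) has_vector_derivative ?X p) (at (fst p))"
    and Vy: "((\<lambda>s. ?V (fst p, s)) has_vector_derivative ?Y p) (at (snd p))" for p
    using tsum_deriv_x[of sin sin c N p] by (simp_all only: tsum_partials insertI1 insertI2)
  have cont: "continuous_on UNIV ?X" "continuous_on UNIV ?Y" "continuous_on UNIV ?V" by (intro continuous_tsum; simp)+
  let ?D1 = "\<lambda>p. (fst p - x0) * (?V p \<bullet> ?X p + ?X p \<bullet> ?V p) + ?V p \<bullet> ?V p"
  let ?D2 = "\<lambda>p. (snd p - y0) * (?V p \<bullet> ?Y p + ?Y p \<bullet> ?V p) + ?V p \<bullet> ?V p"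
  have c: "continuous_on UNIV ?D1" "continuous_on UNIV ?D2" "continuous_on UNIV (\<lambda>p. ?V p \<bullet> ?V p)"
    by (intro continuous_intros cont)+
  have "(\<integral>p. ?D1 p \<partial>M) = integral {0..B} (\<lambda>y. (fst (A, y) - x0) * (?V (A, y) \<bullet> ?V (A, y)) - (fst (0, y) - x0) * (?V (0, y) \<bullet> ?V (0, y)))"
  proof (rule divergence_x[OF _ c(1)])
    show "((\<lambda>s. (fst (s, snd p) - x0) * (?V (s, snd p) \<bullet> ?V (s, snd p))) has_vector_derivative ?D1 p) (at (fst p))" for p
      using affine_mult_deriv[OF inner_deriv[OF Vx[of p] Vx[of p]], of x0] by simp
  qed
  then have I1: "(\<integral>p. ?D1 p \<partial>M) = 0" by (simp add: tsum_zero_x)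
  have "(\<integral>p. ?D2 p \<partial>M) = integral {0..A} (\<lambda>x. (snd (x, B) - y0) * (?V (x, B) \<bullet> ?V (x, B)) - (snd (x, 0) - y0) * (?V (x, 0) \<bullet> ?V (x, 0)))"
  proof (rule divergence_y[OF _ c(2)])
    show "((\<lambda>s. (snd (fst p, s) - y0) * (?V (fst p, s) \<bullet> ?V (fst p, s))) has_vector_derivative ?D2 p) (at (snd p))" for p
      using affine_mult_deriv[OF inner_deriv[OF Vy[of p] Vy[of p]], of y0] by simp
  qed
  then have I2: "(\<integral>p. ?D2 p \<partial>M) = 0" by (simp add: tsum_zero_y)
  have eq: "?V p \<bullet> (2 *\<^sub>R ((fst p - x0) *\<^sub>R ?X p + (snd p - y0) *\<^sub>R ?Y p)) = ?D1 p + ?D2 p - 2 * (?V p \<bullet> ?V p)" for p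
    by (rule multiplier_algebra)
  have "(\<integral>p. ?D1 p + ?D2 p - 2 * (?V p \<bullet> ?V p) \<partial>M) = (\<integral>p. ?D1 p \<partial>M) + (\<integral>p. ?D2 p \<partial>M) - 2 * (\<integral>p. ?V p \<bullet> ?V p \<partial>M)"
    by (simp only: integral_mult_right_zero Bochner_Integration.integral_add[OF continuous_integrable[OF c(1)] continuous_integrable[OF c(2)]]
      Bochner_Integration.integral_diff[OF Bochner_Integration.integrable_add[OF continuous_integrable[OF c(1)] continuous_integrable[OF c(2)]]
        integrable_mult_right[OF continuous_integrable[OF c(3)]]])
  then show ?thesis unfolding eq I1 I2 by (simp add: L2_norm_sq inner_self_cmod)
qed

definition gradient_energy :: "(nat \<times> nat \<Rightarrow> complex) \<Rightarrow> nat \<Rightarrow> real" where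
  "gradient_energy c N = (L2_norm M (tsum cos sin (dx c) N))\<^sup>2 + (L2_norm M (tsum sin cos (dy c) N))\<^sup>2"

lemma gradient_energy_eq: "gradient_energy c N = \<kappa> * (\<Sum>q\<in>I N. lam q * (cmod (c q))\<^sup>2)"
  unfolding gradient_energy_def
  by (simp add: norm_tsum lam_def norm_mult power_mult_distrib distrib_right sum.distrib distrib_left)

lemma laplacian_inner:
  "(\<integral>p. tsum sin sin (\<lambda>q. - of_real (lam q) * c q) N p \<bullet> tsum sin sin c N p \<partial>M) = - gradient_energy c N"
proof -
  have int: "integrable M (\<lambda>x. mode sin sin p x * mode sin sin q x)" for p q
    by (intro continuous_integrable continuous_intros continuous_mode) auto
  have "(\<integral>p. tsum sin sin (\<lambda>q. - of_real (lam q) * c q) N p \<bullet> tsum sin sin c N p \<partial>M)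
      = (\<Sum>p\<in>I N. \<Sum>q\<in>I N. ((- of_real (lam p) * c p) \<bullet> c q) * (\<integral>x. mode sin sin p x * mode sin sin q x \<partial>M))"
    unfolding tsum_def by (rule inner_sums_integral(2)) (rule int)
  also have "\<dots> = (\<Sum>p\<in>I N. \<Sum>q\<in>I N. if p = q then ((- of_real (lam p) * c p) \<bullet> c q) * \<kappa> else 0)"
  proof (intro sum.cong refl)
    fix p q assume "p \<in> I N" "q \<in> I N"
    then have "p \<in> J" "q \<in> J" using I_props(2) by blast+
    then have "(\<integral>x. mode sin sin p x * mode sin sin q x \<partial>M) = (if p = q then \<kappa> else 0)"
      by (intro integral_mode_mult) auto
    then show "((- of_real (lam p) * c p) \<bullet> c q) * (\<integral>x. mode sin sin p x * mode sin sin q x \<partial>M)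
        = (if p = q then ((- of_real (lam p) * c p) \<bullet> c q) * \<kappa> else 0)" by simp
  qed
  also have "\<dots> = (\<Sum>p\<in>I N. - (lam p * (cmod (c p))\<^sup>2 * \<kappa>))"
  proof (rule sum.cong[OF refl])
    fix p assume "p \<in> I N"
    moreover have "(- of_real (lam p) * c p) \<bullet> c p = - (lam p * (cmod (c p))\<^sup>2)"
      by (simp add: scaleR_conv_of_real[symmetric] inner_self_cmod)
    ultimately show "(\<Sum>q\<in>I N. if p = q then ((- of_real (lam p) * c p) \<bullet> c q) * \<kappa> else 0) = - (lam p * (cmod (c p))\<^sup>2 * \<kappa>)"
      using I_props(1)[of N] by simp
  qed
  also have "\<dots> = - gradient_energy c N"
    by (simp add: gradient_energy_eq sum_distrib_left sum_negf mult_ac)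
  finally show ?thesis .
qed

end

section \<open>Observability of sine polynomial solutions\<close>

context rect begin

definition energy :: "(nat \<times> nat \<Rightarrow> complex) \<Rightarrow> (nat \<times> nat \<Rightarrow> complex) \<Rightarrow> nat \<Rightarrow> real" where
  "energy c d N = gradient_energy c N + (L2_norm M (tsum sin sin d N))\<^sup>2"

text \<open>The multiplier \<open>2 m \<bullet> \<nabla> + 1\<close> applied to a sine mode. The summand \<open>1\<close> balances the two parts of the
  energy: with \<open>2 m \<bullet> \<nabla>\<close> alone only the kinetic part would appear in the derivative of the multiplier form.\<close>
definition multiplier_mode :: "real \<Rightarrow> real \<Rightarrow> nat \<times> nat \<Rightarrow> real \<times> real \<Rightarrow> real" where
  "multiplier_mode x0 y0 q p = 2 * ((fst p - x0) * (mx q * mode cos sin q p) + (snd p - y0) * (my q * mode sin cos q p)) + mode sin sin q p"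

definition multiplier_form :: "real \<Rightarrow> real \<Rightarrow> (nat \<times> nat \<Rightarrow> complex) \<Rightarrow> (nat \<times> nat \<Rightarrow> complex) \<Rightarrow> nat \<Rightarrow> real" where
  "multiplier_form x0 y0 d c N = (\<Sum>p\<in>I N. \<Sum>q\<in>I N. (d p \<bullet> c q) * (\<integral>x. mode sin sin p x * multiplier_mode x0 y0 q x \<partial>M))"

lemma multiplier_form_eq:
  "multiplier_form x0 y0 d c N = (\<integral>p. tsum sin sin d N p \<bullet>
     (2 *\<^sub>R ((fst p - x0) *\<^sub>R tsum cos sin (dx c) N p + (snd p - y0) *\<^sub>R tsum sin cos (dy c) N p)) \<partial>M)
   + (\<integral>p. tsum sin sin d N p \<bullet> tsum sin sin c N p \<partial>M)"
proof -
  have int: "integrable M (\<lambda>x. mode sin sin p x * multiplier_mode x0 y0 q x)" for p q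
    unfolding multiplier_mode_def by (intro continuous_integrable continuous_intros continuous_mode) auto
  have cont: "continuous_on UNIV (tsum sin sin d N)" "continuous_on UNIV (tsum sin sin c N)"
    "continuous_on UNIV (tsum cos sin (dx c) N)" "continuous_on UNIV (tsum sin cos (dy c) N)"
    by (intro continuous_tsum; simp)+
  have eq: "(\<Sum>q\<in>I N. c q * complex_of_real (multiplier_mode x0 y0 q p)) =
    2 *\<^sub>R ((fst p - x0) *\<^sub>R tsum cos sin (dx c) N p + (snd p - y0) *\<^sub>R tsum sin cos (dy c) N p) + tsum sin sin c N p" for p
    by (simp add: tsum_def multiplier_mode_def scaleR_conv_of_real sum_distrib_left sum.distrib sum_subtractf algebra_simps)
  have "multiplier_form x0 y0 d c N = (\<integral>p. (\<Sum>p'\<in>I N. d p' * of_real (mode sin sin p' p)) \<bullet> (\<Sum>q\<in>I N. c q * of_real (multiplier_mode x0 y0 q p)) \<partial>M)"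
    unfolding multiplier_form_def by (rule inner_sums_integral(2)[symmetric]) (rule int)
  also have "\<dots> = (\<integral>p. tsum sin sin d N p \<bullet> (2 *\<^sub>R ((fst p - x0) *\<^sub>R tsum cos sin (dx c) N p + (snd p - y0) *\<^sub>R tsum sin cos (dy c) N p))
      + tsum sin sin d N p \<bullet> tsum sin sin c N p \<partial>M)"
    unfolding eq by (simp add: tsum_def[of sin sin d] inner_add_right)
  also have "\<dots> = (\<integral>p. tsum sin sin d N p \<bullet>
     (2 *\<^sub>R ((fst p - x0) *\<^sub>R tsum cos sin (dx c) N p + (snd p - y0) *\<^sub>R tsum sin cos (dy c) N p)) \<partial>M)
   + (\<integral>p. tsum sin sin d N p \<bullet> tsum sin sin c N p \<partial>M)"
    by (rule Bochner_Integration.integral_add) (intro continuous_integrable continuous_intros cont)+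
  finally show ?thesis .
qed

text \<open>On the rectangle \<open>\<bar>x - x\<^sub>0\<bar> \<le> A\<close> and \<open>\<bar>y - y\<^sub>0\<bar> \<le> B\<close>, which takes care of the first order part. The
  zeroth order part needs Poincare's inequality, which for sine series only says that all frequencies \<open>mx\<close> are at
  least \<open>1/a\<close>.\<close>
lemma multiplier_form_bound:
  assumes x0: "x0 \<in> {0, A}" and y0: "y0 \<in> {0, B}"
  shows "\<bar>multiplier_form x0 y0 d c N\<bar> \<le> 2 * (A + B) * energy c d N"
proof -
  let ?V = "tsum sin sin d N" and ?U = "tsum sin sin c N" and ?X = "tsum cos sin (dx c) N" and ?Y = "tsum sin cos (dy c) N"
  let ?nV = "(L2_norm M ?V)\<^sup>2" and ?nU = "(L2_norm M ?U)\<^sup>2" and ?nX = "(L2_norm M ?X)\<^sup>2" and ?nY = "(L2_norm M ?Y)\<^sup>2"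
  have cont: "continuous_on UNIV ?V" "continuous_on UNIV ?U" "continuous_on UNIV ?X" "continuous_on UNIV ?Y"
    by (intro continuous_tsum; simp)+
  have sq: "integrable M (\<lambda>p. (cmod (?V p))\<^sup>2)" "integrable M (\<lambda>p. (cmod (?U p))\<^sup>2)" "integrable M (\<lambda>p. (cmod (?X p))\<^sup>2)" "integrable M (\<lambda>p. (cmod (?Y p))\<^sup>2)"
    by (intro L2_integrable_sq continuous_L2 cont)+
  have in2: "\<bar>2 * (z \<bullet> w)\<bar> \<le> (cmod z)\<^sup>2 + (cmod w)\<^sup>2" for z w :: complex
    using Cauchy_Schwarz_ineq2[of z w] sum_squares_bound[of "cmod z" "cmod w"] by simp
  have w2: "\<bar>s * (2 * (z \<bullet> w))\<bar> \<le> L * ((cmod z)\<^sup>2 + (cmod w)\<^sup>2)" if "\<bar>s\<bar> \<le> L" for s L and z w :: complex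
    unfolding abs_mult[of s] using that in2[of z w] by (intro mult_mono) auto
  have "\<bar>\<integral>p. ?V p \<bullet> (2 *\<^sub>R ((fst p - x0) *\<^sub>R ?X p + (snd p - y0) *\<^sub>R ?Y p)) \<partial>M\<bar>
      \<le> (\<integral>p. \<bar>?V p \<bullet> (2 *\<^sub>R ((fst p - x0) *\<^sub>R ?X p + (snd p - y0) *\<^sub>R ?Y p))\<bar> \<partial>M)"
    by (rule integral_abs_bound)
  also have "\<dots> \<le> (\<integral>p. A * ((cmod (?V p))\<^sup>2 + (cmod (?X p))\<^sup>2) + B * ((cmod (?V p))\<^sup>2 + (cmod (?Y p))\<^sup>2) \<partial>M)"
  proof (rule integral_mono)
    show "integrable M (\<lambda>p. \<bar>?V p \<bullet> (2 *\<^sub>R ((fst p - x0) *\<^sub>R ?X p + (snd p - y0) *\<^sub>R ?Y p))\<bar>)"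
      "integrable M (\<lambda>p. A * ((cmod (?V p))\<^sup>2 + (cmod (?X p))\<^sup>2) + B * ((cmod (?V p))\<^sup>2 + (cmod (?Y p))\<^sup>2))"
      by (intro continuous_integrable continuous_intros cont)+
    fix p assume "p \<in> space M"
    then have "\<bar>fst p - x0\<bar> \<le> A" "\<bar>snd p - y0\<bar> \<le> B" using x0 y0 by (auto simp: rectangle_eq)
    from w2[OF this(1), of "?V p" "?X p"] w2[OF this(2), of "?V p" "?Y p"]
    have "\<bar>(fst p - x0) * (2 * (?V p \<bullet> ?X p)) + (snd p - y0) * (2 * (?V p \<bullet> ?Y p))\<bar>
      \<le> A * ((cmod (?V p))\<^sup>2 + (cmod (?X p))\<^sup>2) + B * ((cmod (?V p))\<^sup>2 + (cmod (?Y p))\<^sup>2)"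
      by linarith
    then show "\<bar>?V p \<bullet> (2 *\<^sub>R ((fst p - x0) *\<^sub>R ?X p + (snd p - y0) *\<^sub>R ?Y p))\<bar>
      \<le> A * ((cmod (?V p))\<^sup>2 + (cmod (?X p))\<^sup>2) + B * ((cmod (?V p))\<^sup>2 + (cmod (?Y p))\<^sup>2)"
      by (simp add: inner_add_right algebra_simps)
  qed
  also have "\<dots> = A * (?nV + ?nX) + B * (?nV + ?nY)"
    using sq by (simp add: L2_norm_sq)
  finally have 1: "\<bar>\<integral>p. ?V p \<bullet> (2 *\<^sub>R ((fst p - x0) *\<^sub>R ?X p + (snd p - y0) *\<^sub>R ?Y p)) \<partial>M\<bar> \<le> A * (?nV + ?nX) + B * (?nV + ?nY)" .
  have "\<bar>\<integral>p. ?V p \<bullet> ?U p \<partial>M\<bar> \<le> (\<integral>p. \<bar>?V p \<bullet> ?U p\<bar> \<partial>M)"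
    by (rule integral_abs_bound)
  also have "\<dots> \<le> (\<integral>p. A * (cmod (?V p))\<^sup>2 + (cmod (?U p))\<^sup>2 / A \<partial>M)"
  proof (rule integral_mono)
    show "integrable M (\<lambda>p. \<bar>?V p \<bullet> ?U p\<bar>)" "integrable M (\<lambda>p. A * (cmod (?V p))\<^sup>2 + (cmod (?U p))\<^sup>2 / A)"
      using A_pos by (intro continuous_integrable continuous_intros cont; simp)+
    fix p
    have "2 * (sqrt A * cmod (?V p)) * (cmod (?U p) / sqrt A) \<le> (sqrt A * cmod (?V p))\<^sup>2 + (cmod (?U p) / sqrt A)\<^sup>2"
      by (rule sum_squares_bound)
    then have "2 * (cmod (?V p) * cmod (?U p)) \<le> A * (cmod (?V p))\<^sup>2 + (cmod (?U p))\<^sup>2 / A"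
      using A_pos by (simp add: power_mult_distrib power_divide)
    moreover have "0 \<le> cmod (?V p) * cmod (?U p)" by simp
    ultimately show "\<bar>?V p \<bullet> ?U p\<bar> \<le> A * (cmod (?V p))\<^sup>2 + (cmod (?U p))\<^sup>2 / A"
      using Cauchy_Schwarz_ineq2[of "?V p" "?U p"] by linarith
  qed
  also have "\<dots> = A * ?nV + ?nU / A" using sq by (simp add: L2_norm_sq)
  also have "?nU / A \<le> A * ?nX"
  proof -
    have "?nU = \<kappa> * (\<Sum>q\<in>I N. (cmod (c q))\<^sup>2)" by (rule norm_tsum) auto
    also have "\<dots> \<le> \<kappa> * (\<Sum>q\<in>I N. A\<^sup>2 * (cmod (dx c q))\<^sup>2)"
    proof (intro mult_left_mono sum_mono)
      fix q assume "q \<in> I N"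
      then have "q \<in> J" using I_props(2) by blast
      have "1 \<le> pi" using pi_gt3 by linarith
      then have "a * mx q \<le> A * mx q" unfolding A_def using a_pos freq_nonneg(1)[of q] by (intro mult_right_mono) auto
      then have "1 \<le> A * mx q" using freq_ge(1)[OF \<open>q \<in> J\<close>] by linarith
      then have "1 * cmod (c q) \<le> (A * mx q) * cmod (c q)" by (intro mult_right_mono) auto
      then have "(cmod (c q))\<^sup>2 \<le> ((A * mx q) * cmod (c q))\<^sup>2" by (intro power_mono) auto
      then show "(cmod (c q))\<^sup>2 \<le> A\<^sup>2 * (cmod (dx c q))\<^sup>2" by (simp add: norm_mult power_mult_distrib)
    qed (use kappa_pos in simp)
    also have "\<dots> = A\<^sup>2 * (\<kappa> * (\<Sum>q\<in>I N. (cmod (dx c q))\<^sup>2))" by (simp add: sum_distrib_left mult_ac)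
    also have "\<kappa> * (\<Sum>q\<in>I N. (cmod (dx c q))\<^sup>2) = ?nX" by (rule norm_tsum[symmetric]) auto
    finally show ?thesis using A_pos by (simp add: divide_le_eq power2_eq_square mult_ac)
  qed
  finally have 2: "\<bar>\<integral>p. ?V p \<bullet> ?U p \<partial>M\<bar> \<le> A * ?nV + A * ?nX" by simp
  have "\<bar>multiplier_form x0 y0 d c N\<bar> \<le> A * (?nV + ?nX) + B * (?nV + ?nY) + (A * ?nV + A * ?nX)"
    unfolding multiplier_form_eq using 1 2 by linarith
  also have "\<dots> \<le> 2 * (A + B) * energy c d N"
    using A_pos B_pos by (simp add: energy_def gradient_energy_def algebra_simps)
  finally show ?thesis .
qed

text \<open>The derivative of the multiplier form along a solution is the boundary energy minus the energy. Integrated over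
  \<open>[0, T]\<close>, the values at the two end points cost at most \<open>2 (A + B)\<close> energies each.\<close>
lemma finite_observability:
  assumes x0: "x0 \<in> {0, A}" and y0: "y0 \<in> {0, B}" and T: "T \<ge> 0"
    and dc: "\<And>q t. t \<in> {0..T} \<Longrightarrow> ((\<lambda>s. c s q) has_vector_derivative d t q) (at t within {0..T})"
    and dd: "\<And>q t. t \<in> {0..T} \<Longrightarrow> ((\<lambda>s. d s q) has_vector_derivative - of_real (lam q) * c t q) (at t within {0..T})"
  shows "(\<lambda>t. boundary_energy x0 y0 (c t) N) integrable_on {0..T}"
    and "(T - 4 * (A + B)) * energy (c 0) (d 0) N \<le> integral {0..T} (\<lambda>t. boundary_energy x0 y0 (c t) N)"
proof -
  have inner': "((\<lambda>s. u s \<bullet> v s) has_vector_derivative u t \<bullet> v' + u' \<bullet> v t) (at t within {0..T})"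
    if "(u has_vector_derivative u') (at t within {0..T})" "(v has_vector_derivative v') (at t within {0..T})"
    for u v :: "real \<Rightarrow> complex" and u' v' t
    using bounded_bilinear.has_vector_derivative[OF bounded_bilinear_inner that] .
  have energy_eq: "energy (c t) (d t) N = \<kappa> * (\<Sum>q\<in>I N. lam q * (c t q \<bullet> c t q) + d t q \<bullet> d t q)" for t
  proof -
    have "(L2_norm M (tsum sin sin (d t) N))\<^sup>2 = \<kappa> * (\<Sum>q\<in>I N. (cmod (d t q))\<^sup>2)" by (rule norm_tsum) auto
    then show ?thesis by (simp add: energy_def gradient_energy_eq inner_self_cmod sum.distrib distrib_left)
  qed
  have dE: "((\<lambda>t. energy (c t) (d t) N) has_derivative (\<lambda>h. 0)) (at t within {0..T})" if t: "t \<in> {0..T}" for t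
  proof -
    have "((\<lambda>t. \<kappa> * (\<Sum>q\<in>I N. lam q * (c t q \<bullet> c t q) + d t q \<bullet> d t q)) has_vector_derivative
      \<kappa> * (\<Sum>q\<in>I N. lam q * (c t q \<bullet> d t q + d t q \<bullet> c t q) + (d t q \<bullet> (- of_real (lam q) * c t q) + (- of_real (lam q) * c t q) \<bullet> d t q))) (at t within {0..T})"
      by (intro bounded_linear.has_vector_derivative[OF bounded_linear_mult_right] has_vector_derivative_sum has_vector_derivative_add inner' dc dd t)
    also have "(\<Sum>q\<in>I N. lam q * (c t q \<bullet> d t q + d t q \<bullet> c t q) + (d t q \<bullet> (- of_real (lam q) * c t q) + (- of_real (lam q) * c t q) \<bullet> d t q)) = 0"
      by (rule sum.neutral) (simp add: inner_complex_def algebra_simps)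
    finally show ?thesis unfolding energy_eq by (simp add: has_vector_derivative_def)
  qed
  obtain e where e: "\<And>t. t \<in> {0..T} \<Longrightarrow> energy (c t) (d t) N = e"
    using has_derivative_zero_constant[OF _ dE] by auto
  let ?\<Xi> = "\<lambda>t. multiplier_form x0 y0 (d t) (c t) N"
  have dXi: "(?\<Xi> has_vector_derivative boundary_energy x0 y0 (c t) N - e) (at t within {0..T})" if t: "t \<in> {0..T}" for t
  proof -
    let ?G = "\<lambda>p q. \<integral>x. mode sin sin p x * multiplier_mode x0 y0 q x \<partial>M"
    have "(?\<Xi> has_vector_derivative (\<Sum>p\<in>I N. \<Sum>q\<in>I N. (d t p \<bullet> d t q + (- of_real (lam p) * c t p) \<bullet> c t q) * ?G p q)) (at t within {0..T})"
      unfolding multiplier_form_def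
      by (intro has_vector_derivative_sum bounded_linear.has_vector_derivative[OF bounded_linear_mult_left] inner' dc dd t)
    also have "(\<Sum>p\<in>I N. \<Sum>q\<in>I N. (d t p \<bullet> d t q + (- of_real (lam p) * c t p) \<bullet> c t q) * ?G p q)
      = multiplier_form x0 y0 (d t) (d t) N + multiplier_form x0 y0 (\<lambda>q. - of_real (lam q) * c t q) (c t) N"
      unfolding multiplier_form_def by (simp only: distrib_right sum.distrib)
    also have "\<dots> = boundary_energy x0 y0 (c t) N - energy (c t) (d t) N"
      unfolding multiplier_form_eq multiplier_divergence Rellich_identity[OF x0 y0] laplacian_inner
      by (simp add: energy_def inner_self_cmod L2_norm_sq)
    also have "energy (c t) (d t) N = e" by (rule e[OF t])
    finally show ?thesis .
  qed
  have FTC: "((\<lambda>t. boundary_energy x0 y0 (c t) N - e) has_integral (?\<Xi> T - ?\<Xi> 0)) {0..T}"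
    by (rule fundamental_theorem_of_calculus[OF T dXi])
  have const: "((\<lambda>t. e) has_integral T * e) {0..T}"
    using has_integral_const_real[of e 0 T] T by simp
  have "((\<lambda>t. boundary_energy x0 y0 (c t) N - e + e) has_integral (?\<Xi> T - ?\<Xi> 0 + T * e)) {0..T}"
    by (rule has_integral_add[OF FTC const])
  then have I: "((\<lambda>t. boundary_energy x0 y0 (c t) N) has_integral (?\<Xi> T - ?\<Xi> 0 + T * e)) {0..T}" by simp
  then show "(\<lambda>t. boundary_energy x0 y0 (c t) N) integrable_on {0..T}" by blast
  have "\<bar>?\<Xi> T\<bar> \<le> 2 * (A + B) * e" "\<bar>?\<Xi> 0\<bar> \<le> 2 * (A + B) * e"
    using multiplier_form_bound[OF x0 y0, of "d T" "c T" N] multiplier_form_bound[OF x0 y0, of "d 0" "c 0" N] e[of T] e[of 0] T by auto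
  then have "(T - 4 * (A + B)) * e \<le> ?\<Xi> T - ?\<Xi> 0 + T * e"
    unfolding left_diff_distrib by linarith
  then show "(T - 4 * (A + B)) * energy (c 0) (d 0) N \<le> integral {0..T} (\<lambda>t. boundary_energy x0 y0 (c t) N)"
    using integral_unique[OF I] e[of 0] T by simp
qed

lemma normal_sum_on_sides:
  shows "0 < s \<Longrightarrow> s < A \<Longrightarrow> cmod (normal_sum c N (s, 0)) = cmod (tsum sin cos (dy c) N (s, 0))"
    "0 < s \<Longrightarrow> s < A \<Longrightarrow> cmod (normal_sum c N (s, B)) = cmod (tsum sin cos (dy c) N (s, B))"
    "cmod (normal_sum c N (A, s)) = cmod (tsum cos sin (dx c) N (A, s))"
    "cmod (normal_sum c N (0, s)) = cmod (tsum cos sin (dx c) N (0, s))"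
  using A_pos B_pos by (auto simp: normal_sum_eq outward_normal_def A_def[symmetric])

lemma restricted_normal_sum_L2:
  assumes "\<Gamma> \<in> sets borel"
  shows "f \<in> L2 \<sigma> \<Longrightarrow> (\<lambda>p. indicator \<Gamma> p * f p) \<in> L2 \<sigma>"
  by (rule L2_mult_bounded[where B=1]) (use assms in \<open>auto simp: indicator_def\<close>)

text \<open>The weights \<open>A\<close> and \<open>B\<close> of the two sides are both at most \<open>A + B\<close>.\<close>
lemma boundary_energy_le_observation:
  assumes \<Gamma>: "\<Gamma> \<in> sets borel" and x0: "x0 \<in> {0, A}" and y0: "y0 \<in> {0, B}"
    and sides: "{0<..<A} \<times> {B - y0} \<subseteq> \<Gamma>" "{A - x0} \<times> {0<..<B} \<subseteq> \<Gamma>"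
  shows "boundary_energy x0 y0 c N \<le> (A + B) * (L2_norm \<sigma> (\<lambda>p. indicator \<Gamma> p * normal_sum c N p))\<^sup>2"
proof -
  let ?X = "tsum cos sin (dx c) N" and ?Y = "tsum sin cos (dy c) N"
  let ?g = "\<lambda>p. (cmod (indicator \<Gamma> p * normal_sum c N p))\<^sup>2"
  have cont: "continuous_on UNIV ?X" "continuous_on UNIV ?Y" by (intro continuous_tsum; simp)+
  have cX: "continuous_on UNIV (\<lambda>s. (cmod (?X (r, s)))\<^sup>2)" and cY: "continuous_on UNIV (\<lambda>s. (cmod (?Y (s, r)))\<^sup>2)" for r
    by (auto intro!: continuous_intros continuous_on_compose2[OF cont(1)] continuous_on_compose2[OF cont(2)])
  obtain K1 K2 where K: "\<And>p. p \<in> cbox (0, 0) (A, B) \<Longrightarrow> cmod (?X p) \<le> K1" "\<And>p. p \<in> cbox (0, 0) (A, B) \<Longrightarrow> cmod (?Y p) \<le> K2"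
    using continuous_bounded[OF cont(1)] continuous_bounded[OF cont(2)] by metis
  have meas: "?g \<in> borel_measurable borel"
    using L2_measurable[OF restricted_normal_sum_L2[OF \<Gamma> normal_sum_L2[of c N]]] by simp
  have gK: "\<bar>?g p\<bar> \<le> (K1 + K2)\<^sup>2" if p: "p \<in> cbox (0, 0) (A, B)" for p
  proof -
    have "cmod (indicator \<Gamma> p * normal_sum c N p) \<le> cmod (normal_sum c N p)"
      by (simp add: norm_mult indicator_def)
    also have "\<dots> \<le> \<bar>fst (outward_normal a b p)\<bar> * cmod (?X p) + \<bar>snd (outward_normal a b p)\<bar> * cmod (?Y p)"
      unfolding normal_sum_eq by (rule norm_triangle_le) (simp add: norm_mult)
    also have "\<dots> \<le> 1 * K1 + 1 * K2"
      by (intro add_mono mult_mono outward_normal_bounded K p) auto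
    finally have "?g p \<le> (K1 + K2)\<^sup>2" by (intro power_mono) auto
    then show ?thesis by simp
  qed
  have norm_eq: "(L2_norm \<sigma> (\<lambda>p. indicator \<Gamma> p * normal_sum c N p))\<^sup>2 = edge_integral ?g"
    unfolding L2_norm_sq by (rule boundary_integral(2)[OF meas gK])
  have nn: "0 \<le> (\<integral>s. indicator S s * ?g (f s) \<partial>lborel)" for S and f :: "real \<Rightarrow> real \<times> real"
    by (rule Bochner_Integration.integral_nonneg) simp
  have V: "integral {0..B} (\<lambda>y. (cmod (?X (A - x0, y)))\<^sup>2) = (\<integral>s. indicator {0<..<B} s * ?g (A - x0, s) \<partial>lborel)"
  proof -
    have "indicator {0<..<B} s * (cmod (?X (A - x0, s)))\<^sup>2 = indicator {0<..<B} s * ?g (A - x0, s)" for s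
    proof (cases "s \<in> {0<..<B}")
      case True
      then have "(A - x0, s) \<in> \<Gamma>" using sides(2) by auto
      moreover have "cmod (normal_sum c N (A - x0, s)) = cmod (?X (A - x0, s))"
        using x0 normal_sum_on_sides(3,4)[of c N s] by auto
      ultimately show ?thesis by (simp add: norm_mult)
    qed simp
    then show ?thesis by (simp only: integral_open_interval_eq[OF cX, symmetric])
  qed
  have H: "integral {0..A} (\<lambda>x. (cmod (?Y (x, B - y0)))\<^sup>2) = (\<integral>s. indicator {0<..<A} s * ?g (s, B - y0) \<partial>lborel)"
  proof -
    have "indicator {0<..<A} s * (cmod (?Y (s, B - y0)))\<^sup>2 = indicator {0<..<A} s * ?g (s, B - y0)" for s
    proof (cases "s \<in> {0<..<A}")
      case True
      then have "(s, B - y0) \<in> \<Gamma>" using sides(1) by auto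
      moreover have "cmod (normal_sum c N (s, B - y0)) = cmod (?Y (s, B - y0))"
        using y0 True normal_sum_on_sides(1,2)[of s c N] by auto
      ultimately show ?thesis by (simp add: norm_mult)
    qed simp
    then show ?thesis by (simp only: integral_open_interval_eq[OF cY, symmetric])
  qed
  have "integral {0..B} (\<lambda>y. (cmod (?X (A - x0, y)))\<^sup>2) + integral {0..A} (\<lambda>x. (cmod (?Y (x, B - y0)))\<^sup>2) \<le> edge_integral ?g"
    unfolding V H edge_integral_def using x0 y0
      nn[of "{0<..<A}" "\<lambda>s. (s, 0)"] nn[of "{0<..<A}" "\<lambda>s. (s, B)"] nn[of "{0<..<B}" "\<lambda>s. (A, s)"] nn[of "{0<..<B}" "\<lambda>s. (0, s)"]
    by auto
  moreover have nV: "0 \<le> integral {0..B} (\<lambda>y. (cmod (?X (A - x0, y)))\<^sup>2)" unfolding V by (rule nn)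
  moreover have nH: "0 \<le> integral {0..A} (\<lambda>x. (cmod (?Y (x, B - y0)))\<^sup>2)" unfolding H by (rule nn)
  ultimately have "(A + B) * (integral {0..B} (\<lambda>y. (cmod (?X (A - x0, y)))\<^sup>2) + integral {0..A} (\<lambda>x. (cmod (?Y (x, B - y0)))\<^sup>2)) \<le> (A + B) * edge_integral ?g"
    using A_pos B_pos by (intro mult_left_mono) auto
  moreover have "boundary_energy x0 y0 c N \<le> (A + B) * (integral {0..B} (\<lambda>y. (cmod (?X (A - x0, y)))\<^sup>2) + integral {0..A} (\<lambda>x. (cmod (?Y (x, B - y0)))\<^sup>2))"
    unfolding boundary_energy_def using A_pos B_pos nV nH by (simp add: algebra_simps)
  ultimately show ?thesis unfolding norm_eq by linarith
qed

text \<open>For a sine polynomial the observation is a quadratic form in the coefficients. The general observation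
  inherits measurability in time from this.\<close>
lemma observation_continuous:
  assumes \<Gamma>: "\<Gamma> \<in> sets borel" and c: "\<And>q. continuous_on S (\<lambda>t. c t q)"
  shows "continuous_on S (\<lambda>t. (L2_norm \<sigma> (\<lambda>p. indicator \<Gamma> p * normal_sum (c t) N p))\<^sup>2)"
proof -
  let ?\<beta> = "\<lambda>q p. indicator \<Gamma> p * normal_mode q p"
  have mode_meas: "(\<lambda>p. mode f g q p) \<in> borel_measurable borel" if "f \<in> {sin, cos}" "g \<in> {sin, cos}" for f g q
    by (rule borel_measurable_continuous_onI[OF continuous_mode[OF that]])
  have [measurable]: "?\<beta> q \<in> borel_measurable borel" for q
    unfolding normal_mode_def using \<Gamma> outward_normal_measurable mode_meas[of cos sin] mode_meas[of sin cos] by measurable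
  have b: "\<bar>?\<beta> q p\<bar> \<le> mx q + my q" for q p
  proof -
    have "\<bar>?\<beta> q p\<bar> \<le> \<bar>normal_mode q p\<bar>" by (simp add: indicator_def)
    also have "\<dots> \<le> \<bar>fst (outward_normal a b p)\<bar> * (mx q * \<bar>mode cos sin q p\<bar>) + \<bar>snd (outward_normal a b p)\<bar> * (my q * \<bar>mode sin cos q p\<bar>)"
      unfolding normal_mode_def by (rule order_trans[OF abs_triangle_ineq]) (simp add: abs_mult freq_nonneg)
    also have "\<dots> \<le> 1 * (mx q * 1) + 1 * (my q * 1)"
      by (intro add_mono mult_mono outward_normal_bounded mode_bounded) (auto simp: freq_nonneg)
    finally show ?thesis by simp
  qed
  interpret finite_measure \<sigma> by (rule finite_boundary_measure)
  have int: "integrable \<sigma> (\<lambda>p. ?\<beta> q p * ?\<beta> r p)" for q r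
  proof (rule integrable_const_bound[where B="(mx q + my q) * (mx r + my r)"])
    show "AE p in \<sigma>. norm (?\<beta> q p * ?\<beta> r p) \<le> (mx q + my q) * (mx r + my r)"
    proof (rule AE_I2)
      show "norm (?\<beta> q p * ?\<beta> r p) \<le> (mx q + my q) * (mx r + my r)" for p
        unfolding real_norm_def abs_mult[of "?\<beta> q p"] by (intro mult_mono b) (auto simp: freq_nonneg)
    qed
  qed simp
  have "(L2_norm \<sigma> (\<lambda>p. indicator \<Gamma> p * normal_sum (c t) N p))\<^sup>2
      = (\<Sum>q\<in>I N. \<Sum>r\<in>I N. (c t q \<bullet> c t r) * (\<integral>p. ?\<beta> q p * ?\<beta> r p \<partial>\<sigma>))" for t
  proof -
    have "indicator \<Gamma> p * normal_sum (c t) N p = (\<Sum>q\<in>I N. c t q * of_real (?\<beta> q p))" for p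
      by (simp add: normal_sum_def sum_distrib_left indicator_def)
    then show ?thesis
      unfolding L2_norm_sq inner_self_cmod[symmetric] by (simp only: inner_sums_integral(2)[OF int])
  qed
  then show ?thesis by (simp only:) (intro continuous_intros c)
qed

end

section \<open>Solutions of the wave equation\<close>

lemma has_vector_derivative_iff_quotient:
  fixes f :: "real \<Rightarrow> 'a::real_normed_vector"
  shows "(f has_vector_derivative D) (at t within S) \<longleftrightarrow>
    ((\<lambda>s. norm ((f s - f t) /\<^sub>R (s - t) - D)) \<longlongrightarrow> 0) (at t within S)"
proof -
  have "norm ((f s - f t) - (s - t) *\<^sub>R D) / norm (s - t) = norm ((f s - f t) /\<^sub>R (s - t) - D)" if "s \<noteq> t" for s
  proof -
    have "(f s - f t) /\<^sub>R (s - t) - D = ((f s - f t) - (s - t) *\<^sub>R D) /\<^sub>R (s - t)"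
      using that by (simp add: scaleR_diff_right)
    then show ?thesis by (simp add: divide_inverse mult.commute)
  qed
  then have ev: "\<forall>\<^sub>F s in at t within S. norm ((f s - f t) - (s - t) *\<^sub>R D) / norm (s - t) = norm ((f s - f t) /\<^sub>R (s - t) - D)"
    by (auto simp: eventually_at_filter)
  show ?thesis
    unfolding has_vector_derivative_def has_derivative_iff_norm
    using tendsto_cong[OF ev] by (simp add: bounded_linear_scaleR_left)
qed

context rect begin

lemma fc_quotient:
  assumes "f \<in> L2 M" "g \<in> L2 M" "h \<in> L2 M"
  shows "(\<lambda>x. (f x - g x) /\<^sub>R r - h x) \<in> L2 M"
    and "fc (\<lambda>x. (f x - g x) /\<^sub>R r - h x) q = (fc f q - fc g q) /\<^sub>R r - fc h q"
proof -
  have e: "(f x - g x) /\<^sub>R r = of_real (inverse r) * (f x - g x)" for x by (simp add: scaleR_conv_of_real)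
  have L: "(\<lambda>x. of_real (inverse r) * (f x - g x)) \<in> L2 M" by (intro L2_mult_const L2_diff assms)
  show "(\<lambda>x. (f x - g x) /\<^sub>R r - h x) \<in> L2 M" unfolding e by (rule L2_diff[OF L assms(3)])
  show "fc (\<lambda>x. (f x - g x) /\<^sub>R r - h x) q = (fc f q - fc g q) /\<^sub>R r - fc h q"
    unfolding e fc_diff[OF L assms(3)] fc_mult_const fc_diff[OF assms(1,2)] by (simp add: scaleR_conv_of_real)
qed

lemma fc_has_derivative:
  assumes u: "\<And>t. t \<ge> 0 \<Longrightarrow> u t \<in> L2 M" and v: "\<And>t. t \<ge> 0 \<Longrightarrow> v t \<in> L2 M"
    and d: "has_derivative_in (L2_norm M) u v" and t: "t \<ge> 0"
  shows "((\<lambda>s. fc (u s) q) has_vector_derivative fc (v t) q) (at t within {0..})"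
  unfolding has_vector_derivative_iff_quotient
proof (rule Lim_null_comparison)
  let ?C = "L2_norm M (\<lambda>x. of_real (mode sin sin q x)) / \<kappa>"
  have "((\<lambda>s. L2_norm M (\<lambda>x. (u s x - u t x) /\<^sub>R (s - t) - v t x)) \<longlongrightarrow> 0) (at t within {0..})"
    using d t unfolding has_derivative_in_def by blast
  from tendsto_mult_left_zero[OF this, of ?C]
  show "((\<lambda>s. L2_norm M (\<lambda>x. (u s x - u t x) /\<^sub>R (s - t) - v t x) * ?C) \<longlongrightarrow> 0) (at t within {0..})" .
  show "\<forall>\<^sub>F s in at t within {0..}. norm (norm ((fc (u s) q - fc (u t) q) /\<^sub>R (s - t) - fc (v t) q))
      \<le> L2_norm M (\<lambda>x. (u s x - u t x) /\<^sub>R (s - t) - v t x) * ?C"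
    unfolding eventually_at_filter
  proof (intro always_eventually allI impI)
    fix s :: real assume "s \<in> {0..}"
    then have L: "u s \<in> L2 M" "u t \<in> L2 M" "v t \<in> L2 M" using u v t by auto
    show "norm (norm ((fc (u s) q - fc (u t) q) /\<^sub>R (s - t) - fc (v t) q))
      \<le> L2_norm M (\<lambda>x. (u s x - u t x) /\<^sub>R (s - t) - v t x) * ?C"
      using fc_bound[OF fc_quotient(1)[OF L, of "s - t"], of q] unfolding fc_quotient(2)[OF L] by simp
  qed
qed

lemma has_derivative_in_L2_if_H1:
  "has_derivative_in (H1_norm \<Omega>) u v \<Longrightarrow> has_derivative_in (L2_norm M) u v"
  unfolding has_derivative_in_def
proof (intro allI impI)
  fix t :: real
  assume "\<forall>t\<ge>0. ((\<lambda>s. H1_norm \<Omega> (\<lambda>x. (u s x - u t x) /\<^sub>R (s - t) - v t x)) \<longlongrightarrow> 0) (at t within {0..})" "t \<ge> 0"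
  then have "((\<lambda>s. H1_norm \<Omega> (\<lambda>x. (u s x - u t x) /\<^sub>R (s - t) - v t x)) \<longlongrightarrow> 0) (at t within {0..})" by blast
  then show "((\<lambda>s. L2_norm M (\<lambda>x. (u s x - u t x) /\<^sub>R (s - t) - v t x)) \<longlongrightarrow> 0) (at t within {0..})"
    by (rule Lim_null_comparison[rotated]) (simp add: L2_norm_le_H1_norm)
qed

lemma H10_L2: "u \<in> H10 \<Omega> \<Longrightarrow> u \<in> L2 M"
  unfolding H10_def by (blast intro: H1_L2)

text \<open>Taking a Fourier coefficient is continuous, so it commutes with the time derivative, and on coefficients the
  Laplacian is multiplication by \<open>- lam\<close>: every coefficient is a harmonic oscillator.\<close>
lemma wave_coefficients:
  assumes dom: "\<And>t. t \<ge> 0 \<Longrightarrow> u t \<in> dom_laplacian \<Omega>" and v: "\<And>t. t \<ge> 0 \<Longrightarrow> v t \<in> H10 \<Omega>" and w: "\<And>t. t \<ge> 0 \<Longrightarrow> w t \<in> L2 M"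
    and uv: "has_derivative_in (H1_norm \<Omega>) u v" and vw: "has_derivative_in (L2_norm M) v w"
    and eq: "\<And>t. t \<ge> 0 \<Longrightarrow> AE x in M. w t x = laplacian \<Omega> (u t) x" and t: "t \<ge> 0"
  shows "((\<lambda>s. fc (u s) q) has_vector_derivative fc (v t) q) (at t within {0..})"
    and "((\<lambda>s. fc (v s) q) has_vector_derivative - of_real (lam q) * fc (u t) q) (at t within {0..})"
proof -
  show "((\<lambda>s. fc (u s) q) has_vector_derivative fc (v t) q) (at t within {0..})"
    by (rule fc_has_derivative[OF dom_L2[OF dom] H10_L2[OF v] has_derivative_in_L2_if_H1[OF uv] t])
  have "((\<lambda>s. fc (v s) q) has_vector_derivative fc (w t) q) (at t within {0..})"
    by (rule fc_has_derivative[OF H10_L2[OF v] w vw t])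
  also have "fc (w t) q = fc (laplacian \<Omega> (u t)) q"
    by (rule fc_cong_AE[OF L2_measurable[OF w[OF t]] L2_measurable[OF laplacian_L2[OF dom[OF t]]] eq[OF t]])
  also have "\<dots> = - of_real (lam q) * fc (u t) q" by (rule fc_laplacian[OF dom[OF t]])
  finally show "((\<lambda>s. fc (v s) q) has_vector_derivative - of_real (lam q) * fc (u t) q) (at t within {0..})" .
qed

lemma laplacian_diff:
  assumes u: "u \<in> dom_laplacian \<Omega>" and v: "v \<in> dom_laplacian \<Omega>"
  shows "AE x in M. laplacian \<Omega> (\<lambda>x. u x - v x) x = laplacian \<Omega> u x - laplacian \<Omega> v x"
    and "laplacian \<Omega> (\<lambda>x. u x - v x) \<in> L2 M"
proof -
  have H: "u \<in> H1 \<Omega>" "v \<in> H1 \<Omega>" and H2: "e \<in> Basis \<Longrightarrow> wp e u \<in> H1 \<Omega>" "e \<in> Basis \<Longrightarrow> wp e v \<in> H1 \<Omega>" for e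
    using u v unfolding dom_laplacian_def H2_def by blast+
  let ?w = "\<lambda>x. u x - v x"
  have w: "has_weak_partial \<Omega> e (wp e ?w)
      (\<lambda>x. wp e (wp e u) x - wp e (wp e v) x)" if e: "e \<in> Basis" for e
  proof (rule has_weak_partial_cong[OF e])
    have 1: "has_weak_partial \<Omega> e ?w (\<lambda>x. wp e u x - wp e v x)"
      by (intro has_weak_partial_diff H1_weak_partial H e)
    show "has_weak_partial \<Omega> e (\<lambda>x. wp e u x - wp e v x)
      (\<lambda>x. wp e (wp e u) x - wp e (wp e v) x)"
      by (intro has_weak_partial_diff H1_weak_partial H2 e)
    show "AE x in M. wp e u x - wp e v x = wp e ?w x"
      using weak_partial_eq[OF 1] by eventually_elim simp
    show "wp e ?w \<in> borel_measurable M"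
      using has_weak_partial_weak_partial[OF 1] by (auto simp: has_weak_partial_def L2_def)
  qed
  note ae = weak_partial_eq[OF w[OF basis_vectors(1)]] weak_partial_eq[OF w[OF basis_vectors(2)]]
  have lap: "laplacian \<Omega> f x = wp (1, 0) (wp (1, 0) f) x + wp (0, 1) (wp (0, 1) f) x" for f x
    by (simp add: laplacian_def Basis_prod_def)
  show "AE x in M. laplacian \<Omega> ?w x = laplacian \<Omega> u x - laplacian \<Omega> v x"
    using ae by eventually_elim (simp add: lap)
  have "wp e (wp e ?w) \<in> L2 M" if "e \<in> Basis" for e
    using has_weak_partial_weak_partial[OF w[OF that]] by (simp add: has_weak_partial_def)
  then show "laplacian \<Omega> ?w \<in> L2 M"
    unfolding lap[abs_def] by (intro L2_add) (simp_all add: basis_vectors)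
qed

text \<open>This is where the continuity of \<open>t \<mapsto> u(t)\<close> in \<open>H\<^sup>2\<close> enters: it makes the observation bounded in time, and so
  integrable.\<close>
lemma dom_norm_bounded:
  assumes dom: "\<And>t. t \<ge> 0 \<Longrightarrow> u t \<in> dom_laplacian \<Omega>" and c: "continuous_in (dom_norm \<Omega>) u"
  shows "\<exists>K. \<forall>t\<in>{0..T}. dom_norm \<Omega> (u t) \<le> K"
proof -
  have "((\<lambda>s. dom_norm \<Omega> (u s)) \<longlongrightarrow> dom_norm \<Omega> (u t)) (at t within {0..})" if t: "t \<ge> 0" for t
  proof (rule Lim_null[THEN iffD2], rule Lim_null_comparison)
    show "((\<lambda>s. dom_norm \<Omega> (\<lambda>x. u s x - u t x)) \<longlongrightarrow> 0) (at t within {0..})"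
      using c t unfolding continuous_in_def by blast
    show "\<forall>\<^sub>F s in at t within {0..}. norm (dom_norm \<Omega> (u s) - dom_norm \<Omega> (u t)) \<le> dom_norm \<Omega> (\<lambda>x. u s x - u t x)"
      unfolding eventually_at_filter
    proof (intro always_eventually allI impI)
      fix s :: real assume "s \<in> {0..}"
      then have d: "u s \<in> dom_laplacian \<Omega>" "u t \<in> dom_laplacian \<Omega>" using dom t by auto
      have "L2_norm M (laplacian \<Omega> (\<lambda>x. u s x - u t x)) = L2_norm M (\<lambda>x. laplacian \<Omega> (u s) x - laplacian \<Omega> (u t) x)"
        by (rule L2_norm_cong_AE[OF _ _ laplacian_diff(1)[OF d]])
          (intro L2_measurable L2_diff laplacian_L2 laplacian_diff(2) d)+
      then show "norm (dom_norm \<Omega> (u s) - dom_norm \<Omega> (u t)) \<le> dom_norm \<Omega> (\<lambda>x. u s x - u t x)"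
        using L2_norm_abs_diff[OF laplacian_L2[OF d(1)] laplacian_L2[OF d(2)]] by (simp add: dom_norm_def)
    qed
  qed
  then have "continuous_on {0..} (\<lambda>t. dom_norm \<Omega> (u t))" by (auto simp: continuous_on_def)
  then have "compact ((\<lambda>t. dom_norm \<Omega> (u t)) ` {0..T})"
    by (intro compact_continuous_image continuous_on_subset[of "{0..}" _ "{0..T}"]) auto
  then have "bounded ((\<lambda>t. dom_norm \<Omega> (u t)) ` {0..T})" by (rule compact_imp_bounded)
  then obtain K where "\<forall>y\<in>(\<lambda>t. dom_norm \<Omega> (u t)) ` {0..T}. norm y \<le> K" unfolding bounded_iff by blast
  then show ?thesis by (auto intro!: exI[of _ K])
qed

lemma energy_tendsto:
  assumes u: "u \<in> dom_laplacian \<Omega>" and v: "v \<in> L2 M"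
  shows "(\<lambda>N. energy (fc u) (fc v) N) \<longlonglongrightarrow> (grad_norm \<Omega> u)\<^sup>2 + (L2_norm M v)\<^sup>2"
proof -
  have L: "wp e u \<in> L2 M" if "e \<in> Basis" for e
    using u that unfolding dom_laplacian_def H2_def by (blast intro: weak_partial_L2)
  have "(\<lambda>N. L2_norm M (tsum cos sin (dx (fc u)) N)) \<longlonglongrightarrow> L2_norm M (wp (1, 0) u)"
    by (rule L2_norm_tendsto[OF tsum_L2 L[OF basis_vectors(1)] fourier_gradient_tendsto(1)[OF u]]) auto
  moreover have "(\<lambda>N. L2_norm M (tsum sin cos (dy (fc u)) N)) \<longlonglongrightarrow> L2_norm M (wp (0, 1) u)"
    by (rule L2_norm_tendsto[OF tsum_L2 L[OF basis_vectors(2)] fourier_gradient_tendsto(2)[OF u]]) auto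
  moreover have "(\<lambda>N. L2_norm M (tsum sin sin (fc v) N)) \<longlonglongrightarrow> L2_norm M v"
    by (rule L2_norm_tendsto[OF tsum_L2 v fourier_tendsto[OF v]]) auto
  ultimately have "(\<lambda>N. energy (fc u) (fc v) N) \<longlonglongrightarrow>
      (L2_norm M (wp (1, 0) u))\<^sup>2 + (L2_norm M (wp (0, 1) u))\<^sup>2 + (L2_norm M v)\<^sup>2"
    unfolding energy_def gradient_energy_def by (intro tendsto_intros)
  also have "(L2_norm M (wp (1, 0) u))\<^sup>2 + (L2_norm M (wp (0, 1) u))\<^sup>2 = (grad_norm \<Omega> u)\<^sup>2"
    by (simp add: grad_norm_def Basis_prod_def)
  finally show ?thesis .
qed

lemma grad_norm_cong_AE:
  assumes u: "u \<in> H1 \<Omega>" and v: "v \<in> borel_measurable M" and ae: "AE x in M. u x = v x"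
  shows "grad_norm \<Omega> v = grad_norm \<Omega> u"
proof -
  have "L2_norm M (wp e v) = L2_norm M (wp e u)" if "e \<in> Basis" for e
    by (rule L2_norm_weak_partial[OF has_weak_partial_cong[OF that H1_weak_partial[OF u that] v ae]])
  then show ?thesis by (simp add: grad_norm_def)
qed

lemma observation_sq_eq: "observation_sq a b \<Gamma> u = (L2_norm \<sigma> (\<lambda>p. indicator \<Gamma> p * normal_derivative a b u p))\<^sup>2"
  unfolding observation_sq_def L2_norm_sq set_lebesgue_integral_def
  by (intro Bochner_Integration.integral_cong refl) (simp add: indicator_def)

lemma observation_tendsto:
  assumes \<Gamma>: "\<Gamma> \<in> sets borel" and u: "u \<in> dom_laplacian \<Omega>"
  shows "(\<lambda>N. (L2_norm \<sigma> (\<lambda>p. indicator \<Gamma> p * normal_sum (fc u) N p))\<^sup>2) \<longlonglongrightarrow> observation_sq a b \<Gamma> u"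
  unfolding observation_sq_eq
proof (intro tendsto_power L2_norm_tendsto restricted_normal_sum_L2[OF \<Gamma>] normal_sum_L2 normal_sum_tendsto(1)[OF u])
  show "(\<lambda>N. L2_norm \<sigma> (\<lambda>p. indicator \<Gamma> p * normal_sum (fc u) N p - indicator \<Gamma> p * normal_derivative a b u p)) \<longlonglongrightarrow> 0"
  proof (rule Lim_null_comparison[OF _ normal_sum_tendsto(2)[OF u]], intro always_eventually allI)
    fix N
    have "L2_norm \<sigma> (\<lambda>p. indicator \<Gamma> p * (normal_sum (fc u) N p - normal_derivative a b u p))
        \<le> 1 * L2_norm \<sigma> (\<lambda>p. normal_sum (fc u) N p - normal_derivative a b u p)"
      by (rule L2_norm_mult_bounded[OF L2_diff[OF normal_sum_L2 normal_sum_tendsto(1)[OF u]]])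
        (use \<Gamma> in \<open>auto simp: indicator_def\<close>)
    then show "norm (L2_norm \<sigma> (\<lambda>p. indicator \<Gamma> p * normal_sum (fc u) N p - indicator \<Gamma> p * normal_derivative a b u p))
        \<le> L2_norm \<sigma> (\<lambda>p. normal_sum (fc u) N p - normal_derivative a b u p)"
      by (simp add: right_diff_distrib)
  qed
qed

lemma restricted_normal_sum_bound:
  assumes \<Gamma>: "\<Gamma> \<in> sets borel" and u: "u \<in> dom_laplacian \<Omega>"
  shows "L2_norm \<sigma> (\<lambda>p. indicator \<Gamma> p * normal_sum (fc u) N p) \<le> normal_const * dom_norm \<Omega> u"
proof -
  have "L2_norm \<sigma> (\<lambda>p. indicator \<Gamma> p * normal_sum (fc u) N p) \<le> 1 * L2_norm \<sigma> (normal_sum (fc u) N)"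
    by (rule L2_norm_mult_bounded[OF normal_sum_L2]) (use \<Gamma> in \<open>auto simp: indicator_def\<close>)
  then show ?thesis using normal_sum_bound[OF u, of N] by linarith
qed

text \<open>Each partial sum of the sine series of the solution satisfies the estimate. On the left the energies converge,
  on the right the observations do, dominated by a constant on \<open>[0, T]\<close>.\<close>
lemma observability:
  assumes \<Gamma>: "\<Gamma> \<in> sets borel" and x0: "x0 \<in> {0, A}" and y0: "y0 \<in> {0, B}"
    and sides: "{0<..<A} \<times> {B - y0} \<subseteq> \<Gamma>" "{A - x0} \<times> {0<..<B} \<subseteq> \<Gamma>"
    and u0: "u0 \<in> L2 M" and v0: "v0 \<in> L2 M"
    and sol: "wave_solution \<Omega> u0 v0 u" and T: "T \<ge> 4 * (A + B) + 1"
  shows "1 / (A + B) * ((grad_norm \<Omega> u0)\<^sup>2 + (L2_norm M v0)\<^sup>2) \<le> (LINT t:{0..T}|lborel. observation_sq a b \<Gamma> (u t))"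
proof -
  obtain v w where all: "\<forall>t\<ge>0. u t \<in> dom_laplacian \<Omega> \<and> v t \<in> H10 \<Omega> \<and> w t \<in> L2 M"
    and cu: "continuous_in (dom_norm \<Omega>) u"
    and uv: "has_derivative_in (H1_norm \<Omega>) u v" and vw: "has_derivative_in (L2_norm M) v w"
    and eqs: "\<forall>t\<ge>0. AE x in M. w t x = laplacian \<Omega> (u t) x"
    and i0: "AE x in M. u 0 x = u0 x" and i1: "AE x in M. v 0 x = v0 x"
    using sol unfolding wave_solution_def by (elim exE conjE) (rule that)
  have dom: "u t \<in> dom_laplacian \<Omega>" and v: "v t \<in> H10 \<Omega>" and w: "w t \<in> L2 M"
    and eq: "AE x in M. w t x = laplacian \<Omega> (u t) x" if "t \<ge> 0" for t
    using all eqs that by blast+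
  have T0: "T \<ge> 0" by (rule order_trans[OF _ T]) (use A_pos B_pos in simp)
  let ?q = "\<lambda>N t. (L2_norm \<sigma> (\<lambda>p. indicator \<Gamma> p * normal_sum (fc (u t)) N p))\<^sup>2"
  note wc = wave_coefficients[OF dom v w uv vw eq]
  have dc: "((\<lambda>s. fc (u s) q) has_vector_derivative fc (v t) q) (at t within {0..T})"
    and dd: "((\<lambda>s. fc (v s) q) has_vector_derivative - of_real (lam q) * fc (u t) q) (at t within {0..T})" if t: "t \<in> {0..T}" for t q
    using has_vector_derivative_within_subset[OF wc(1)[of t q], of "{0..T}"] has_vector_derivative_within_subset[OF wc(2)[of t q], of "{0..T}"] t
    by auto
  note fo = finite_observability[OF x0 y0 T0 dc dd]
  have cont: "continuous_on {0..T} (?q N)" for N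
    by (rule observation_continuous[OF \<Gamma>])
      (auto simp: continuous_on_eq_continuous_within intro: has_vector_derivative_continuous[OF dc])
  obtain K where K: "\<And>t. t \<in> {0..T} \<Longrightarrow> dom_norm \<Omega> (u t) \<le> K"
    using dom_norm_bounded[OF dom cu, of T] by blast
  have nc: "normal_const \<ge> 0" using trace_const_pos by (simp add: normal_const_def)
  have q_bound: "?q N t \<le> (normal_const * K)\<^sup>2" if t: "t \<in> {0..T}" for N t
  proof (rule power_mono)
    have "L2_norm \<sigma> (\<lambda>p. indicator \<Gamma> p * normal_sum (fc (u t)) N p) \<le> normal_const * dom_norm \<Omega> (u t)"
      using t by (intro restricted_normal_sum_bound \<Gamma> dom) auto
    also have "\<dots> \<le> normal_const * K" by (intro mult_left_mono K t nc)
    finally show "L2_norm \<sigma> (\<lambda>p. indicator \<Gamma> p * normal_sum (fc (u t)) N p) \<le> normal_const * K" .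
  qed simp
  have lim: "(\<lambda>N. (LINT t:{0..T}|lborel. ?q N t)) \<longlonglongrightarrow> (LINT t:{0..T}|lborel. observation_sq a b \<Gamma> (u t))"
    unfolding set_lebesgue_integral_def
  proof (rule integral_dominated_convergence[where w="\<lambda>t. indicator {0..T} t *\<^sub>R (normal_const * K)\<^sup>2"])
    show m: "(\<lambda>t. indicator {0..T} t *\<^sub>R ?q N t) \<in> borel_measurable lborel" for N
      using borel_measurable_continuous_on_indicator[OF _ cont[of N]] by simp
    show l: "AE t in lborel. (\<lambda>N. indicator {0..T} t *\<^sub>R ?q N t) \<longlonglongrightarrow> indicator {0..T} t *\<^sub>R observation_sq a b \<Gamma> (u t)"
    proof (rule AE_I2)
      fix t :: real
      show "(\<lambda>N. indicator {0..T} t *\<^sub>R ?q N t) \<longlonglongrightarrow> indicator {0..T} t *\<^sub>R observation_sq a b \<Gamma> (u t)"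
        using observation_tendsto[OF \<Gamma> dom[of t]] by (cases "t \<in> {0..T}") (auto intro!: tendsto_intros)
    qed
    show "(\<lambda>t. indicator {0..T} t *\<^sub>R observation_sq a b \<Gamma> (u t)) \<in> borel_measurable lborel"
    proof (rule borel_measurable_LIMSEQ_real[OF _ m])
      fix t :: real
      show "(\<lambda>N. indicator {0..T} t *\<^sub>R ?q N t) \<longlonglongrightarrow> indicator {0..T} t *\<^sub>R observation_sq a b \<Gamma> (u t)"
        using observation_tendsto[OF \<Gamma> dom[of t]] by (cases "t \<in> {0..T}") (auto intro!: tendsto_intros)
    qed
    show "integrable lborel (\<lambda>t. indicator {0..T} t *\<^sub>R (normal_const * K)\<^sup>2)"
      unfolding real_scaleR_def by (intro integrable_mult_left integrable_real_indicator emeasure_bounded_finite) auto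
    show "AE t in lborel. norm (indicator {0..T} t *\<^sub>R ?q N t) \<le> indicator {0..T} t *\<^sub>R (normal_const * K)\<^sup>2" for N
      using q_bound by (intro AE_I2) (auto simp: indicator_def)
  qed
  have le: "1 / (A + B) * energy (fc (u 0)) (fc (v 0)) N \<le> (LINT t:{0..T}|lborel. ?q N t)" for N
  proof -
    have E0: "0 \<le> energy (fc (u 0)) (fc (v 0)) N" by (simp add: energy_def gradient_energy_def)
    \<comment> \<open>By the choice of \<open>T\<close>, at least one energy is left.\<close>
    have "1 * energy (fc (u 0)) (fc (v 0)) N \<le> (T - 4 * (A + B)) * energy (fc (u 0)) (fc (v 0)) N"
      by (rule mult_right_mono[OF _ E0]) (use T in simp)
    also have "\<dots> \<le> integral {0..T} (\<lambda>t. boundary_energy x0 y0 (fc (u t)) N)" by (rule fo(2))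
    also have "\<dots> \<le> integral {0..T} (\<lambda>t. (A + B) * ?q N t)"
      by (intro integral_le fo(1) integrable_continuous_interval continuous_intros cont boundary_energy_le_observation \<Gamma> x0 y0 sides)
    also have "\<dots> = (A + B) * integral {0..T} (?q N)" by simp
    also have "integral {0..T} (?q N) = (LINT t:{0..T}|lborel. ?q N t)"
      by (rule set_borel_integral_eq_integral(2)[symmetric]) (rule borel_integrable_atLeastAtMost'[OF cont])
    finally show ?thesis using A_pos B_pos by (simp add: divide_le_eq mult.commute)
  qed
  have "(\<lambda>N. 1 / (A + B) * energy (fc (u 0)) (fc (v 0)) N) \<longlonglongrightarrow> 1 / (A + B) * ((grad_norm \<Omega> (u 0))\<^sup>2 + (L2_norm M (v 0))\<^sup>2)"
    by (intro tendsto_intros energy_tendsto dom H10_L2 v) auto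
  from LIMSEQ_le[OF this lim] le
  have "1 / (A + B) * ((grad_norm \<Omega> (u 0))\<^sup>2 + (L2_norm M (v 0))\<^sup>2) \<le> (LINT t:{0..T}|lborel. observation_sq a b \<Gamma> (u t))"
    by blast
  moreover have "grad_norm \<Omega> u0 = grad_norm \<Omega> (u 0)"
    by (rule grad_norm_cong_AE[OF _ L2_measurable[OF u0] i0]) (use dom[of 0] in \<open>auto simp: dom_laplacian_def H10_def\<close>)
  moreover have "L2_norm M (v 0) = L2_norm M v0"
    by (rule L2_norm_cong_AE[OF L2_measurable[OF H10_L2[OF v]] L2_measurable[OF v0] i1]) simp
  ultimately show ?thesis by simp
qed

end

section \<open>Exact observability\<close>

text \<open>This is why constants that depend on the side lengths are functions of \<open>\<Gamma>\<close> alone.\<close>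
lemma touching_sides_determine_rectangle:
  assumes a: "a > 0" and b: "b > 0" and sub: "\<Gamma> \<subseteq> frontier (rectangle a b)" and sides: "contains_touching_sides a b \<Gamma>"
  shows "Sup (fst ` \<Gamma>) = a * pi" and "Sup (snd ` \<Gamma>) = b * pi"
proof -
  interpret rect a b by unfold_locales fact+
  have "closure \<Omega> \<subseteq> cbox (0, 0) (A, B)"
    by (rule closure_minimal[OF rectangle_subset_cbox closed_cbox])
  then have box: "\<Gamma> \<subseteq> cbox (0, 0) (A, B)" using sub by (auto simp: frontier_def)
  obtain y where y: "{0<..<A} \<times> {y} \<subseteq> \<Gamma>" using sides unfolding contains_touching_sides_def horizontal_sides_def A_def by blast
  obtain x where x: "{x} \<times> {0<..<B} \<subseteq> \<Gamma>" using sides unfolding contains_touching_sides_def vertical_sides_def B_def by blast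
  have *: "Sup S = L" if "S \<subseteq> {..L}" "{0<..<L} \<subseteq> S" "L > 0" for S :: "real set" and L
  proof (rule antisym)
    have ne: "S \<noteq> {}" using that(2,3) dense[of 0 L] by auto
    show "Sup S \<le> L" using that(1) ne by (intro cSup_least) auto
    have "bdd_above S" using that(1) by (intro bdd_aboveI[of _ L]) auto
    then have "Sup {0<..<L} \<le> Sup S" using that(2,3) by (intro cSup_subset_mono) auto
    then show "L \<le> Sup S" using that(3) by simp
  qed
  have "{0<..<A} \<subseteq> fst ` \<Gamma>" using y by force
  moreover have "fst ` \<Gamma> \<subseteq> {..A}" using box by force
  ultimately show "Sup (fst ` \<Gamma>) = a * pi" using * A_pos unfolding A_def by blast
  have "{0<..<B} \<subseteq> snd ` \<Gamma>" using x by force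
  moreover have "snd ` \<Gamma> \<subseteq> {..B}" using box by force
  ultimately show "Sup (snd ` \<Gamma>) = b * pi" using * B_pos unfolding B_def by blast
qed

theorem theorem4p1:
  "\<exists>(c :: (real \<times> real) set \<Rightarrow> real \<Rightarrow> real) (T\<^sub>0 :: (real \<times> real) set \<Rightarrow> real \<Rightarrow> real).
     \<forall>(a :: real) (b :: real) (\<Gamma> :: (real \<times> real) set).
       a > 0 \<and> b > 0 \<and> \<Gamma> \<noteq> {} \<and>
       openin (top_of_set (frontier (rectangle a b))) \<Gamma> \<and>
       contains_touching_sides a b \<Gamma> \<longrightarrow>
       c \<Gamma> (observation_norm a b \<Gamma>) > 0 \<and>
       T\<^sub>0 \<Gamma> (observation_norm a b \<Gamma>) > 0 \<and>
       (\<forall>u0 \<in> H2 (rectangle a b) \<inter> H10 (rectangle a b). \<forall>v0 \<in> H10 (rectangle a b).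
        \<forall>u. wave_solution (rectangle a b) u0 v0 u \<longrightarrow>
         (\<forall>T \<ge> T\<^sub>0 \<Gamma> (observation_norm a b \<Gamma>).
            c \<Gamma> (observation_norm a b \<Gamma>) *
              ((grad_norm (rectangle a b) u0)\<^sup>2 + (L2_norm (lebesgue_on (rectangle a b)) v0)\<^sup>2)
            \<le> (LINT t:{0..T}|lborel. (LINT p:\<Gamma>|boundary_measure a b.
                 (cmod (normal_derivative a b (u t) p))\<^sup>2))))"
proof (intro exI allI impI, elim conjE)
  define S :: "(real \<times> real) set \<Rightarrow> real" where "S \<Gamma> = Sup (fst ` \<Gamma>) + Sup (snd ` \<Gamma>)" for \<Gamma>
  let ?c = "\<lambda>\<Gamma> (_ :: real). 1 / S \<Gamma>" and ?T = "\<lambda>\<Gamma> (_ :: real). 4 * S \<Gamma> + 1"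
  fix a b :: real and \<Gamma> :: "(real \<times> real) set"
  assume a: "a > 0" and b: "b > 0" and op: "openin (top_of_set (frontier (rectangle a b))) \<Gamma>" and sides: "contains_touching_sides a b \<Gamma>"
  interpret rect a b by unfold_locales fact+
  have sub: "\<Gamma> \<subseteq> frontier \<Omega>" using openin_imp_subset[OF op] .
  have S_eq: "S \<Gamma> = A + B"
    using touching_sides_determine_rectangle[OF a b sub sides] by (simp add: S_def A_def B_def)
  obtain U where U: "open U" "\<Gamma> = frontier \<Omega> \<inter> U" using op by (auto simp: openin_open)
  have \<Gamma>: "\<Gamma> \<in> sets borel" unfolding U(2) using U(1) by (intro sets.Int borel_closed borel_open frontier_closed)
  obtain y0 where y0: "y0 \<in> {0, B}" "{0<..<A} \<times> {B - y0} \<subseteq> \<Gamma>"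
    using sides unfolding contains_touching_sides_def horizontal_sides_def A_def[symmetric] B_def[symmetric] by force
  obtain x0 where x0: "x0 \<in> {0, A}" "{A - x0} \<times> {0<..<B} \<subseteq> \<Gamma>"
    using sides unfolding contains_touching_sides_def vertical_sides_def A_def[symmetric] B_def[symmetric] by force
  show "?c \<Gamma> (observation_norm a b \<Gamma>) > 0 \<and> ?T \<Gamma> (observation_norm a b \<Gamma>) > 0 \<and>
       (\<forall>u0 \<in> H2 \<Omega> \<inter> H10 \<Omega>. \<forall>v0 \<in> H10 \<Omega>. \<forall>u. wave_solution \<Omega> u0 v0 u \<longrightarrow>
         (\<forall>T \<ge> ?T \<Gamma> (observation_norm a b \<Gamma>).
            ?c \<Gamma> (observation_norm a b \<Gamma>) * ((grad_norm \<Omega> u0)\<^sup>2 + (L2_norm M v0)\<^sup>2)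
            \<le> (LINT t:{0..T}|lborel. (LINT p:\<Gamma>|boundary_measure a b. (cmod (normal_derivative a b (u t) p))\<^sup>2))))"
  proof (intro conjI ballI allI impI)
    show "1 / S \<Gamma> > 0" "4 * S \<Gamma> + 1 > 0" unfolding S_eq using A_pos B_pos by simp_all
    fix u0 v0 u T
    assume "u0 \<in> H2 \<Omega> \<inter> H10 \<Omega>" "v0 \<in> H10 \<Omega>" "wave_solution \<Omega> u0 v0 u" "4 * S \<Gamma> + 1 \<le> T"
    then show "1 / S \<Gamma> * ((grad_norm \<Omega> u0)\<^sup>2 + (L2_norm M v0)\<^sup>2)
        \<le> (LINT t:{0..T}|lborel. (LINT p:\<Gamma>|boundary_measure a b. (cmod (normal_derivative a b (u t) p))\<^sup>2))"
      using observability[OF \<Gamma> x0(1) y0(1) y0(2) x0(2), of u0 v0 u T] unfolding S_eq observation_sq_def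
      by (simp add: H10_L2)
  qed
qed

end
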